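(* Let $\kappa$ be a kernel on a ground space $(\mathcal S,\mu)$, with $\|T_\kappa\|>0$. Suppose that $\kappa$ is irreducible, and that $$\sup_{x\in\mathcal S}\int_{\mathcal S}\kappa(x,y)^2\,d\mu(y)<\infty .$$ (i) The function $c\mapsto\rho(c):=\rho(c\kappa)$, $c>0$, is analytic except at $c_0:=\|T_\kappa\|^{-1}$. (ii) The linear operator $T_\kappa$ has an eigenfunction $\psi$ of eigenvalue $\|T_\kappa\|<\infty$, and every such eigenfunction is bounded and satisfies $$\rho(c_0+\varepsilon)=2c_0^{-1}\,\frac{\int_{\mathcal S}\psi\,d\mu\int_{\mathcal S}\psi^2\,d\mu}{\int_{\mathcal S}\psi^3\,d\mu}\,\varepsilon+O(\varepsilon^2),\qquad\varepsilon>0,$$ so $\rho'_+(c_0)=2c_0^{-1}\int_{\mathcal S}\psi\int_{\mathcal S}\psi^2\big/\int_{\mathcal S}\psi^3>0$ and $\rho$ has a phase transition at $c_0$ with exponent $1$.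
   Context: A ground space is a pair $(\mathcal S,\mu)$, where $\mathcal S$ is a separable metric space and $\mu$ is a Borel probability measure on $\mathcal S$. A kernel on $(\mathcal S,\mu)$ is a symmetric non-negative Borel measurable function on $\mathcal S\times\mathcal S$. It is irreducible if $A\subseteq\mathcal S$ measurable and $\kappa=0$ a.e. on $A\times(\mathcal S\setminus A)$ imply $\mu(A)=0$ or $\mu(\mathcal S\setminus A)=0$. $(T_\kappa f)(x)=\int_{\mathcal S}\kappa(x,y)f(y)\,d\mu(y)$, and $\|T_\kappa\|=\sup\{\|T_\kappa f\|_{L^2(\mu)}: f\ge0,\ \|f\|_{L^2(\mu)}\le1\}$; eigenfunctions are non-zero elements of $L^2(\mathcal S,\mu)$ (so boundedness is understood up to null sets). Branching process. $\mathfrak X_\kappa(x)$ is the multi-type Galton–Watson process with type space $\mathcal S$ started with one particle of type $x$, in which the children of a particle of type $y$ form a Poisson process on $\mathcal S$ with intensity $\kappa(y,z)\,d\mu(z)$. $\rho(\kappa;x)$ is the probability that $\mathfrak X_\kappa(x)$ survives for ever (every generation non-empty), and $\rho(\kappa)=\int_{\mathcal S}\rho(\kappa;x)\,d\mu(x)$. A real function is analytic at a point if it is given by the sum of a convergent power series in a neighbourhood of that point. $\rho'_+$ denotes the right derivative. The $O(\varepsilon^2)$ is as $\varepsilon\downarrow0$. The phase transition at $c_0$ (where $\rho(c)=0$ for $c\le c_0$ and $\rho(c)>0$ for $c>c_0$) has exponent $k$ if $\rho(c_0+\varepsilon)=\Theta(\varepsilon^k)$ as $\varepsilon\downarrow0$.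 *)

theory Defs
  imports "HOL-Probability.Probability" "HOL-Library.Landau_Symbols"
begin

text \<open>
  A separable metric space is a type of class \<open>metric_space\<close> and
  \<open>second_countable_topology\<close>; for metric spaces second countability is separability.
\<close>

definition ground_space :: "'a::{metric_space, second_countable_topology} measure \<Rightarrow> bool" where
  "ground_space \<mu> \<longleftrightarrow> prob_space \<mu> \<and> sets \<mu> = sets borel"

definition is_kernel :: "('a::{metric_space, second_countable_topology} \<Rightarrow> 'a \<Rightarrow> real) \<Rightarrow> bool" where
  "is_kernel \<kappa> \<longleftrightarrow>
     (\<forall>x y. \<kappa> x y = \<kappa> y x) \<and> (\<forall>x y. 0 \<le> \<kappa> x y) \<and> (\<lambda>(x, y). \<kappa> x y) \<in> borel_measurable borel"

definition irreducible_kernel :: "'a measure \<Rightarrow> ('a \<Rightarrow> 'a \<Rightarrow> real) \<Rightarrow> bool" where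
  "irreducible_kernel \<mu> \<kappa> \<longleftrightarrow>
     (\<forall>A\<in>sets \<mu>. (AE (x, y) in \<mu> \<Otimes>\<^sub>M \<mu>. x \<in> A \<and> y \<in> space \<mu> - A \<longrightarrow> \<kappa> x y = 0) \<longrightarrow>
        emeasure \<mu> A = 0 \<or> emeasure \<mu> (space \<mu> - A) = 0)"


section \<open>The integral operator\<close>

definition L2_norm :: "'a measure \<Rightarrow> ('a \<Rightarrow> ennreal) \<Rightarrow> ennreal" where
  "L2_norm \<mu> g =
     (let I = \<integral>\<^sup>+ x. (g x)\<^sup>2 \<partial>\<mu> in if I = \<infinity> then \<infinity> else ennreal (sqrt (enn2real I)))"

text \<open>
  For non-negative \<open>f\<close> the function \<open>T f\<close> takes values in \<open>[0, \<infinity>]\<close> and may have infinite norm,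
  so the norm of the operator is an extended non-negative real.
\<close>

definition kernel_op_norm :: "'a measure \<Rightarrow> ('a \<Rightarrow> 'a \<Rightarrow> real) \<Rightarrow> ennreal" where
  "kernel_op_norm \<mu> \<kappa> =
     (SUP f \<in> {f :: 'a \<Rightarrow> real. f \<in> borel_measurable \<mu> \<and> (\<forall>x. 0 \<le> f x) \<and>
                              L2_norm \<mu> (\<lambda>x. ennreal (f x)) \<le> 1}.
        L2_norm \<mu> (\<lambda>x. \<integral>\<^sup>+ y. ennreal (\<kappa> x y * f y) \<partial>\<mu>))"

definition kernel_op :: "'a measure \<Rightarrow> ('a \<Rightarrow> 'a \<Rightarrow> real) \<Rightarrow> ('a \<Rightarrow> real) \<Rightarrow> 'a \<Rightarrow> real" where
  "kernel_op \<mu> \<kappa> f x = (\<integral>y. \<kappa> x y * f y \<partial>\<mu>)"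

text \<open>
  Elements of \<open>L\<^sup>2\<close> are represented by functions up to null sets. Since the Bochner integral of a
  non-integrable function is 0, convergence of the defining integral is required separately.
\<close>

definition eigenfunction ::
    "'a measure \<Rightarrow> ('a \<Rightarrow> 'a \<Rightarrow> real) \<Rightarrow> real \<Rightarrow> ('a \<Rightarrow> real) \<Rightarrow> bool" where
  "eigenfunction \<mu> \<kappa> r \<psi> \<longleftrightarrow>
     \<psi> \<in> borel_measurable \<mu> \<and> integrable \<mu> (\<lambda>x. (\<psi> x)\<^sup>2) \<and> \<not> (AE x in \<mu>. \<psi> x = 0) \<and>
     (AE x in \<mu>. integrable \<mu> (\<lambda>y. \<kappa> x y * \<psi> y) \<and> kernel_op \<mu> \<kappa> \<psi> x = r * \<psi> x)"

definition ess_bounded :: "'a measure \<Rightarrow> ('a \<Rightarrow> real) \<Rightarrow> bool" where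
  "ess_bounded \<mu> f \<longleftrightarrow> (\<exists>B. AE x in \<mu>. \<bar>f x\<bar> \<le> B)"


section \<open>The branching process\<close>

text \<open>
  A finite population is the list of the types of its particles, in an arbitrary enumeration.
  The \<open>\<sigma>\<close>-algebra is that of the disjoint union over \<open>n\<close> of the \<open>n\<close>-fold product spaces: it is
  generated by the sets \<open>A\<^sub>1 \<times> \<dots> \<times> A\<^sub>n\<close>.
\<close>

definition population_space :: "'a::topological_space list measure" where
  "population_space = sigma UNIV (listset ` lists (sets borel))"

primrec iid_points :: "'a::topological_space measure \<Rightarrow> nat \<Rightarrow> 'a list measure" where
  "iid_points P 0 = return population_space []"
| "iid_points P (Suc n) =
     P \<bind> (\<lambda>z. iid_points P n \<bind> (\<lambda>zs. return population_space (z # zs)))"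

text \<open>
  The Poisson process whose intensity measure \<open>\<nu>\<close> is finite: the number of points is Poisson with
  mean \<open>\<nu>(S)\<close> and, given their number, the points are independent with law \<open>\<nu>/\<nu>(S)\<close>.
\<close>

definition poisson_process :: "'a::topological_space measure \<Rightarrow> 'a list measure" where
  "poisson_process \<nu> =
     (if emeasure \<nu> (space \<nu>) = 0 then return population_space []
      else measure_pmf (poisson_pmf (measure \<nu> (space \<nu>))) \<bind>
             iid_points (uniform_measure \<nu> (space \<nu>)))"

definition offspring ::
    "'a::topological_space measure \<Rightarrow> ('a \<Rightarrow> 'a \<Rightarrow> real) \<Rightarrow> 'a \<Rightarrow> 'a list measure" where
  "offspring \<mu> \<kappa> y = poisson_process (density \<mu> (\<lambda>z. ennreal (\<kappa> y z)))"

text \<open>The particles of a generation have independent families of children.\<close>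

primrec next_generation ::
    "'a::topological_space measure \<Rightarrow> ('a \<Rightarrow> 'a \<Rightarrow> real) \<Rightarrow> 'a list \<Rightarrow> 'a list measure" where
  "next_generation \<mu> \<kappa> [] = return population_space []"
| "next_generation \<mu> \<kappa> (y # ys) =
     offspring \<mu> \<kappa> y \<bind> (\<lambda>zs. next_generation \<mu> \<kappa> ys \<bind> (\<lambda>ws. return population_space (zs @ ws)))"

primrec generation_kernel ::
    "'a::topological_space measure \<Rightarrow> ('a \<Rightarrow> 'a \<Rightarrow> real) \<Rightarrow> 'a \<Rightarrow> nat \<Rightarrow> (nat \<Rightarrow> 'a list) \<Rightarrow> 'a list measure"
where
  "generation_kernel \<mu> \<kappa> x 0 \<omega> = return population_space [x]"
| "generation_kernel \<mu> \<kappa> x (Suc n) \<omega> = next_generation \<mu> \<kappa> (\<omega> n)"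

text \<open>
  The law, on sequences of populations, of the generations of the process started with one particle
  of type \<open>x\<close>: the Ionescu-Tulcea extension of the kernels giving generation \<open>n\<close> conditionally on
  the earlier generations. It is meaningful if every \<open>\<integral> \<kappa>(y, z) d\<mu>(z)\<close> is finite.
\<close>

definition branching_process ::
    "'a::topological_space measure \<Rightarrow> ('a \<Rightarrow> 'a \<Rightarrow> real) \<Rightarrow> 'a \<Rightarrow> (nat \<Rightarrow> 'a list) measure" where
  "branching_process \<mu> \<kappa> x =
     projective_family.lim UNIV
       (Ionescu_Tulcea.CI (generation_kernel \<mu> \<kappa> x) (\<lambda>_. population_space)) (\<lambda>_. population_space)"

definition survival_from ::
    "'a::topological_space measure \<Rightarrow> ('a \<Rightarrow> 'a \<Rightarrow> real) \<Rightarrow> 'a \<Rightarrow> real" where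
  "survival_from \<mu> \<kappa> x = measure (branching_process \<mu> \<kappa> x) {\<omega>. \<forall>n. \<omega> n \<noteq> []}"

definition survival :: "'a::topological_space measure \<Rightarrow> ('a \<Rightarrow> 'a \<Rightarrow> real) \<Rightarrow> real" where
  "survival \<mu> \<kappa> = (\<integral>x. survival_from \<mu> \<kappa> x \<partial>\<mu>)"


section \<open>Real functions\<close>

definition real_analytic_at :: "(real \<Rightarrow> real) \<Rightarrow> real \<Rightarrow> bool" where
  "real_analytic_at f x \<longleftrightarrow>
     (\<exists>a. \<exists>r>0. \<forall>y. \<bar>y - x\<bar> < r \<longrightarrow> (\<lambda>n. a n * (y - x) ^ n) sums f y)"

definition phase_transition_exponent :: "(real \<Rightarrow> real) \<Rightarrow> real \<Rightarrow> real \<Rightarrow> bool" where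
  "phase_transition_exponent \<rho> c\<^sub>0 k \<longleftrightarrow>
     0 < c\<^sub>0 \<and> (\<forall>c. 0 < c \<and> c \<le> c\<^sub>0 \<longrightarrow> \<rho> c = 0) \<and> (\<forall>c>c\<^sub>0. 0 < \<rho> c) \<and>
     (\<lambda>\<epsilon>. \<rho> (c\<^sub>0 + \<epsilon>)) \<in> \<Theta>[at_right 0](\<lambda>\<epsilon>. \<epsilon> powr k)"

end

theory Submission
  imports Defs "HOL-Complex_Analysis.Complex_Analysis"
begin

text \<open>
  The probability that generation \<open>n\<close> is non-empty satisfies \<open>\<rho>\<^sub>0 = 1\<close>,
  \<open>\<rho>\<^sub>n\<^sub>+\<^sub>1 = 1 - exp (- c T \<rho>\<^sub>n)\<close>, so \<open>\<rho>(c; \<cdot>)\<close> is the largest fixed point of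
  \<open>f \<mapsto> 1 - exp (- c T f)\<close>. The square bound makes \<open>T\<close> a compact operator from \<open>L\<^sup>2\<close> to bounded functions,
  which gives a bounded eigenfunction \<open>\<psi> > 0\<close> for \<open>\<lambda> = \<parallel>T\<parallel>\<close>, unique up to scaling by irreducibility,
  and a spectral gap. Testing the fixed point equation against \<open>\<psi>\<close> shows that \<open>\<rho>(c)\<close> vanishes for
  \<open>c \<lambda> \<le> 1\<close>, while \<open>t \<psi>\<close> is a subsolution for \<open>c \<lambda> > 1\<close> and small \<open>t\<close>. Near \<open>c\<^sub>0\<close> the gap shows that
  the component of \<open>\<rho>(c; \<cdot>)\<close> orthogonal to \<open>\<psi>\<close> is of second order, and the equation tested
  against \<open>\<psi>\<close> determines the coefficient of \<open>\<psi>\<close>. For \<open>c > c\<^sub>0\<close> the linearised equation is a strict contraction in a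
  weighted supremum norm, so the iterates started at \<open>\<rho>(c; \<cdot>)\<close> stay bounded for complex parameters near
  \<open>c\<close>; by Montel's theorem their limit is holomorphic.
\<close>

section \<open>Populations\<close>

text \<open>The metric space need not be complete, so no standard Borel structure is available:
  populations are handled through rectangles and recursion over the length of a list, and weak
  compactness rests on a countable generator of the Borel sets. The process enters through product
  functionals, on which independent Poisson families act by an exponential.

  Two obstacles shape the analysis. At the critical value the linearised equation is singular in the
  direction \<psi>. That direction is left to a scalar equation, whose quadratic term comes from 1 -
  exp(-u) = u - u^2/2 + ...; dividing by the amplitude produces the ratio of the integrals of
  \<psi>^2 and \<psi>^3, which requires a lower bound on the amplitude.

  Above the critical value the complex iterates are shown to be bounded, but not to converge off the
  real axis. The limit is taken along a subsequence and identified at real parameters alone. The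
  starting point keeps the iterates where the linearisation contracts; the price is that, for a
  parameter larger than the reference one, they climb from below, and recognising their limit as the
  largest fixed point needs uniqueness among positive solutions.\<close>

lemma space_population_space [simp]: "space population_space = UNIV"
  by (simp add: population_space_def space_measure_of_conv)

lemma sets_population_space: "sets population_space = sigma_sets UNIV (listset ` lists (sets borel))"
  by (simp add: population_space_def)

lemma listset_in_sets:
  "As \<in> lists (sets borel) \<Longrightarrow> listset As \<in> sets population_space"
  by (auto simp: sets_population_space)

lemma measurable_populationI:
  fixes f :: "'b \<Rightarrow> 'a::topological_space list"
  assumes "\<And>As. As \<in> lists (sets borel) \<Longrightarrow> f -` listset As \<inter> space M \<in> sets M"
  shows "f \<in> measurable M population_space"
proof (rule measurable_sigma_sets[OF sets_population_space])
  fix y :: "'a list set" assume "y \<in> listset ` lists (sets borel)"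
  then show "f -` y \<inter> space M \<in> sets M" using assms by blast
qed blast+

lemma Cons_in_listset_iff: "z # zs \<in> listset (A # As) \<longleftrightarrow> z \<in> A \<and> zs \<in> listset As"
  by (auto simp: set_Cons_def)

lemma listset_length: "zs \<in> listset As \<Longrightarrow> length zs = length As"
  by (induction As arbitrary: zs) (auto simp: set_Cons_def)

lemma listset_append_iff:
  "xs @ ys \<in> listset As \<longleftrightarrow>
    xs \<in> listset (take (length xs) As) \<and> ys \<in> listset (drop (length xs) As)"
proof (induction xs arbitrary: As)
  case (Cons x xs)
  show ?case
  proof (cases As)
    case (Cons B Bs)
    with Cons.IH[of Bs] show ?thesis
      by (simp add: Cons_in_listset_iff del: listset.simps)
  qed (simp add: listset.simps(1))
qed simp

lemma measurable_Cons_population [measurable]: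
  "(\<lambda>(z, zs). z # zs) \<in> measurable (borel \<Otimes>\<^sub>M population_space) population_space"
proof (rule measurable_populationI)
  fix As :: "'a set list" assume As: "As \<in> lists (sets borel)"
  show "(\<lambda>(z, zs). z # zs) -` listset As \<inter> space (borel \<Otimes>\<^sub>M population_space)
      \<in> sets (borel \<Otimes>\<^sub>M population_space)"
  proof (cases As)
    case Nil
    then have "(\<lambda>(z, zs). z # zs) -` listset As \<inter> space (borel \<Otimes>\<^sub>M population_space) = {}"
      by auto
    then show ?thesis by simp
  next
    case (Cons B Bs)
    then have "(\<lambda>(z, zs). z # zs) -` listset As \<inter> space (borel \<Otimes>\<^sub>M population_space) = B \<times> listset Bs"
      by (auto simp: set_Cons_def space_pair_measure)
    with As Cons show ?thesis by (auto intro!: pair_measureI listset_in_sets)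
  qed
qed

text \<open>A concatenation does not reveal where it was cut. The preimage of a rectangle is
  therefore a finite union of rectangles, one for each possible length of the first list.\<close>

lemma measurable_append_population [measurable]:
  "(\<lambda>(xs, ys). xs @ ys) \<in> measurable (population_space \<Otimes>\<^sub>M population_space) population_space"
proof (rule measurable_populationI)
  fix As :: "'a set list" assume As: "As \<in> lists (sets borel)"
  have "(\<lambda>(xs, ys). xs @ ys) -` listset As =
      (\<Union>n\<le>length As. listset (take n As) \<times> listset (drop n As))"
  proof (intro set_eqI iffI)
    fix p assume p: "p \<in> (\<lambda>(xs, ys). xs @ ys) -` listset As"
    obtain xs ys where [simp]: "p = (xs, ys)" by force
    from p have "xs @ ys \<in> listset As" by simp
    moreover from listset_length[OF this] have "length xs \<le> length As" by simp
    ultimately show "p \<in> (\<Union>n\<le>length As. listset (take n As) \<times> listset (drop n As))"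
      by (auto simp: listset_append_iff)
  next
    fix p assume "p \<in> (\<Union>n\<le>length As. listset (take n As) \<times> listset (drop n As))"
    then obtain n xs ys where *: "n \<le> length As" "xs \<in> listset (take n As)" "ys \<in> listset (drop n As)"
      "p = (xs, ys)" by auto
    moreover from *(1) listset_length[OF *(2)] have "length xs = n" by simp
    ultimately show "p \<in> (\<lambda>(xs, ys). xs @ ys) -` listset As"
      by (auto simp: listset_append_iff)
  qed
  moreover have "listset (take n As) \<times> listset (drop n As) \<in> sets (population_space \<Otimes>\<^sub>M population_space)" for n
    using As by (intro pair_measureI listset_in_sets) (auto dest: in_set_takeD in_set_dropD)
  ultimately show "(\<lambda>(xs, ys). xs @ ys) -` listset As \<inter> space (population_space \<Otimes>\<^sub>M population_space)
      \<in> sets (population_space \<Otimes>\<^sub>M population_space)"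
    by (simp add: space_pair_measure) 
qed

lemma listset_replicate_UNIV: "listset (replicate n (UNIV :: 'a set)) = {zs. length zs = n}"
proof (induction n)
  case (Suc n)
  have "zs \<in> listset (replicate (Suc n) UNIV) \<longleftrightarrow> length zs = Suc n" for zs :: "'a list"
    using Suc by (cases zs) (auto simp: set_Cons_def set_eq_iff)
  then show ?case by auto
qed auto

lemma sets_length_population [measurable]: "{zs. length zs = n} \<in> sets population_space"
  unfolding listset_replicate_UNIV[symmetric] by (rule listset_in_sets) auto

lemma Nil_in_sets_population [measurable]: "{[]} \<in> sets population_space"
  using sets_length_population[of 0] by simp

lemma sets_hd_population:
  assumes [measurable]: "A \<in> sets borel"
  shows "{zs. length zs = Suc n \<and> hd zs \<in> A} \<in> sets population_space"
proof -
  have "zs \<in> listset (A # replicate n UNIV) \<longleftrightarrow> zs \<in> {zs. length zs = Suc n \<and> hd zs \<in> A}" for zs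
    by (cases zs) (auto simp: set_Cons_def listset_replicate_UNIV)
  then have "listset (A # replicate n UNIV) = {zs. length zs = Suc n \<and> hd zs \<in> A}"
    by (rule set_eqI)
  moreover have "listset (A # replicate n UNIV) \<in> sets population_space"
    by (rule listset_in_sets) auto
  ultimately show ?thesis by (simp only:)
qed

abbreviation population_of_size :: "nat \<Rightarrow> 'a::topological_space list measure" where
  "population_of_size n \<equiv> restrict_space population_space {zs. length zs = n}"

text \<open>On lists of one fixed positive length the unspecified value \<open>hd []\<close> never
  occurs, and the preimage of a set is a rectangle whose other factors are all
  \<open>UNIV\<close>.\<close>

lemma measurable_hd_population: "hd \<in> measurable (population_of_size (Suc n)) borel"
proof (rule measurableI)
  fix A :: "'a set" assume "A \<in> sets borel"
  from sets_hd_population[OF this, of n]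
  show "hd -` A \<inter> space (population_of_size (Suc n)) \<in> sets (population_of_size (Suc n))"
    by (subst sets_restrict_space_iff) (auto simp: space_restrict_space Int_def vimage_def conj_commute)
qed simp

lemma measurable_tl_population:
  "(tl :: 'a::topological_space list \<Rightarrow> 'a list) \<in> measurable (population_of_size (Suc n)) (population_of_size n)"
proof (rule measurable_restrict_space2)
  show "(tl :: 'a list \<Rightarrow> 'a list) \<in> measurable (population_of_size (Suc n)) population_space"
  proof (rule measurable_populationI)
    fix As :: "'a set list" assume As: "As \<in> lists (sets borel)"
    have "tl -` listset As \<inter> space (population_of_size (Suc n)) =
        listset (UNIV # As) \<inter> {zs. length zs = Suc n}"
    proof (intro set_eqI)
      fix zs :: "'a list"
      show "zs \<in> tl -` listset As \<inter> space (population_of_size (Suc n)) \<longleftrightarrow>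
        zs \<in> listset (UNIV # As) \<inter> {zs. length zs = Suc n}"
        by (cases zs) (auto simp: space_restrict_space set_Cons_def)
    qed
    moreover have "listset (UNIV # As) \<inter> {zs. length zs = Suc n} \<in> sets population_space"
      using As by (intro sets.Int listset_in_sets sets_length_population) auto
    ultimately show "tl -` listset As \<inter> space (population_of_size (Suc n)) \<in> sets (population_of_size (Suc n))"
      by (subst sets_restrict_space_iff) auto
  qed
qed (auto simp: space_restrict_space)

text \<open>Lists of a given length form a countable measurable partition, so measurability may be
  checked piece by piece; on length \<open>Suc n\<close> the function factors through head and tail.
  This makes list recursion usable for functions into arbitrary measurable spaces, in particular for
  the kernel \<open>next_generation\<close>.\<close>

lemma measurable_population_recursion:
  fixes f :: "'a::topological_space list \<Rightarrow> 'b"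
  assumes "f [] \<in> space N"
    and step: "\<And>n. f \<in> measurable (population_of_size n) N \<Longrightarrow>
      (\<lambda>(y, ys). f (y # ys)) \<in> measurable (borel \<Otimes>\<^sub>M population_of_size n) N"
  shows "f \<in> measurable population_space N"
proof (rule measurable_piecewise_restrict[where C="range (\<lambda>n. {zs. length zs = n})"])
  fix \<Omega> :: "'a list set" assume "\<Omega> \<in> range (\<lambda>n. {zs. length zs = n})"
  then obtain n where \<Omega>: "\<Omega> = {zs. length zs = n}" by auto
  have "f \<in> measurable (population_of_size n) N"
  proof (induction n)
    case 0
    have "f \<in> measurable (population_of_size 0) N \<longleftrightarrow>
        (\<lambda>_ :: 'a list. f []) \<in> measurable (population_of_size 0) N"
      by (intro measurable_cong) (auto simp: space_restrict_space)
    with assms(1) show ?case by simp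
  next
    case (Suc n)
    have "(\<lambda>zs. (hd zs, tl zs)) \<in> measurable (population_of_size (Suc n)) (borel \<Otimes>\<^sub>M population_of_size n)"
      by (intro measurable_Pair measurable_hd_population measurable_tl_population)
    from measurable_compose[OF this step[OF Suc]]
    have "(\<lambda>zs. f (hd zs # tl zs)) \<in> measurable (population_of_size (Suc n)) N" by simp
    moreover have "f \<in> measurable (population_of_size (Suc n)) N \<longleftrightarrow>
        (\<lambda>zs. f (hd zs # tl zs)) \<in> measurable (population_of_size (Suc n)) N"
      by (intro measurable_cong) (auto simp: space_restrict_space length_Suc_conv)
    ultimately show ?case by blast
  qed
  with \<Omega> show "f \<in> measurable (restrict_space population_space \<Omega>) N" by simp
next
  fix \<Omega> :: "'a list set" assume "\<Omega> \<in> range (\<lambda>n. {zs. length zs = n})"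
  then show "\<Omega> \<inter> space population_space \<in> sets population_space" by auto
qed auto

lemma measurable_prod_list_population:
  fixes q :: "'a::topological_space \<Rightarrow> ennreal"
  assumes [measurable]: "q \<in> borel_measurable borel"
  shows "(\<lambda>zs. prod_list (map q zs)) \<in> borel_measurable population_space"
  by (rule measurable_population_recursion) auto

lemma measurable_iid_points:
  "(\<lambda>P. iid_points P n) \<in> prob_algebra borel \<rightarrow>\<^sub>M prob_algebra population_space"
proof (induction n)
  case 0
  have "return population_space [] \<in> space (prob_algebra (population_space :: 'a list measure))"
    by (simp add: space_prob_algebra prob_space_return)
  then show ?case by (simp add: measurable_const)
next
  case (Suc n)
  note [measurable] = Suc
  show ?case unfolding iid_points.simps by measurable
qed

lemma nn_integral_bind_prob_algebra:
  assumes "P \<in> space (prob_algebra N)" "B \<in> N \<rightarrow>\<^sub>M prob_algebra L" "f \<in> borel_measurable L"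
  shows "(\<integral>\<^sup>+x. f x \<partial>(P \<bind> B)) = (\<integral>\<^sup>+x. (\<integral>\<^sup>+y. f y \<partial>B x) \<partial>P)"
  using assms by (intro nn_integral_bind[where B=L])
     (auto simp: space_prob_algebra measurable_prob_algebraD cong: measurable_cong_sets intro!: prob_space.not_empty)

lemma iid_points_prob:
  "P \<in> space (prob_algebra borel) \<Longrightarrow> iid_points P n \<in> space (prob_algebra population_space)"
  using measurable_space[OF measurable_iid_points] by auto

text \<open>Product functionals are the test functions for the whole process: the extinction
  probability of a population is the product of those of its particles. Independence makes their
  expectation multiplicative.\<close>

lemma nn_integral_iid_points_prod:
  fixes q :: "'a::topological_space \<Rightarrow> ennreal"
  assumes P: "P \<in> space (prob_algebra borel)" and q[measurable]: "q \<in> borel_measurable borel"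
  shows "(\<integral>\<^sup>+zs. prod_list (map q zs) \<partial>iid_points P n) = (\<integral>\<^sup>+z. q z \<partial>P) ^ n"
proof (induction n)
  case 0 then show ?case
    by (simp add: nn_integral_return measurable_prod_list_population)
next
  case (Suc n)
  note [measurable] = measurable_prod_list_population[OF q] 
  have P': "iid_points P n \<in> space (prob_algebra population_space)" by (rule iid_points_prob[OF P])
  have [measurable_cong]: "sets P = sets borel" "sets (iid_points P n) = sets population_space" 
    using P P' by (auto simp: space_prob_algebra)
  have "(\<integral>\<^sup>+zs. prod_list (map q zs) \<partial>iid_points P (Suc n)) =
    (\<integral>\<^sup>+z. (\<integral>\<^sup>+zs. prod_list (map q zs) \<partial>(iid_points P n \<bind> (\<lambda>zs. return population_space (z # zs)))) \<partial>P)"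
    unfolding iid_points.simps
    by (subst nn_integral_bind_prob_algebra[OF P, where L=population_space]) (use P' in measurable)
  also have "\<dots> = (\<integral>\<^sup>+z. (\<integral>\<^sup>+zs. q z * prod_list (map q zs) \<partial>iid_points P n) \<partial>P)"
  proof (intro nn_integral_cong)
    fix z
    have "(\<integral>\<^sup>+zs. prod_list (map q zs) \<partial>(iid_points P n \<bind> (\<lambda>zs. return population_space (z # zs)))) =
      (\<integral>\<^sup>+zs. (\<integral>\<^sup>+ws. prod_list (map q ws) \<partial>return population_space (z # zs)) \<partial>iid_points P n)"
      by (intro nn_integral_bind_prob_algebra[OF P', where L=population_space]) measurable
    then show "(\<integral>\<^sup>+zs. prod_list (map q zs) \<partial>(iid_points P n \<bind> (\<lambda>zs. return population_space (z # zs)))) =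
      (\<integral>\<^sup>+zs. q z * prod_list (map q zs) \<partial>iid_points P n)"
      by (simp add: nn_integral_return measurable_prod_list_population)
  qed
  also have "\<dots> = (\<integral>\<^sup>+z. q z * (\<integral>\<^sup>+zs. prod_list (map q zs) \<partial>iid_points P n) \<partial>P)"
    by (intro nn_integral_cong nn_integral_cmult) measurable
  also have "\<dots> = (\<integral>\<^sup>+z. q z \<partial>P) ^ Suc n"
    by (simp add: Suc nn_integral_multc)
  finally show ?case .
qed


section \<open>Poisson offspring\<close>

lemma nn_integral_poisson_pmf_power:
  fixes s :: real
  assumes "0 < m" "0 \<le> s"
  shows "(\<integral>\<^sup>+n. ennreal s ^ n \<partial>measure_pmf (poisson_pmf m)) = ennreal (exp (m * (s - 1)))"
proof -
  have "(\<lambda>n. (m * s) ^ n /\<^sub>R fact n) sums exp (m * s)"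
    by (rule exp_converges)
  from sums_mult[OF this, of "exp (- m)"]
  have *: "(\<lambda>n. m ^ n / fact n * exp (- m) * s ^ n) sums exp (m * (s - 1))"
    by (simp add: field_simps power_mult_distrib exp_diff exp_minus)
  have "(\<integral>\<^sup>+n. ennreal s ^ n \<partial>measure_pmf (poisson_pmf m)) =
      (\<integral>\<^sup>+n. ennreal (m ^ n / fact n * exp (- m) * s ^ n) \<partial>count_space UNIV)"
    using assms by (subst nn_integral_measure_pmf) (auto simp: ennreal_power ennreal_mult[symmetric] intro!: nn_integral_cong)
  also have "\<dots> = (\<Sum>n. ennreal (m ^ n / fact n * exp (- m) * s ^ n))"
    by (rule nn_integral_count_space_nat)
  also have "\<dots> = ennreal (exp (m * (s - 1)))"
    using * assms by (intro suminf_ennreal_eq) auto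
  finally show ?thesis .
qed

text \<open>For a fixed event the probability is a series of explicit functions of the parameter,
  hence measurable in it. The rate has to be positive for the formula of the point masses, so types
  without children are treated apart.\<close>

lemma measurable_poisson_pmf:
  assumes [measurable]: "f \<in> borel_measurable M" and pos: "\<And>x. x \<in> space M \<Longrightarrow> 0 < f x"
  shows "(\<lambda>x. measure_pmf (poisson_pmf (f x))) \<in> M \<rightarrow>\<^sub>M prob_algebra (count_space UNIV)"
proof (intro measurable_prob_algebraI measurable_subprob_algebra)
  fix A :: "nat set"
  have "(\<lambda>x. emeasure (measure_pmf (poisson_pmf (f x))) A) \<in> borel_measurable M \<longleftrightarrow>
    (\<lambda>x. \<Sum>n. ennreal (f x ^ n / fact n * exp (- f x)) * indicator A n) \<in> borel_measurable M"
  proof (intro measurable_cong)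
    fix x assume "x \<in> space M"
    have "emeasure (measure_pmf (poisson_pmf (f x))) A =
      (\<integral>\<^sup>+n. indicator A n \<partial>measure_pmf (poisson_pmf (f x)))" by simp
    also have "\<dots> = (\<Sum>n. ennreal (f x ^ n / fact n * exp (- f x)) * indicator A n)"
      using pos[OF \<open>x \<in> space M\<close>]
      by (subst nn_integral_measure_pmf) (simp add: nn_integral_count_space_nat)
    finally show "emeasure (measure_pmf (poisson_pmf (f x))) A =
      (\<Sum>n. ennreal (f x ^ n / fact n * exp (- f x)) * indicator A n)" .
  qed
  then show "(\<lambda>x. emeasure (measure_pmf (poisson_pmf (f x))) A) \<in> borel_measurable M"
    by simp
qed (auto intro: prob_space_imp_subprob_space measure_pmf.prob_space_axioms)

text \<open>The process makes sense as soon as every particle has a finite mean number of children,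
  which is what integrable rows provide. The locale is later instantiated with the multiples of the
  kernel.\<close>

locale finite_kernel = prob_space \<mu> for \<mu> :: "'a::{metric_space, second_countable_topology} measure" +
  fixes K :: "'a \<Rightarrow> 'a \<Rightarrow> real"
  assumes sets_eq [simp, measurable_cong]: "sets \<mu> = sets borel"
    and kernel_nonneg [simp]: "0 \<le> K x y"
    and kernel_measurable [measurable]: "(\<lambda>(x, y). K x y) \<in> borel_measurable (borel \<Otimes>\<^sub>M borel)"
    and kernel_integrable: "integrable \<mu> (K x)"
begin

lemma space_eq [simp]: "space \<mu> = UNIV"
  using sets_eq_imp_space_eq[OF sets_eq] by simp

definition mass :: "'a \<Rightarrow> real" where
  "mass x = (\<integral>y. K x y \<partial>\<mu>)"

abbreviation intensity :: "'a \<Rightarrow> 'a measure" where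
  "intensity x \<equiv> density \<mu> (\<lambda>z. ennreal (K x z))"

lemma mass_nonneg: "0 \<le> mass x"
  by (simp add: mass_def)

lemma mass_measurable [measurable]: "mass \<in> borel_measurable borel"
  unfolding mass_def by measurable

lemma emeasure_intensity: "emeasure (intensity x) UNIV = ennreal (mass x)"
  by (simp add: emeasure_density mass_def nn_integral_eq_integral kernel_integrable)

definition child_law :: "'a \<Rightarrow> 'a measure" where
  "child_law x = uniform_measure (intensity x) UNIV"

lemma child_law_prob: "mass x \<noteq> 0 \<Longrightarrow> child_law x \<in> space (prob_algebra borel)"
  unfolding space_prob_algebra child_law_def
  using mass_nonneg[of x] by (auto intro!: prob_space_uniform_measure simp: emeasure_intensity)

lemma child_law_density:
  "mass x \<noteq> 0 \<Longrightarrow> child_law x = density \<mu> (\<lambda>z. ennreal (K x z / mass x))"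
  unfolding child_law_def uniform_measure_def using mass_nonneg[of x]
  by (subst density_density_eq)
     (auto simp: emeasure_intensity divide_ennreal ennreal_times_divide intro!: arg_cong[where f="density \<mu>"])

lemma offspring_eq:
  "offspring \<mu> K x = (if mass x = 0 then return population_space []
     else measure_pmf (poisson_pmf (mass x)) \<bind> iid_points (child_law x))"
  unfolding offspring_def poisson_process_def child_law_def
  by (simp add: emeasure_intensity measure_def mass_nonneg)

lemma measurable_child_law: 
  "child_law \<in> restrict_space borel {x. mass x \<noteq> 0} \<rightarrow>\<^sub>M prob_algebra borel"
proof (intro measurable_prob_algebraI measurable_subprob_algebra)
  fix A :: "'a set" assume [measurable]: "A \<in> sets borel"
  have "(\<lambda>x. emeasure (child_law x) A) \<in> borel_measurable (restrict_space borel {x. mass x \<noteq> 0}) \<longleftrightarrow>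
    (\<lambda>x. \<integral>\<^sup>+z. ennreal (K x z / mass x) * indicator A z \<partial>\<mu>) \<in> borel_measurable (restrict_space borel {x. mass x \<noteq> 0})"
    by (intro measurable_cong) (auto simp: space_restrict_space child_law_density emeasure_density)
  also have "\<dots>" by (rule measurable_restrict_space1) measurable
  finally show "(\<lambda>x. emeasure (child_law x) A) \<in> borel_measurable (restrict_space borel {x. mass x \<noteq> 0})" .
qed (use child_law_prob in \<open>auto simp: space_prob_algebra space_restrict_space intro: prob_space_imp_subprob_space\<close>)

lemma measurable_offspring [measurable]:
  "offspring \<mu> K \<in> borel \<rightarrow>\<^sub>M prob_algebra population_space"
proof -
  let ?R = "restrict_space borel {x. mass x \<noteq> 0}"
  have 1: "return population_space [] \<in> space (prob_algebra (population_space :: 'a list measure))"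
    by (simp add: space_prob_algebra prob_space_return)
  have 2: "(\<lambda>x. measure_pmf (poisson_pmf (mass x)) \<bind> iid_points (child_law x)) \<in> ?R \<rightarrow>\<^sub>M prob_algebra population_space"
  proof (rule measurable_bind_prob_space2[where N="count_space UNIV"])
    show "(\<lambda>x. measure_pmf (poisson_pmf (mass x))) \<in> ?R \<rightarrow>\<^sub>M prob_algebra (count_space UNIV)"
    proof (rule measurable_poisson_pmf)
      show "0 < mass x" if "x \<in> space ?R" for x
        using that mass_nonneg[of x] by (auto simp: space_restrict_space less_le)
    qed (rule measurable_restrict_space1[OF mass_measurable])
    \<comment> \<open>The number of points is discrete, so joint measurability in type and number
      reduces to measurability in the type for each number.\<close>
    have "(\<lambda>x. iid_points (child_law (fst x)) n) \<in> ?R \<Otimes>\<^sub>M count_space UNIV \<rightarrow>\<^sub>M prob_algebra population_space" for n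
      by (rule measurable_compose[OF _ measurable_iid_points])
         (rule measurable_compose[OF measurable_fst measurable_child_law])
    from measurable_compose_countable[where f="\<lambda>n x. iid_points (child_law (fst x)) n", OF this measurable_snd]
    show "(\<lambda>(x, y). iid_points (child_law x) y) \<in> ?R \<Otimes>\<^sub>M count_space UNIV \<rightarrow>\<^sub>M prob_algebra population_space"
      by (simp add: case_prod_beta)
  qed
  have "(\<lambda>x. if mass x = 0 then return population_space []
     else measure_pmf (poisson_pmf (mass x)) \<bind> iid_points (child_law x)) \<in> borel \<rightarrow>\<^sub>M prob_algebra population_space"
    using 1 2 by (subst measurable_If_restrict_space_iff) auto
  then show ?thesis by (simp add: offspring_eq[abs_def])
qed

text \<open>With mean m and s the average of \<open>q\<close> under the law of one child, the
  Poisson generating function gives exp (m (s - 1)), and m (s - 1) is minus the integral of K (1 -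
  q). This is the origin of the nonlinearity 1 - exp (- T f).\<close>

lemma nn_integral_offspring_prod:
  assumes q[measurable]: "q \<in> borel_measurable borel" and q01: "\<And>x. 0 \<le> q x" "\<And>x. q x \<le> 1"
  shows "(\<integral>\<^sup>+zs. prod_list (map (\<lambda>z. ennreal (q z)) zs) \<partial>offspring \<mu> K x) =
    ennreal (exp (- (\<integral>y. K x y * (1 - q y) \<partial>\<mu>)))"
proof -
  have int: "integrable \<mu> (\<lambda>y. K x y * q y)"
    using q01 by (intro Bochner_Integration.integrable_bound[OF kernel_integrable[of x]])
      (auto intro!: mult_left_le)
  have eq: "(\<integral>y. K x y * (1 - q y) \<partial>\<mu>) = mass x - (\<integral>y. K x y * q y \<partial>\<mu>)"
    by (simp add: right_diff_distrib mass_def Bochner_Integration.integral_diff kernel_integrable int)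
  show ?thesis
  proof (cases "mass x = 0")
    case True
    then have "AE y in \<mu>. K x y = 0"
      using integral_nonneg_eq_0_iff_AE[OF kernel_integrable[of x]] by (simp add: mass_def)
    then have "(\<integral>y. K x y * (1 - q y) \<partial>\<mu>) = 0"
      by (intro integral_eq_zero_AE) auto
    with True show ?thesis
      by (simp add: offspring_eq nn_integral_return measurable_prod_list_population)
  next
    case False
    then have m: "0 < mass x" using mass_nonneg[of x] by simp
    define s where "s = (\<integral>y. K x y * q y \<partial>\<mu>) / mass x"
    have s: "0 \<le> s" using m q01 by (auto simp: s_def intro!: divide_nonneg_nonneg integral_nonneg_AE)
    have P: "child_law x \<in> space (prob_algebra borel)" using child_law_prob[OF False] .
    have "(\<integral>\<^sup>+z. ennreal (q z) \<partial>child_law x) = (\<integral>\<^sup>+z. ennreal (K x z * q z / mass x) \<partial>\<mu>)"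
      unfolding child_law_density[OF False] using m q01
      by (subst nn_integral_density) (auto simp: ennreal_mult[symmetric] intro!: nn_integral_cong)
    also have "\<dots> = ennreal s"
      using int m q01 by (subst nn_integral_eq_integral) (auto simp: s_def)
    finally have s_eq: "(\<integral>\<^sup>+z. ennreal (q z) \<partial>child_law x) = ennreal s" .
    have "(\<integral>\<^sup>+zs. prod_list (map (\<lambda>z. ennreal (q z)) zs) \<partial>offspring \<mu> K x) =
      (\<integral>\<^sup>+n. (\<integral>\<^sup>+zs. prod_list (map (\<lambda>z. ennreal (q z)) zs) \<partial>iid_points (child_law x) n)
         \<partial>measure_pmf (poisson_pmf (mass x)))"
      unfolding offspring_eq using False
      by (simp, intro nn_integral_bind_prob_algebra[where N="count_space UNIV" and L=population_space])
         (auto simp: space_prob_algebra measure_pmf.prob_space_axioms iid_points_prob[OF P, unfolded space_prob_algebra, simplified]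
           intro!: measurable_prod_list_population prob_space_imp_subprob_space)
    also have "\<dots> = (\<integral>\<^sup>+n. ennreal s ^ n \<partial>measure_pmf (poisson_pmf (mass x)))"
      by (intro nn_integral_cong, subst nn_integral_iid_points_prod[OF P]) (auto simp: s_eq)
    also have "\<dots> = ennreal (exp (mass x * (s - 1)))"
      by (rule nn_integral_poisson_pmf_power[OF m s])
    also have "mass x * (s - 1) = - (\<integral>y. K x y * (1 - q y) \<partial>\<mu>)"
      using m unfolding eq s_def by (simp add: right_diff_distrib)
    finally show ?thesis .
  qed
qed

section \<open>From one generation to the next\<close>

lemma measurable_next_generation [measurable]:
  "next_generation \<mu> K \<in> population_space \<rightarrow>\<^sub>M prob_algebra population_space"
proof (rule measurable_population_recursion)
  show "next_generation \<mu> K [] \<in> space (prob_algebra population_space)"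
    by (simp add: space_prob_algebra prob_space_return)
  fix n assume [measurable]: "next_generation \<mu> K \<in> population_of_size n \<rightarrow>\<^sub>M prob_algebra population_space"
  show "(\<lambda>(y, ys). next_generation \<mu> K (y # ys)) \<in> borel \<Otimes>\<^sub>M population_of_size n \<rightarrow>\<^sub>M prob_algebra population_space"
    unfolding next_generation.simps by measurable
qed

lemma next_generation_prob: "next_generation \<mu> K ys \<in> space (prob_algebra population_space)"
  using measurable_space[OF measurable_next_generation] by auto

lemma offspring_prob: "offspring \<mu> K y \<in> space (prob_algebra population_space)"
  using measurable_space[OF measurable_offspring] by auto

text \<open>Branching property: the families are independent and concatenated, so a product
  functional of the children averages to a product functional of the parents. This closure is what
  allows an induction over generations.\<close>

lemma nn_integral_next_generation_prod:
  assumes q[measurable]: "q \<in> borel_measurable borel" and q01: "\<And>x. 0 \<le> q x" "\<And>x. q x \<le> 1"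
  shows "(\<integral>\<^sup>+zs. prod_list (map (\<lambda>z. ennreal (q z)) zs) \<partial>next_generation \<mu> K ys) =
    prod_list (map (\<lambda>y. ennreal (exp (- (\<integral>z. K y z * (1 - q z) \<partial>\<mu>)))) ys)"
proof (induction ys)
  case Nil then show ?case by (simp add: nn_integral_return measurable_prod_list_population)
next
  case (Cons y ys)
  let ?q = "\<lambda>zs. prod_list (map (\<lambda>z. ennreal (q z)) zs)"
  have [measurable]: "?q \<in> borel_measurable population_space"
    by (intro measurable_prod_list_population) measurable
  note P1 = offspring_prob[of y] and P2 = next_generation_prob[of ys]
  have [measurable_cong]: "sets (offspring \<mu> K y) = sets population_space"
    "sets (next_generation \<mu> K ys) = sets population_space"
    using P1 P2 by (auto simp: space_prob_algebra)
  have inner: "(\<integral>\<^sup>+us. ?q us \<partial>(next_generation \<mu> K ys \<bind> (\<lambda>ws. return population_space (zs @ ws)))) =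
     ?q zs * (\<integral>\<^sup>+ws. ?q ws \<partial>next_generation \<mu> K ys)" for zs
  proof -
    have "(\<integral>\<^sup>+us. ?q us \<partial>(next_generation \<mu> K ys \<bind> (\<lambda>ws. return population_space (zs @ ws)))) =
       (\<integral>\<^sup>+ws. (\<integral>\<^sup>+us. ?q us \<partial>return population_space (zs @ ws)) \<partial>next_generation \<mu> K ys)"
      by (intro nn_integral_bind_prob_algebra[OF P2, where L=population_space]) measurable
    also have "\<dots> = (\<integral>\<^sup>+ws. ?q zs * ?q ws \<partial>next_generation \<mu> K ys)"
      by (intro nn_integral_cong, subst nn_integral_return) auto
    also have "\<dots> = ?q zs * (\<integral>\<^sup>+ws. ?q ws \<partial>next_generation \<mu> K ys)"
      by (rule nn_integral_cmult) measurable
    finally show ?thesis .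
  qed
  have "(\<integral>\<^sup>+us. ?q us \<partial>next_generation \<mu> K (y # ys)) =
    (\<integral>\<^sup>+zs. (\<integral>\<^sup>+us. ?q us \<partial>(next_generation \<mu> K ys \<bind> (\<lambda>ws. return population_space (zs @ ws)))) \<partial>offspring \<mu> K y)"
    unfolding next_generation.simps
    by (rule nn_integral_bind_prob_algebra[OF P1, where L=population_space]) (use P2 in measurable)
  also have "\<dots> = (\<integral>\<^sup>+zs. ?q zs \<partial>offspring \<mu> K y) * (\<integral>\<^sup>+ws. ?q ws \<partial>next_generation \<mu> K ys)"
    unfolding inner by (rule nn_integral_multc) measurable
  also have "\<dots> = prod_list (map (\<lambda>y. ennreal (exp (- (\<integral>z. K y z * (1 - q z) \<partial>\<mu>)))) (y # ys))"
    by (simp add: nn_integral_offspring_prod[OF q q01] Cons.IH)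
  finally show ?case .
qed

end


section \<open>Survival of the branching process\<close>

primrec surv :: "'a measure \<Rightarrow> ('a \<Rightarrow> 'a \<Rightarrow> real) \<Rightarrow> nat \<Rightarrow> 'a \<Rightarrow> real" where
  "surv \<mu> K 0 x = 1"
| "surv \<mu> K (Suc n) x = 1 - exp (- (\<integral>y. K x y * surv \<mu> K n y \<partial>\<mu>))"

context finite_kernel
begin

lemma surv_nonneg: "0 \<le> surv \<mu> K n x"
  by (induction n arbitrary: x) (auto intro!: integral_nonneg_AE mult_nonneg_nonneg)

lemma surv_le_1: "surv \<mu> K n x \<le> 1"
  by (cases n) auto

lemma surv_measurable [measurable]: "surv \<mu> K n \<in> borel_measurable borel"
  by (induction n) auto

section \<open>Laws of finitely many generations\<close>

lemma measurable_generation_kernel: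
  "generation_kernel \<mu> K x i \<in> PiM {0..<i} (\<lambda>_. population_space) \<rightarrow>\<^sub>M prob_algebra population_space"
proof (cases i)
  case 0
  then have "generation_kernel \<mu> K x i = (\<lambda>_. return population_space [x])" by auto
  then show ?thesis by (simp add: space_prob_algebra prob_space_return)
next
  case (Suc n)
  then have eq: "generation_kernel \<mu> K x i = (\<lambda>\<omega>. next_generation \<mu> K (\<omega> n))" by auto
  show ?thesis unfolding eq
    by (rule measurable_compose[OF _ measurable_next_generation])
       (use Suc in \<open>auto intro!: measurable_component_singleton\<close>)
qed

lemma Ionescu_Tulcea_generations:
  "Ionescu_Tulcea (generation_kernel \<mu> K x) (\<lambda>_. population_space)"
  unfolding Ionescu_Tulcea_def
  using measurable_prob_algebraD[OF measurable_generation_kernel]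
    measurable_space[OF measurable_generation_kernel]
  by (auto simp: space_prob_algebra)

context
  fixes x :: 'a
begin

abbreviation Q :: "(nat \<Rightarrow> 'a list) measure" where "Q \<equiv> branching_process \<mu> K x"

interpretation IT: Ionescu_Tulcea "generation_kernel \<mu> K x" "\<lambda>_. population_space"
  by (rule Ionescu_Tulcea_generations)

lemma sets_branching_process [measurable_cong]:
  "sets Q = sets (PiM UNIV (\<lambda>_. population_space))"
  unfolding branching_process_def by (rule IT.PF.sets_lim)

lemma space_branching_process: "space Q = UNIV"
  using sets_eq_imp_space_eq[OF sets_branching_process] by (simp add: space_PiM)

text \<open>Every computation is reduced to finitely many generations, where the law is an explicit
  composition of kernels. The history before generation 0 is empty, and
  \<open>\<lambda>_. undefined\<close> is the one point of the empty product.\<close>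

lemma distr_branching_process:
  "distr Q (PiM {0..<n} (\<lambda>_. population_space)) (\<lambda>\<omega>. restrict \<omega> {0..<n}) =
    IT.C 0 n (\<lambda>_. undefined)"
  unfolding branching_process_def IT.distr_lim[OF finite_atLeastLessThan]
proof (rule measure_eqI)
  have *: "(\<lambda>_. undefined) \<in> space (PiM {0..<0} (\<lambda>_. population_space))" by (simp add: space_PiM PiE_iff extensional_def)
  show "sets (IT.CI {0..<n}) = sets (IT.C 0 n (\<lambda>_. undefined))"
    using IT.sets_C[OF *, of n] by (simp add: IT.CI_def)
  fix X assume "X \<in> sets (IT.CI {0..<n})"
  then have X: "X \<in> sets (PiM {0..<n} (\<lambda>_. population_space))" by (simp add: IT.CI_def)
  show "emeasure (IT.CI {0..<n}) X = emeasure (IT.C 0 n (\<lambda>_. undefined)) X"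
    using IT.emeasure_CI[OF subset_refl X] sets.sets_into_space[OF X]
    by (simp add: prod_emb_id space_PiM)
qed

lemma prob_space_branching_process: "prob_space Q"
proof -
  have "prob_space (IT.C 0 0 (\<lambda>_. undefined))" by (rule IT.prob_space_C) (simp add: space_PiM)
  then show ?thesis
    unfolding distr_branching_process[symmetric]
    by (rule prob_space_distrD[rotated]) measurable
qed

lemma nn_integral_branching_process_restrict:
  assumes [measurable]: "f \<in> borel_measurable (PiM {0..<n} (\<lambda>_. population_space))"
  shows "(\<integral>\<^sup>+\<omega>. f (restrict \<omega> {0..<n}) \<partial>Q) = (\<integral>\<^sup>+\<omega>. f \<omega> \<partial>IT.C 0 n (\<lambda>_. undefined))"
  unfolding distr_branching_process[symmetric] by (subst nn_integral_distr) measurable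

text \<open>Tower property: generations 0 to n - 1 form the history \<open>{0..<n}\<close>, and the
  kernel with index n draws generation n, which is integrated out first.\<close>

lemma nn_integral_branching_process_Suc:
  assumes f[measurable]: "f \<in> borel_measurable (PiM {0..<Suc n} (\<lambda>_. population_space))"
  shows "(\<integral>\<^sup>+\<omega>. f (restrict \<omega> {0..<Suc n}) \<partial>Q) =
    (\<integral>\<^sup>+\<omega>. (\<integral>\<^sup>+y. f (fun_upd (restrict \<omega> {0..<n}) n y) \<partial>generation_kernel \<mu> K x n (restrict \<omega> {0..<n})) \<partial>Q)"
proof -
  have 0: "(\<lambda>_. undefined) \<in> space (PiM {0..<0} (\<lambda>_. population_space))" by (simp add: space_PiM PiE_iff extensional_def)
  note [measurable] = measurable_fun_upd[where J="{0..<n}"] IT.P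
  have meas: "(\<lambda>\<omega>. \<integral>\<^sup>+y. f (fun_upd \<omega> n y) \<partial>generation_kernel \<mu> K x n \<omega>) \<in> borel_measurable (PiM {0..<n} (\<lambda>_. population_space))"
    by (rule nn_integral_measurable_subprob_algebra2[OF _ IT.P])
       (use f in \<open>auto simp: split_beta' intro!: measurable_compose[OF _ f] measurable_fun_upd[where J="{0..<n}"]\<close>)
  have "(\<integral>\<^sup>+\<omega>. f (restrict \<omega> {0..<Suc n}) \<partial>Q) = (\<integral>\<^sup>+\<omega>. f \<omega> \<partial>IT.C 0 (Suc n) (\<lambda>_. undefined))"
    by (rule nn_integral_branching_process_restrict[OF f])
  also have "\<dots> = (\<integral>\<^sup>+\<omega>. (\<integral>\<^sup>+\<omega>'. f \<omega>' \<partial>IT.eP n \<omega>) \<partial>IT.C 0 n (\<lambda>_. undefined))"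
    using IT.measurable_eP[of n] IT.sets_C[OF 0, of n]
    by (simp, subst nn_integral_bind[where B="PiM {0..<Suc n} (\<lambda>_. population_space)"])
       (auto cong: measurable_cong_sets)
  also have "\<dots> = (\<integral>\<^sup>+\<omega>. (\<integral>\<^sup>+y. f (fun_upd \<omega> n y) \<partial>generation_kernel \<mu> K x n \<omega>) \<partial>IT.C 0 n (\<lambda>_. undefined))"
    using IT.space_C[OF 0, of n] by (intro nn_integral_cong IT.nn_integral_eP) auto
  also have "\<dots> = (\<integral>\<^sup>+\<omega>. (\<integral>\<^sup>+y. f (fun_upd (restrict \<omega> {0..<n}) n y) \<partial>generation_kernel \<mu> K x n (restrict \<omega> {0..<n})) \<partial>Q)"
    by (rule nn_integral_branching_process_restrict[OF meas, symmetric])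
  finally show ?thesis .
qed

lemma nn_integral_branching_process_0:
  assumes [measurable]: "f \<in> borel_measurable population_space"
  shows "(\<integral>\<^sup>+\<omega>. f (\<omega> 0) \<partial>Q) = f [x]"
proof -
  interpret Q: prob_space Q by (rule prob_space_branching_process)
  show ?thesis
    using nn_integral_branching_process_Suc[of "\<lambda>\<omega>. f (\<omega> 0)" 0]
    by (simp add: nn_integral_return Q.emeasure_space_1)
qed

lemma nn_integral_branching_process_step:
  assumes [measurable]: "g \<in> borel_measurable (population_space \<Otimes>\<^sub>M population_space)"
  shows "(\<integral>\<^sup>+\<omega>. g (\<omega> n, \<omega> (Suc n)) \<partial>Q) =
    (\<integral>\<^sup>+\<omega>. (\<integral>\<^sup>+ys. g (\<omega> n, ys) \<partial>next_generation \<mu> K (\<omega> n)) \<partial>Q)"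
  \<comment> \<open>The kernel with index \<open>Suc n\<close> draws generation \<open>Suc n\<close>
    from generation \<open>n\<close>, hence the shifted index.\<close>
  using nn_integral_branching_process_Suc[of "\<lambda>\<omega>. g (\<omega> n, \<omega> (Suc n))" "Suc n"] by simp

text \<open>The left side is the probability that all lines descending from generation n are extinct
  after k further generations. With k arbitrary, the induction trades one generation of the process
  for one step of the recursion. At k = 0 every factor is 0, so the product is the indicator of an
  empty generation.\<close>

lemma nn_integral_extinction_product:
  "(\<integral>\<^sup>+\<omega>. prod_list (map (\<lambda>z. ennreal (1 - surv \<mu> K k z)) (\<omega> n)) \<partial>Q) =
    ennreal (1 - surv \<mu> K (n + k) x)"
proof (induction n arbitrary: k)
  case 0
  show ?case
    by (subst nn_integral_branching_process_0) (auto intro!: measurable_prod_list_population)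
next
  case (Suc n)
  have "(\<integral>\<^sup>+\<omega>. prod_list (map (\<lambda>z. ennreal (1 - surv \<mu> K k z)) (\<omega> (Suc n))) \<partial>Q) =
    (\<integral>\<^sup>+\<omega>. (\<integral>\<^sup>+ys. prod_list (map (\<lambda>z. ennreal (1 - surv \<mu> K k z)) ys) \<partial>next_generation \<mu> K (\<omega> n)) \<partial>Q)"
    using nn_integral_branching_process_step[of "\<lambda>(_, ys). prod_list (map (\<lambda>z. ennreal (1 - surv \<mu> K k z)) ys)" n]
      measurable_prod_list_population[of "\<lambda>z. ennreal (1 - surv \<mu> K k z)"]
    by (simp add: split_beta')
  also have "\<dots> = (\<integral>\<^sup>+\<omega>. prod_list (map (\<lambda>z. ennreal (1 - surv \<mu> K (Suc k) z)) (\<omega> n)) \<partial>Q)"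
    by (subst nn_integral_next_generation_prod) (auto simp: surv_nonneg surv_le_1)
  finally show ?case by (simp only: Suc.IH) simp
qed

lemma measure_generation_nonempty:
  "measure Q {\<omega>. \<omega> n \<noteq> []} = surv \<mu> K n x"
proof -
  interpret Q: prob_space Q by (rule prob_space_branching_process)
  have [measurable]: "{\<omega>. \<omega> n = []} \<in> sets Q"
  proof -
    have "(\<lambda>\<omega>. \<omega> n) -` {[]} \<inter> space Q \<in> sets Q"
      by measurable
    then show ?thesis by (simp add: space_branching_process vimage_def)
  qed
  have "ennreal (1 - surv \<mu> K n x) =
      (\<integral>\<^sup>+\<omega>. prod_list (map (\<lambda>z. ennreal (1 - surv \<mu> K 0 z)) (\<omega> n)) \<partial>Q)"
    by (subst nn_integral_extinction_product) simp
  also have "\<dots> = (\<integral>\<^sup>+\<omega>. indicator {\<omega>. \<omega> n = []} \<omega> \<partial>Q)"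
  proof (intro nn_integral_cong)
    fix \<omega> :: "nat \<Rightarrow> 'a list"
    show "prod_list (map (\<lambda>z. ennreal (1 - surv \<mu> K 0 z)) (\<omega> n)) = indicator {\<omega>. \<omega> n = []} \<omega>"
      by (cases "\<omega> n") auto
  qed
  also have "\<dots> = ennreal (measure Q {\<omega>. \<omega> n = []})"
    by (simp add: Q.emeasure_eq_measure)
  finally have "measure Q {\<omega>. \<omega> n = []} = 1 - surv \<mu> K n x"
    using surv_le_1 by (subst (asm) ennreal_inj) auto
  moreover have "{\<omega>. \<omega> n \<noteq> []} = space Q - {\<omega>. \<omega> n = []}"
    by (auto simp: space_branching_process)
  ultimately show ?thesis by (simp only: Q.prob_compl) (simp add: Q.prob_compl)
qed

text \<open>The sample space contains sequences in which a non-empty generation follows an empty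
  one, so absorption at \<open>[]\<close> holds only almost surely; it is read off from the
  transition out of \<open>[]\<close>.\<close>

lemma AE_extinct_stays:
  "AE \<omega> in Q. \<omega> n = [] \<longrightarrow> \<omega> (Suc n) = []"
proof -
  define g :: "'a list \<times> 'a list \<Rightarrow> ennreal" where
    "g = (\<lambda>(a, b). indicator {[]} a * indicator (UNIV - {[]}) b)"
  have [measurable]: "UNIV - {[]} \<in> sets (population_space :: 'a list measure)"
    using sets.compl_sets[OF Nil_in_sets_population] by simp
  have g[measurable]: "g \<in> borel_measurable (population_space \<Otimes>\<^sub>M population_space)"
    unfolding g_def by measurable
  have "(\<integral>\<^sup>+ys. g (zs, ys) \<partial>next_generation \<mu> K zs) = 0" for zs
    by (cases "zs = []") (auto simp: g_def nn_integral_return)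
  then have "(\<integral>\<^sup>+\<omega>. g (\<omega> n, \<omega> (Suc n)) \<partial>Q) = 0"
    by (subst nn_integral_branching_process_step[OF g]) simp
  then have "AE \<omega> in Q. g (\<omega> n, \<omega> (Suc n)) = 0"
    by (subst (asm) nn_integral_0_iff_AE) auto
  then show ?thesis by eventually_elim (auto simp: g_def indicator_def split: if_splits)
qed

theorem surv_tendsto_survival_from:
  "(\<lambda>n. surv \<mu> K n x) \<longlonglongrightarrow> survival_from \<mu> K x"
proof -
  interpret Q: prob_space Q by (rule prob_space_branching_process)
  define S where "S n = {\<omega> :: nat \<Rightarrow> 'a list. \<omega> n \<noteq> []}" for n
  \<comment> \<open>The events \<open>S n\<close> decrease only up to null sets. Continuity from
    above is applied to their finite intersections, which decrease everywhere and have the same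
    probabilities.\<close>
  define S' where "S' n = (\<Inter>k\<le>n. S k)" for n
  have S[measurable]: "S n \<in> sets Q" for n
  proof -
    have "(\<lambda>\<omega>. \<omega> n) -` (space population_space - {[]}) \<inter> space Q \<in> sets Q"
      by measurable
    then show ?thesis by (simp add: space_branching_process vimage_def S_def)
  qed
  have S'[measurable]: "S' n \<in> sets Q" for n
    unfolding S'_def by measurable
  have "AE \<omega> in Q. \<forall>n. \<omega> n = [] \<longrightarrow> \<omega> (Suc n) = []"
    using AE_extinct_stays by (simp add: AE_all_countable)
  then have "AE \<omega> in Q. \<omega> \<in> S' n \<longleftrightarrow> \<omega> \<in> S n" for n
  proof eventually_elim
    case (elim \<omega>)
    have "\<omega> k = [] \<Longrightarrow> k \<le> n \<Longrightarrow> \<omega> n = []" for k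
      by (rotate_tac 1, induction n rule: dec_induct) (use elim in auto)
    then show ?case by (auto simp: S'_def S_def)
  qed
  then have "measure Q (S' n) = surv \<mu> K n x" for n
    using Q.finite_measure_eq_AE[OF _ S'[of n] S[of n]] measure_generation_nonempty[of n] by (simp add: S_def)
  moreover have "(\<lambda>n. measure Q (S' n)) \<longlonglongrightarrow> measure Q (\<Inter>n. S' n)"
    by (rule Q.finite_Lim_measure_decseq) (auto simp: S'_def decseq_def)
  moreover have "(\<Inter>n. S' n) = {\<omega>. \<forall>n. \<omega> n \<noteq> []}"
    by (auto simp: S'_def S_def)
  ultimately show ?thesis by (simp add: survival_from_def)
qed

end

end


section \<open>Square integrable functions\<close>

text \<open>Genuine functions are used instead of classes modulo null sets, because
  \<open>T f x\<close> and the survival probability are compared at every single point.\<close>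

definition square_integrable :: "'a measure \<Rightarrow> ('a \<Rightarrow> real) \<Rightarrow> bool" where
  "square_integrable M f \<longleftrightarrow> f \<in> borel_measurable M \<and> integrable M (\<lambda>x. (f x)\<^sup>2)"

definition norm2 :: "'a measure \<Rightarrow> ('a \<Rightarrow> real) \<Rightarrow> real" where
  "norm2 M f = sqrt (\<integral>x. (f x)\<^sup>2 \<partial>M)"

lemma square_integrable_measurable [measurable_dest]:
  "square_integrable M f \<Longrightarrow> f \<in> borel_measurable M"
  by (simp add: square_integrable_def)

lemma square_integrable_square: "square_integrable M f \<Longrightarrow> integrable M (\<lambda>x. (f x)\<^sup>2)"
  by (simp add: square_integrable_def)

lemma square_integrable_bound:
  assumes "square_integrable M f" and [measurable]: "g \<in> borel_measurable M"
    and "AE x in M. \<bar>g x\<bar> \<le> \<bar>f x\<bar>"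
  shows "square_integrable M g"
  unfolding square_integrable_def
proof
  show "integrable M (\<lambda>x. (g x)\<^sup>2)"
  proof (rule Bochner_Integration.integrable_bound[OF square_integrable_square[OF assms(1)]])
    show "AE x in M. norm ((g x)\<^sup>2) \<le> norm ((f x)\<^sup>2)"
      using assms(3) by eventually_elim (simp add: abs_le_square_iff[symmetric])
  qed measurable
qed fact

lemma square_integrable_mult:
  assumes "square_integrable M f" "square_integrable M g"
  shows "integrable M (\<lambda>x. f x * g x)"
proof (rule Bochner_Integration.integrable_bound)
  show "integrable M (\<lambda>x. (f x)\<^sup>2 + (g x)\<^sup>2)"
    using assms by (intro Bochner_Integration.integrable_add square_integrable_square)
  have "\<bar>a * b\<bar> \<le> a\<^sup>2 + b\<^sup>2" for a b :: real
    using sum_squares_bound[of "\<bar>a\<bar>" "\<bar>b\<bar>"] mult_nonneg_nonneg[OF abs_ge_zero abs_ge_zero, of a b]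
    unfolding abs_mult power2_abs by linarith
  then show "AE x in M. norm (f x * g x) \<le> norm ((f x)\<^sup>2 + (g x)\<^sup>2)"
    by simp
qed (use assms in measurable)

lemma square_integrable_add:
  assumes "square_integrable M f" "square_integrable M g"
  shows "square_integrable M (\<lambda>x. f x + g x)"
  unfolding square_integrable_def power2_sum
  using assms integrable_mult_right[OF square_integrable_mult[OF assms], of 2]
  by (auto simp: square_integrable_def mult.assoc)

lemma square_integrable_cmult:
  "square_integrable M f \<Longrightarrow> square_integrable M (\<lambda>x. c * f x)"
  by (auto simp: square_integrable_def power_mult_distrib)

lemma square_integrable_diff:
  assumes "square_integrable M f" "square_integrable M g"
  shows "square_integrable M (\<lambda>x. f x - g x)"
  using square_integrable_add[OF assms(1) square_integrable_cmult[OF assms(2), of "-1"]] by simp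

lemma square_integrable_abs:
  "square_integrable M f \<Longrightarrow> square_integrable M (\<lambda>x. \<bar>f x\<bar>)"
  by (auto simp: square_integrable_def)

lemma norm2_nonneg [simp]: "0 \<le> norm2 M f"
  by (simp add: norm2_def)

lemma norm2_power2: "(norm2 M f)\<^sup>2 = (\<integral>x. (f x)\<^sup>2 \<partial>M)"
  by (simp add: norm2_def)

lemma norm2_cmult: "norm2 M (\<lambda>x. c * f x) = \<bar>c\<bar> * norm2 M f"
  by (simp add: norm2_def power_mult_distrib real_sqrt_mult)

lemma norm2_abs: "norm2 M (\<lambda>x. \<bar>f x\<bar>) = norm2 M f"
  by (simp add: norm2_def)

lemma norm2_mono_AE:
  assumes "square_integrable M f" "square_integrable M g" "AE x in M. \<bar>f x\<bar> \<le> \<bar>g x\<bar>"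
  shows "norm2 M f \<le> norm2 M g"
  unfolding norm2_def real_sqrt_le_iff
proof (rule integral_mono_AE)
  show "AE x in M. (f x)\<^sup>2 \<le> (g x)\<^sup>2"
    using assms(3) by eventually_elim (simp add: abs_le_square_iff[symmetric])
qed (use assms square_integrable_square in auto)

lemma norm2_eq_0_iff:
  assumes "square_integrable M f"
  shows "norm2 M f = 0 \<longleftrightarrow> (AE x in M. f x = 0)"
  unfolding norm2_def real_sqrt_eq_0_iff
  using integral_nonneg_eq_0_iff_AE[OF square_integrable_square[OF assms]] by simp

lemma Cauchy_Schwarz_norm2:
  assumes f: "square_integrable M f" and g: "square_integrable M g"
  shows "\<bar>\<integral>x. f x * g x \<partial>M\<bar> \<le> norm2 M f * norm2 M g"
proof -
  define a b where "a = norm2 M f" and "b = norm2 M g"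
  let ?I = "\<integral>x. f x * g x \<partial>M"
  have *: "0 \<le> s\<^sup>2 * a\<^sup>2 - 2 * s * t * ?I + t\<^sup>2 * b\<^sup>2" for s t
  proof -
    have "0 \<le> (\<integral>x. (s * f x - t * g x)\<^sup>2 \<partial>M)" by simp
    also have "(\<lambda>x. (s * f x - t * g x)\<^sup>2) = (\<lambda>x. s\<^sup>2 * (f x)\<^sup>2 - 2 * s * t * (f x * g x) + t\<^sup>2 * (g x)\<^sup>2)"
      by (auto simp: power2_eq_square algebra_simps)
    also have "(\<integral>x. s\<^sup>2 * (f x)\<^sup>2 - 2 * s * t * (f x * g x) + t\<^sup>2 * (g x)\<^sup>2 \<partial>M) =
        s\<^sup>2 * a\<^sup>2 - 2 * s * t * ?I + t\<^sup>2 * b\<^sup>2"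
      using square_integrable_square[OF f] square_integrable_square[OF g] square_integrable_mult[OF f g]
      by (simp add: a_def b_def norm2_power2)
    finally show ?thesis .
  qed
  have "?I\<^sup>2 \<le> (a * b)\<^sup>2"
  proof (cases "b = 0")
    case True
    then have "AE x in M. f x * g x = 0"
      using norm2_eq_0_iff[OF g] by (auto simp: b_def)
    then have "?I = 0" by (rule integral_eq_zero_AE)
    then show ?thesis by simp
  next
    case False
    \<comment> \<open>With s = b and t = I / b the quadratic form collapses to (a b)^2 -
      I^2.\<close>
    from *[of b "?I / b"] False show ?thesis by (simp add: power2_eq_square field_simps)
  qed
  then have "\<bar>?I\<bar> \<le> \<bar>a * b\<bar>" by (simp add: abs_le_square_iff)
  then show ?thesis by (simp add: a_def b_def)
qed

lemma norm2_triangle: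
  assumes f: "square_integrable M f" and g: "square_integrable M g"
  shows "norm2 M (\<lambda>x. f x + g x) \<le> norm2 M f + norm2 M g"
proof (rule power2_le_imp_le)
  have "(norm2 M (\<lambda>x. f x + g x))\<^sup>2 = (norm2 M f)\<^sup>2 + (norm2 M g)\<^sup>2 + 2 * (\<integral>x. f x * g x \<partial>M)"
    using square_integrable_square[OF f] square_integrable_square[OF g] square_integrable_mult[OF f g]
    by (simp add: norm2_power2 power2_sum mult.assoc)
  also have "\<dots> \<le> (norm2 M f + norm2 M g)\<^sup>2"
    using Cauchy_Schwarz_norm2[OF f g] by (simp add: power2_sum)
  finally show "(norm2 M (\<lambda>x. f x + g x))\<^sup>2 \<le> (norm2 M f + norm2 M g)\<^sup>2" .
qed simp

lemma norm2_triangle_diff: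
  assumes f: "square_integrable M f" and g: "square_integrable M g"
  shows "norm2 M f \<le> norm2 M (\<lambda>x. f x - g x) + norm2 M g"
  using norm2_triangle[OF square_integrable_diff[OF f g] g] by simp

lemma (in prob_space) square_integrable_bounded:
  assumes [measurable]: "f \<in> borel_measurable M" and "\<And>x. \<bar>f x\<bar> \<le> B"
  shows "square_integrable M f"
  unfolding square_integrable_def
proof
  show "integrable M (\<lambda>x. (f x)\<^sup>2)"
    using assms(2) by (intro integrable_const_bound[where B="B\<^sup>2"])
      (auto simp: abs_le_square_iff[symmetric] intro!: AE_I2 order_trans[OF _ abs_ge_self])
qed fact

lemma (in prob_space) square_integrable_const: "square_integrable M (\<lambda>_. c)"
  by (rule square_integrable_bounded[where B="\<bar>c\<bar>"]) auto

lemma (in prob_space) norm2_bounded: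
  assumes "f \<in> borel_measurable M" "\<And>x. \<bar>f x\<bar> \<le> B"
  shows "norm2 M f \<le> B"
proof -
  have "0 \<le> B" using assms(2)[of undefined] by linarith
  have "norm2 M f \<le> norm2 M (\<lambda>_. B)"
    using assms \<open>0 \<le> B\<close> by (intro norm2_mono_AE square_integrable_bounded[OF assms] square_integrable_const) auto
  also have "\<dots> = B" using \<open>0 \<le> B\<close> by (simp add: norm2_def prob_space)
  finally show ?thesis .
qed

lemma (in prob_space) square_integrable_integrable:
  "square_integrable M f \<Longrightarrow> integrable M f"
  using square_integrable_mult[OF square_integrable_const[of 1]] by simp

text \<open>Convergence is inherited through approximation that is uniform in the index, without
  naming any limit. It is used to pass to countable unions of sets and then from simple functions to
  all of L2.\<close>

lemma convergent_real_approx: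
  fixes a :: "nat \<Rightarrow> real"
  assumes "\<And>e. 0 < e \<Longrightarrow> \<exists>c. convergent c \<and> (\<forall>k. \<bar>a k - c k\<bar> \<le> e)"
  shows "convergent a"
proof (rule Cauchy_convergent, rule CauchyI)
  fix e :: real assume "0 < e"
  then obtain c where c: "convergent c" "\<And>k. \<bar>a k - c k\<bar> \<le> e / 4" using assms[of "e/4"] by auto
  from CauchyD[OF convergent_Cauchy[OF c(1)], of "e/4"] \<open>0 < e\<close>
  obtain N where N: "\<And>m n. N \<le> m \<Longrightarrow> N \<le> n \<Longrightarrow> \<bar>c m - c n\<bar> < e / 4" by auto
  have "\<bar>a m - a n\<bar> < e" if "N \<le> m" "N \<le> n" for m n
    using N[OF that] c(2)[of m] c(2)[of n] \<open>0 < e\<close> by linarith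
  then show "\<exists>N. \<forall>m\<ge>N. \<forall>n\<ge>N. norm (a m - a n) < e" by auto
qed

text \<open>Separability enters here: the finite intersections of sets from a countable base are
  still countably many. The intersection of the empty family supplies \<open>UNIV\<close>.\<close>

lemma countable_Int_stable_generator_borel:
  obtains G :: "'a::second_countable_topology set set"
  where "countable G" "Int_stable G" "UNIV \<in> G" "sets (borel :: 'a measure) = sigma_sets UNIV G"
proof -
  obtain B :: "'a set set" where B: "countable B" "topological_basis B"
    using ex_countable_basis by blast
  define G where "G = Inter ` {F. finite F \<and> F \<subseteq> B}"
  have "countable {F. finite F \<and> F \<subseteq> B}" using B(1) by (rule countable_Collect_finite_subset)
  then have 1: "countable G" by (simp add: G_def)
  have 2: "Int_stable G"
  proof (rule Int_stableI)
    fix a b assume "a \<in> G" "b \<in> G"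
    then obtain F H where "finite F" "F \<subseteq> B" "a = \<Inter>F" "finite H" "H \<subseteq> B" "b = \<Inter>H"
      by (auto simp: G_def)
    then show "a \<inter> b \<in> G" by (auto simp: G_def intro!: image_eqI[of _ _ "F \<union> H"])
  qed
  have 3: "UNIV \<in> G" by (auto simp: G_def intro!: image_eqI[of _ _ "{}"])
  have sB: "sets (borel :: 'a measure) = sigma_sets UNIV B"
    by (subst borel_eq_countable_basis[OF B]) (rule sets_measure_of, auto)
  have "sets (borel :: 'a measure) = sigma_sets UNIV G"
    unfolding sB
  proof (rule sigma_sets_eqI)
    fix a assume "a \<in> B"
    then show "a \<in> sigma_sets UNIV G" by (intro sigma_sets.Basic) (auto simp: G_def intro!: image_eqI[of _ _ "{a}"])
  next
    fix b assume "b \<in> G"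
    then obtain F where F: "finite F" "F \<subseteq> B" "b = \<Inter>F" by (auto simp: G_def)
    have "\<Inter>F \<in> sets (borel :: 'a measure)"
    proof (cases "F = {}")
      case False
      have "\<And>x. x \<in> F \<Longrightarrow> x \<in> sets (borel :: 'a measure)" using F(2) unfolding sB by auto
      with F(1) False sets.finite_INT[of F "\<lambda>x. x"] show ?thesis by simp
    qed auto
    with F(3) sB show "b \<in> sigma_sets UNIV B" by simp
  qed
  with 1 2 3 show ?thesis by (rule that)
qed

lemma norm2_simple_approx:
  assumes g: "square_integrable M g" and "0 < e"
  obtains s where "simple_function M s" "square_integrable M s" "norm2 M (\<lambda>x. g x - s x) < e"
proof -
  obtain s where s: "\<And>i. simple_function M (s i)"
      "\<And>x. x \<in> space M \<Longrightarrow> (\<lambda>i. s i x) \<longlonglongrightarrow> g x"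
      "\<And>i x. x \<in> space M \<Longrightarrow> \<bar>s i x\<bar> \<le> 2 * \<bar>g x\<bar>"
  proof -
    have "g \<in> borel_measurable M" using g by (simp add: square_integrable_def)
    from borel_measurable_implies_sequence_metric[OF this, of 0]
    obtain F where F: "\<forall>i. simple_function M (F i)" "\<forall>x\<in>space M. (\<lambda>i. F i x) \<longlonglongrightarrow> g x"
        "\<forall>i. \<forall>x\<in>space M. dist (F i x) 0 \<le> 2 * dist (g x) 0" by blast
    show ?thesis by (rule that[of F]) (use F in auto)
  qed
  have [measurable]: "s i \<in> borel_measurable M" "g \<in> borel_measurable M" for i 
    using borel_measurable_simple_function[OF s(1)] g by auto
  have sq: "square_integrable M (s i)" for i
    by (rule square_integrable_bound[OF square_integrable_cmult[OF g, of 2]]) (use s(3) in \<open>auto simp: abs_mult\<close>)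
  have "(\<lambda>i. \<integral>x. (g x - s i x)\<^sup>2 \<partial>M) \<longlonglongrightarrow> (\<integral>x. 0 \<partial>M)"
  \<comment> \<open>The approximants satisfy |s i| \<le> 2 |g|, so |g - s i| \<le> 3 |g|; squaring
    gives the constant 9.\<close>
  proof (rule integral_dominated_convergence[where w="\<lambda>x. 9 * (g x)\<^sup>2"])
    show "AE x in M. (\<lambda>i. (g x - s i x)\<^sup>2) \<longlonglongrightarrow> 0"
    proof (rule AE_I2)
      fix x assume "x \<in> space M"
      from tendsto_power[OF tendsto_diff[OF tendsto_const s(2)[OF this]], of "g x" 2]
      show "(\<lambda>i. (g x - s i x)\<^sup>2) \<longlonglongrightarrow> 0" by simp
    qed
    fix i
    show "AE x in M. norm ((g x - s i x)\<^sup>2) \<le> 9 * (g x)\<^sup>2"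
    proof (rule AE_I2)
      fix x assume "x \<in> space M"
      then have "\<bar>g x - s i x\<bar> \<le> 3 * \<bar>g x\<bar>" using s(3)[of x i] by linarith
      then have "(g x - s i x)\<^sup>2 \<le> (3 * g x)\<^sup>2" unfolding abs_le_square_iff[symmetric] by (simp add: abs_mult)
      then show "norm ((g x - s i x)\<^sup>2) \<le> 9 * (g x)\<^sup>2" by (simp add: power_mult_distrib)
    qed
  qed (use g square_integrable_square in auto)
  then have "(\<lambda>i. norm2 M (\<lambda>x. g x - s i x)) \<longlonglongrightarrow> 0"
    unfolding norm2_def using tendsto_real_sqrt by fastforce
  then have "eventually (\<lambda>i. norm2 M (\<lambda>x. g x - s i x) < e) sequentially"
    using \<open>0 < e\<close> by (rule order_tendstoD)
  then obtain i where "norm2 M (\<lambda>x. g x - s i x) < e" by (auto simp: eventually_sequentially)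
  with s(1) sq show ?thesis by (rule that)
qed

text \<open>The sets \<open>A\<close> for which the integrals of \<open>f (r n)\<close> over \<open>A\<close> converge form a Dynkin system, so it
  suffices to choose \<open>r\<close> by a diagonal argument over a countable \<open>\<inter>\<close>-stable generator.\<close>

lemma weak_sequential_compactness_L2:
  fixes M :: "'a::second_countable_topology measure"
  assumes "prob_space M" and sets_M [simp, measurable_cong]: "sets M = sets borel"
    and f: "\<And>n. square_integrable M (f n)" and bd: "\<And>n. norm2 M (f n) \<le> 1"
  obtains r :: "nat \<Rightarrow> nat" where "strict_mono r"
    "\<And>g. square_integrable M g \<Longrightarrow> convergent (\<lambda>n. \<integral>x. g x * f (r n) x \<partial>M)"
proof -
  interpret prob_space M by fact
  have space_M [simp]: "space M = UNIV" using sets_eq_imp_space_eq[OF sets_M] by simp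
  have f_m [measurable]: "f n \<in> borel_measurable borel" for n
    using f[of n] by (simp add: square_integrable_def cong: measurable_cong_sets)
  have CS: "\<bar>\<integral>x. g x * f n x \<partial>M\<bar> \<le> norm2 M g" if "square_integrable M g" for g n
    using Cauchy_Schwarz_norm2[OF that f[of n]] mult_left_mono[OF bd[of n] norm2_nonneg[of M g]] by simp
  have ind: "square_integrable M (indicator A)" if "A \<in> sets borel" for A :: "'a set"
    using that by (intro square_integrable_bounded[where B=1]) auto
  obtain G :: "'a set set" where G: "countable G" "Int_stable G" "UNIV \<in> G"
      "sets (borel :: 'a measure) = sigma_sets UNIV G"
    by (rule countable_Int_stable_generator_borel)
  define A where "A = from_nat_into G"
  have A_G: "range A = G" unfolding A_def using G(1,3) by (intro range_from_nat_into) auto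
  then have [measurable]: "A n \<in> sets borel" for n unfolding G(4) by auto
  interpret subseqs "\<lambda>n s. convergent (\<lambda>k. \<integral>x. indicator (A n) x * f (s k) x \<partial>M)"
  proof
    fix n and s :: "nat \<Rightarrow> nat"
    have "bounded (range (\<lambda>k. \<integral>x. indicator (A n) x * f (s k) x \<partial>M))"
      using CS[OF ind[of "A n"]] by (intro boundedI[where B="norm2 M (indicator (A n))"]) auto
    from bounded_imp_convergent_subsequence[OF this]
    show "\<exists>r'. strict_mono r' \<and> convergent (\<lambda>k. \<integral>x. indicator (A n) x * f ((s \<circ> r') k) x \<partial>M)"
      by (auto simp: convergent_def o_def)
  qed
  define r where "r = diagseq"
  have "convergent (\<lambda>k. \<integral>x. indicator (A n) x * f (r k) x \<partial>M)" for n
  proof -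
    have "convergent (\<lambda>k. \<integral>x. indicator (A n) x * f ((diagseq \<circ> (+) (Suc n)) k) x \<partial>M)"
    proof (rule diagseq_holds)
      fix r s :: "nat \<Rightarrow> nat" and n
      assume "strict_mono r" "convergent (\<lambda>k. \<integral>x. indicator (A n) x * f (s k) x \<partial>M)"
      from convergent_subseq_convergent[OF this(2) this(1)]
      show "convergent (\<lambda>k. \<integral>x. indicator (A n) x * f ((s \<circ> r) k) x \<partial>M)" by (simp add: o_def)
    qed
    \<comment> \<open>The diagonal sequence is a subsequence of the n-th extraction only from index
      \<open>Suc n\<close> on; dropping finitely many terms does not change the limit.\<close>
    then obtain L where "(\<lambda>k. \<integral>x. indicator (A n) x * f (r (k + Suc n)) x \<partial>M) \<longlonglongrightarrow> L"
      by (auto simp: convergent_def r_def add.commute)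
    then have "(\<lambda>k. \<integral>x. indicator (A n) x * f (r k) x \<partial>M) \<longlonglongrightarrow> L"
      by (rule LIMSEQ_offset)
    then show ?thesis by (auto simp: convergent_def)
  qed
  then have basic: "convergent (\<lambda>k. \<integral>x. indicator B x * f (r k) x \<partial>M)" if "B \<in> G" for B
    using that A_G by auto
  have int: "integrable M (\<lambda>x. indicator B x * f n x)" if "B \<in> sets borel" for B n
    by (rule square_integrable_mult[OF ind[OF that] f])
  have conv_top: "convergent (\<lambda>k. \<integral>x. f (r k) x \<partial>M)"
    using basic[OF G(3)] by simp
  have sets_conv: "convergent (\<lambda>k. \<integral>x. indicator B x * f (r k) x \<partial>M)" if "B \<in> sets borel" for B
    using that[unfolded G(4)]
  proof (induction rule: sigma_sets_induct_disjoint[OF G(2) Pow_UNIV[THEN equalityD2, THEN subset_trans[OF subset_UNIV]],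
      consumes 1, case_names basic empty compl union])
    case (compl B)
    then have B: "B \<in> sets borel" by (simp add: G(4))
    have "(\<integral>x. indicator (UNIV - B) x * f n x \<partial>M) = (\<integral>x. f n x \<partial>M) - (\<integral>x. indicator B x * f n x \<partial>M)" for n
    proof -
      have "(\<integral>x. indicator (UNIV - B) x * f n x \<partial>M) = (\<integral>x. f n x - indicator B x * f n x \<partial>M)"
        by (intro Bochner_Integration.integral_cong) (auto simp: indicator_def)
      also have "\<dots> = (\<integral>x. f n x \<partial>M) - (\<integral>x. indicator B x * f n x \<partial>M)"
        by (intro Bochner_Integration.integral_diff int B square_integrable_integrable f)
      finally show ?thesis .
    qed
    with convergent_diff[OF conv_top compl(2)] show ?case by simp
  next
    case (union B)
    then have B: "B i \<in> sets borel" for i unfolding G(4) by auto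
    define U where "U N = (\<Union>i<N. B i)" for N
    have U[measurable]: "U N \<in> sets borel" for N using B unfolding U_def by auto
    have U'[measurable]: "\<Union>(range B) \<in> sets borel" using B by auto
    have Uc: "convergent (\<lambda>k. \<integral>x. indicator (U N) x * f (r k) x \<partial>M)" for N
    proof -
      have "(\<integral>x. indicator (U N) x * f n x \<partial>M) = (\<Sum>i<N. \<integral>x. indicator (B i) x * f n x \<partial>M)" for n
      proof -
        have "indicator (U N) x = (\<Sum>i<N. indicator (B i) x :: real)" for x
          unfolding U_def using union(1) by (intro indicator_UN_disjoint) (auto simp: disjoint_family_on_def)
        then have "(\<integral>x. indicator (U N) x * f n x \<partial>M) = (\<integral>x. (\<Sum>i<N. indicator (B i) x * f n x) \<partial>M)"
          by (simp add: sum_distrib_right)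
        also have "\<dots> = (\<Sum>i<N. \<integral>x. indicator (B i) x * f n x \<partial>M)"
          by (rule Bochner_Integration.integral_sum) (rule int[OF B])
        finally show ?thesis .
      qed
      then show ?thesis using union(3) by (auto intro!: convergent_sum)
    qed
    show ?case
    proof (rule convergent_real_approx)
      fix e :: real assume "0 < e"
      have "(\<lambda>N. measure M (U N)) \<longlonglongrightarrow> measure M (\<Union>N. U N)"
      proof (rule finite_Lim_measure_incseq)
        show "range U \<subseteq> sets M" using U by auto
        show "incseq U" by (auto simp: U_def incseq_def intro: less_le_trans)
      qed
      moreover have "(\<Union>N. U N) = \<Union>(range B)" by (auto simp: U_def)
      ultimately have "(\<lambda>N. measure M (U N)) \<longlonglongrightarrow> measure M (\<Union>(range B))" by simp
      from tendsto_diff[OF tendsto_const this, of "measure M (\<Union>(range B))"] have "eventually (\<lambda>N. measure M (\<Union>(range B)) - measure M (U N) < e\<^sup>2) sequentially"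
        using \<open>0 < e\<close> by (intro order_tendstoD(2)) auto
      then obtain N where N: "measure M (\<Union>(range B)) - measure M (U N) < e\<^sup>2"
        by (auto simp: eventually_sequentially)
      \<comment> \<open>By Cauchy-Schwarz and the norm bound on \<open>f n\<close>, the error is at
        most the square root of the measure of the tail. It is uniform in n, which is what lets
        convergence pass to the countable union.\<close>
      have "\<bar>(\<integral>x. indicator (\<Union>(range B)) x * f n x \<partial>M) - (\<integral>x. indicator (U N) x * f n x \<partial>M)\<bar> \<le> e" for n
      proof -
        let ?D = "\<Union>(range B) - U N"
        have "(\<integral>x. indicator (\<Union>(range B)) x * f n x \<partial>M) - (\<integral>x. indicator (U N) x * f n x \<partial>M) =
          (\<integral>x. indicator (\<Union>(range B)) x * f n x - indicator (U N) x * f n x \<partial>M)"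
          by (intro Bochner_Integration.integral_diff[symmetric] int) auto
        also have "\<dots> = (\<integral>x. indicator ?D x * f n x \<partial>M)"
          by (intro Bochner_Integration.integral_cong) (auto simp: indicator_def U_def)
        finally have eq: "(\<integral>x. indicator (\<Union>(range B)) x * f n x \<partial>M) - (\<integral>x. indicator (U N) x * f n x \<partial>M) =
          (\<integral>x. indicator ?D x * f n x \<partial>M)" .
        have "(norm2 M (indicator ?D))\<^sup>2 = (\<integral>x. indicator ?D x \<partial>M)"
          unfolding norm2_power2 by (intro Bochner_Integration.integral_cong) (auto simp: indicator_def)
        also have "\<dots> = measure M ?D" by simp
        also have "\<dots> = measure M (\<Union>(range B)) - measure M (U N)"
        proof (rule finite_measure_Diff)
          show "U N \<subseteq> \<Union>(range B)" by (auto simp: U_def)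
        qed (simp_all only: sets_M U U')
        finally have "(norm2 M (indicator ?D))\<^sup>2 \<le> e\<^sup>2" using N by simp
        then have "norm2 M (indicator ?D) \<le> e" using \<open>0 < e\<close> by (simp add: power2_le_iff_abs_le)
        with CS[OF ind[of ?D], of n] show ?thesis unfolding eq by simp
      qed
      with Uc[of N] show "\<exists>c. convergent c \<and> (\<forall>k. \<bar>(\<integral>x. indicator (\<Union>(range B)) x * f (r k) x \<partial>M) - c k\<bar> \<le> e)"
        by blast
    qed
  qed (use basic in \<open>auto intro: convergent_const\<close>)
  have simple_conv: "convergent (\<lambda>k. \<integral>x. s x * f (r k) x \<partial>M)" if s: "simple_function M s" for s :: "'a \<Rightarrow> real"
  proof -
    have fin: "finite (s ` UNIV)" using simple_functionD(1)[OF s] by simp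
    have m: "s -` {y} \<in> sets borel" for y using simple_functionD(2)[OF s, of "{y}"] by simp
    have "s x = (\<Sum>y\<in>s ` UNIV. y * indicator (s -` {y}) x)" for x
    proof -
      have "(\<Sum>y\<in>s ` UNIV. y * indicator (s -` {y}) x) = (\<Sum>y\<in>s ` UNIV. if y = s x then y else 0)"
        by (intro sum.cong) (auto simp: indicator_def)
      also have "\<dots> = s x" using fin by (subst sum.delta) auto
      finally show ?thesis by simp
    qed
    then have "(\<integral>x. s x * f n x \<partial>M) = (\<integral>x. (\<Sum>y\<in>s ` UNIV. y * (indicator (s -` {y}) x * f n x)) \<partial>M)" for n
      by (intro Bochner_Integration.integral_cong refl) (metis (no_types, lifting) mult.assoc sum.cong sum_distrib_right)
    also have "\<dots> n = (\<Sum>y\<in>s ` UNIV. y * (\<integral>x. indicator (s -` {y}) x * f n x \<partial>M))" for n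
      by (subst Bochner_Integration.integral_sum) (auto intro!: integrable_mult_right int m)
    finally have "(\<integral>x. s x * f n x \<partial>M) = (\<Sum>y\<in>s ` UNIV. y * (\<integral>x. indicator (s -` {y}) x * f n x \<partial>M))" for n .
    then show ?thesis
      by (auto intro!: convergent_sum convergent_mult convergent_const sets_conv m)
  qed
  show ?thesis
  proof
    show "strict_mono r" unfolding r_def by (rule subseq_diagseq)
    fix g assume g: "square_integrable M g"
    show "convergent (\<lambda>n. \<integral>x. g x * f (r n) x \<partial>M)"
    proof (rule convergent_real_approx)
      fix e :: real assume "0 < e"
      then obtain s where s: "simple_function M s" "square_integrable M s" "norm2 M (\<lambda>x. g x - s x) < e"
        using norm2_simple_approx[OF g] by metis
      have "\<bar>(\<integral>x. g x * f n x \<partial>M) - (\<integral>x. s x * f n x \<partial>M)\<bar> \<le> e" for n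
      proof -
        have "(\<integral>x. g x * f n x \<partial>M) - (\<integral>x. s x * f n x \<partial>M) = (\<integral>x. (g x - s x) * f n x \<partial>M)"
          using square_integrable_mult[OF g f[of n]] square_integrable_mult[OF s(2) f[of n]]
          by (simp add: left_diff_distrib)
        then show ?thesis using CS[OF square_integrable_diff[OF g s(2)], of n] s(3) by linarith
      qed
      with simple_conv[OF s(1)]
      show "\<exists>c. convergent c \<and> (\<forall>k. \<bar>(\<integral>x. g x * f (r k) x \<partial>M) - c k\<bar> \<le> e)" by blast
    qed
  qed
qed


section \<open>The integral operator\<close>

text \<open>The bound on the rows holds at every x, so \<open>T\<close> sends L2 to functions
  bounded everywhere. \<open>C\<close> may be any positive bound, which permits division by
  it.\<close>

locale bounded_square_kernel = prob_space \<mu>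
  for \<mu> :: "'a::{metric_space, second_countable_topology} measure" +
  fixes \<kappa> :: "'a \<Rightarrow> 'a \<Rightarrow> real" and C :: real
  assumes sets_eq [simp, measurable_cong]: "sets \<mu> = sets borel"
    and kernel_sym: "\<kappa> x y = \<kappa> y x"
    and kernel_nonneg [simp]: "0 \<le> \<kappa> x y"
    and kernel_measurable [measurable]: "(\<lambda>(x, y). \<kappa> x y) \<in> borel_measurable (borel \<Otimes>\<^sub>M borel)"
    and kernel_square_integrable: "square_integrable \<mu> (\<kappa> x)"
    and kernel_norm2_le: "norm2 \<mu> (\<kappa> x) \<le> C"
    and C_pos: "0 < C"
begin

abbreviation T :: "('a \<Rightarrow> real) \<Rightarrow> 'a \<Rightarrow> real" where "T \<equiv> kernel_op \<mu> \<kappa>"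
abbreviation sqi :: "('a \<Rightarrow> real) \<Rightarrow> bool" where "sqi \<equiv> square_integrable \<mu>"
abbreviation nrm :: "('a \<Rightarrow> real) \<Rightarrow> real" where "nrm \<equiv> norm2 \<mu>"

lemma space_eq [simp]: "space \<mu> = UNIV"
  using sets_eq_imp_space_eq[OF sets_eq] by simp

lemma sqi_measurable [measurable_dest]: "sqi f \<Longrightarrow> f \<in> borel_measurable borel"
  by (simp add: square_integrable_def cong: measurable_cong_sets)

lemma kernel_times_integrable: "sqi f \<Longrightarrow> integrable \<mu> (\<lambda>y. \<kappa> x y * f y)"
  by (rule square_integrable_mult[OF kernel_square_integrable])

lemma T_bound: "sqi f \<Longrightarrow> \<bar>T f x\<bar> \<le> C * nrm f"
  unfolding kernel_op_def
  using Cauchy_Schwarz_norm2[OF kernel_square_integrable, of f x]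
    mult_right_mono[OF kernel_norm2_le norm2_nonneg, of x \<mu> f] by linarith

lemma T_measurable [measurable]:
  assumes [measurable]: "f \<in> borel_measurable borel"
  shows "T f \<in> borel_measurable borel"
  unfolding kernel_op_def[abs_def] by measurable

lemma T_sqi: "sqi f \<Longrightarrow> sqi (T f)"
  by (rule square_integrable_bounded[where B="C * nrm f"]) (auto intro: T_bound)

lemma T_add: "sqi f \<Longrightarrow> sqi g \<Longrightarrow> T (\<lambda>y. f y + g y) x = T f x + T g x"
  by (simp add: kernel_op_def distrib_left kernel_times_integrable)

lemma T_diff: "sqi f \<Longrightarrow> sqi g \<Longrightarrow> T (\<lambda>y. f y - g y) x = T f x - T g x"
  by (simp add: kernel_op_def right_diff_distrib kernel_times_integrable)

lemma T_cmult: "T (\<lambda>y. c * f y) x = c * T f x"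
proof -
  have "(\<integral>y. \<kappa> x y * (c * f y) \<partial>\<mu>) = (\<integral>y. c * (\<kappa> x y * f y) \<partial>\<mu>)"
    by (intro Bochner_Integration.integral_cong) auto
  then show ?thesis by (simp add: kernel_op_def)
qed

lemma T_mono_AE: "sqi f \<Longrightarrow> sqi g \<Longrightarrow> AE y in \<mu>. f y \<le> g y \<Longrightarrow> T f x \<le> T g x"
  unfolding kernel_op_def
  by (intro integral_mono_AE kernel_times_integrable) (auto intro: mult_left_mono elim!: eventually_mono)

lemma T_mono: "sqi f \<Longrightarrow> sqi g \<Longrightarrow> (\<And>y. f y \<le> g y) \<Longrightarrow> T f x \<le> T g x"
  by (rule T_mono_AE) auto

lemma T_nonneg: "(\<And>y. 0 \<le> f y) \<Longrightarrow> 0 \<le> T f x"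
  unfolding kernel_op_def by (intro integral_nonneg_AE) auto

lemma T_abs: "\<bar>T f x\<bar> \<le> T (\<lambda>y. \<bar>f y\<bar>) x"
  unfolding kernel_op_def using integral_norm_bound[of \<mu> "\<lambda>y. \<kappa> x y * f y"] by (simp add: abs_mult)

text \<open>Fubini applies because integrating the absolute values gives the integral of |f| T|g|, a
  product of two square integrable functions; symmetry of the kernel then exchanges the
  roles.\<close>

lemma T_sym:
  assumes f: "sqi f" and g: "sqi g"
  shows "(\<integral>x. f x * T g x \<partial>\<mu>) = (\<integral>x. T f x * g x \<partial>\<mu>)"
proof -
  interpret P: pair_sigma_finite \<mu> \<mu> ..
  have [measurable]: "f \<in> borel_measurable borel" "g \<in> borel_measurable borel"
    using f g by auto
  have "integrable (\<mu> \<Otimes>\<^sub>M \<mu>) (\<lambda>(x, y). f x * (\<kappa> x y * g y))"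
  proof (rule P.Fubini_integrable)
    have "(\<lambda>x. LINT y|\<mu>. norm (case (x, y) of (x, y) \<Rightarrow> f x * (\<kappa> x y * g y))) = (\<lambda>x. \<bar>f x\<bar> * T (\<lambda>y. \<bar>g y\<bar>) x)"
      by (simp add: kernel_op_def abs_mult)
    then show "integrable \<mu> (\<lambda>x. LINT y|\<mu>. norm (case (x, y) of (x, y) \<Rightarrow> f x * (\<kappa> x y * g y)))"
      using square_integrable_mult[OF square_integrable_abs[OF f] T_sqi[OF square_integrable_abs[OF g]]] by simp
    show "AE x in \<mu>. integrable \<mu> (\<lambda>y. case (x, y) of (x, y) \<Rightarrow> f x * (\<kappa> x y * g y))"
      using kernel_times_integrable[OF g] by auto
  qed measurable
  from P.Fubini_integral[OF this]
  have "(\<integral>x. f x * T g x \<partial>\<mu>) = (\<integral>y. (\<integral>x. f x * (\<kappa> x y * g y) \<partial>\<mu>) \<partial>\<mu>)"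
    by (simp add: kernel_op_def)
  also have "\<dots> = (\<integral>y. T f y * g y \<partial>\<mu>)"
  proof (intro Bochner_Integration.integral_cong refl)
    fix y
    have "(\<lambda>x. f x * (\<kappa> x y * g y)) = (\<lambda>x. (\<kappa> y x * f x) * g y)"
      using kernel_sym by (auto simp: mult_ac)
    then show "(\<integral>x. f x * (\<kappa> x y * g y) \<partial>\<mu>) = T f y * g y"
      by (simp add: kernel_op_def)
  qed
  finally show ?thesis .
qed

text \<open>\<open>enn2real\<close> sends infinity to 0, so this number represents the norm only
  after \<open>op_norm_finite\<close>.\<close>

definition lam :: real where "lam = enn2real (kernel_op_norm \<mu> \<kappa>)"

lemma L2_norm_eq:
  assumes "sqi f" "\<And>x. 0 \<le> f x"
  shows "L2_norm \<mu> (\<lambda>x. ennreal (f x)) = ennreal (nrm f)"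
proof -
  have "(\<integral>\<^sup>+x. (ennreal (f x))\<^sup>2 \<partial>\<mu>) = (\<integral>\<^sup>+x. ennreal ((f x)\<^sup>2) \<partial>\<mu>)"
    using assms(2) by (simp add: ennreal_power)
  also have "\<dots> = ennreal (\<integral>x. (f x)\<^sup>2 \<partial>\<mu>)"
    by (rule nn_integral_eq_integral) (use square_integrable_square[OF assms(1)] in auto)
  finally show ?thesis by (simp add: L2_norm_def norm2_def)
qed

lemma sqi_if_L2_norm_finite:
  assumes [measurable]: "f \<in> borel_measurable \<mu>" and "\<And>x. 0 \<le> f x" "L2_norm \<mu> (\<lambda>x. ennreal (f x)) < \<infinity>"
  shows "sqi f"
  unfolding square_integrable_def
proof
  show "integrable \<mu> (\<lambda>x. (f x)\<^sup>2)"
    using assms by (intro integrableI_bounded) (auto simp: L2_norm_def Let_def ennreal_power less_top[symmetric] split: if_splits)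
qed fact

lemma op_norm_eq:
  "kernel_op_norm \<mu> \<kappa> = (SUP f \<in> {f. sqi f \<and> (\<forall>x. 0 \<le> f x) \<and> nrm f \<le> 1}. ennreal (nrm (T f)))"
  unfolding kernel_op_norm_def
proof (rule SUP_cong)
  show "{f. f \<in> borel_measurable \<mu> \<and> (\<forall>x. 0 \<le> f x) \<and> L2_norm \<mu> (\<lambda>x. ennreal (f x)) \<le> 1} =
    {f. sqi f \<and> (\<forall>x. 0 \<le> f x) \<and> nrm f \<le> 1}"
  proof (intro set_eqI iffI)
    fix f assume "f \<in> {f. f \<in> borel_measurable \<mu> \<and> (\<forall>x. 0 \<le> f x) \<and> L2_norm \<mu> (\<lambda>x. ennreal (f x)) \<le> 1}"
    then have *: "f \<in> borel_measurable \<mu>" "\<And>x. 0 \<le> f x" "L2_norm \<mu> (\<lambda>x. ennreal (f x)) \<le> 1" by auto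
    then have "sqi f" using le_less_trans[OF *(3), of \<infinity>] by (intro sqi_if_L2_norm_finite) auto
    with * L2_norm_eq[of f] show "f \<in> {f. sqi f \<and> (\<forall>x. 0 \<le> f x) \<and> nrm f \<le> 1}" by simp
  next
    fix f assume "f \<in> {f. sqi f \<and> (\<forall>x. 0 \<le> f x) \<and> nrm f \<le> 1}"
    with L2_norm_eq[of f] show "f \<in> {f. f \<in> borel_measurable \<mu> \<and> (\<forall>x. 0 \<le> f x) \<and> L2_norm \<mu> (\<lambda>x. ennreal (f x)) \<le> 1}"
      by (auto simp: square_integrable_def)
  qed
  fix f assume "f \<in> {f. sqi f \<and> (\<forall>x. 0 \<le> f x) \<and> nrm f \<le> 1}"
  then have f: "sqi f" "\<And>x. 0 \<le> f x" by auto
  have "(\<integral>\<^sup>+ y. ennreal (\<kappa> x y * f y) \<partial>\<mu>) = ennreal (T f x)" for x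
    unfolding kernel_op_def using f by (intro nn_integral_eq_integral kernel_times_integrable) auto
  then show "L2_norm \<mu> (\<lambda>x. \<integral>\<^sup>+ y. ennreal (\<kappa> x y * f y) \<partial>\<mu>) = ennreal (nrm (T f))"
    using L2_norm_eq[OF T_sqi[OF f(1)] T_nonneg[OF f(2)]] by simp
qed

lemma norm_T_le_C: "sqi f \<Longrightarrow> nrm (T f) \<le> C * nrm f"
  by (rule norm2_bounded) (auto intro: T_bound)

lemma op_norm_finite: "kernel_op_norm \<mu> \<kappa> < \<infinity>"
proof -
  have "kernel_op_norm \<mu> \<kappa> \<le> ennreal C"
    unfolding op_norm_eq
  proof (rule SUP_least)
    fix f assume "f \<in> {f. sqi f \<and> (\<forall>x. 0 \<le> f x) \<and> nrm f \<le> 1}"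
    then have "nrm (T f) \<le> C * nrm f" "C * nrm f \<le> C * 1" using C_pos
      by (auto intro: norm_T_le_C mult_left_mono)
    then show "ennreal (nrm (T f)) \<le> ennreal C" by (intro ennreal_leI) linarith
  qed
  then show ?thesis by (rule le_less_trans) simp
qed

lemma ennreal_lam: "ennreal lam = kernel_op_norm \<mu> \<kappa>"
  using op_norm_finite by (simp add: lam_def)

lemma lam_nonneg: "0 \<le> lam" by (simp add: lam_def)

lemma norm_T_le_nonneg:
  assumes f: "sqi f" "\<And>x. 0 \<le> f x"
  shows "nrm (T f) \<le> lam * nrm f"
proof (cases "nrm f = 0")
  case True then show ?thesis using norm_T_le_C[OF f(1)] by simp
next
  case False
  then have pos: "0 < nrm f" by (simp add: less_le)
  define g where "g = (\<lambda>x. inverse (nrm f) * f x)"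
  have g: "sqi g" "\<And>x. 0 \<le> g x" "nrm g \<le> 1"
    using f pos by (auto simp: g_def norm2_cmult intro!: square_integrable_cmult)
  then have "ennreal (nrm (T g)) \<le> ennreal lam"
    unfolding ennreal_lam op_norm_eq by (intro SUP_upper) auto
  then have "nrm (T g) \<le> lam" using lam_nonneg by (simp add: ennreal_le_iff)
  moreover have "nrm (T g) = inverse (nrm f) * nrm (T f)"
  proof -
  have "T g = (\<lambda>x. inverse (nrm f) * T f x)" unfolding g_def by (rule ext) (rule T_cmult)
  then show ?thesis using pos by (simp only: norm2_cmult) simp
  qed
  ultimately show ?thesis using pos by (simp add: field_simps)
qed

text \<open>The norm is a supremum over non-negative functions; the domination |T f| \<le> T |f|
  extends the estimate to functions of any sign.\<close>

lemma norm_T_le: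
  assumes f: "sqi f"
  shows "nrm (T f) \<le> lam * nrm f"
proof -
  have "nrm (T f) \<le> nrm (T (\<lambda>y. \<bar>f y\<bar>))"
    by (intro norm2_mono_AE T_sqi f square_integrable_abs AE_I2 order_trans[OF T_abs abs_ge_self])
  also have "\<dots> \<le> lam * nrm (\<lambda>y. \<bar>f y\<bar>)"
    by (intro norm_T_le_nonneg square_integrable_abs f) auto
  finally show ?thesis by (simp add: norm2_abs)
qed

lemma norm_approx_sequence:
  assumes "0 < lam"
  obtains f where "\<And>n. sqi (f n)" "\<And>n x. 0 \<le> f n x" "\<And>n. nrm (f n) \<le> 1"
    "(\<lambda>n. nrm (T (f n))) \<longlonglongrightarrow> lam"
proof -
  have "\<exists>f. sqi f \<and> (\<forall>x. 0 \<le> f x) \<and> nrm f \<le> 1 \<and> lam - 1 / Suc n < nrm (T f)" for n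
  \<comment> \<open>\<open>ennreal\<close> truncates negative numbers to 0, so the threshold can be
    compared with the extended norm only if it is non-negative; a negative threshold is already
    exceeded by the zero function.\<close>
  proof (cases "0 \<le> lam - 1 / Suc n")
    case True
    then have "ennreal (lam - 1 / Suc n) < kernel_op_norm \<mu> \<kappa>"
      unfolding ennreal_lam[symmetric] by (intro ennreal_lessI assms) auto
    then obtain f where
      "sqi f" "\<forall>x. 0 \<le> f x" "nrm f \<le> 1" "ennreal (lam - 1 / Suc n) < ennreal (nrm (T f))"
      unfolding op_norm_eq less_SUP_iff by blast
    with True show ?thesis by (intro exI[of _ f]) (auto simp: ennreal_less_iff)
  next
    case False
    then have "lam - 1 / Suc n < nrm (T (\<lambda>_. 0))"
      using norm2_nonneg[of \<mu> "T (\<lambda>_. 0)"] by linarith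
    moreover have "nrm (\<lambda>_. 0) = 0" by (simp add: norm2_def)
    ultimately show ?thesis
      by (intro exI[of _ "\<lambda>_. 0"]) (simp add: square_integrable_const)
  qed
  then obtain f where f: "\<And>n. sqi (f n)" "\<And>n x. 0 \<le> f n x" "\<And>n. nrm (f n) \<le> 1"
      "\<And>n. lam - 1 / Suc n < nrm (T (f n))" by metis
  have "(\<lambda>n. lam - 1 / Suc n) \<longlonglongrightarrow> lam - 0"
    by (intro tendsto_diff tendsto_const) real_asymp
  then have lower: "(\<lambda>n. lam - 1 / Suc n) \<longlonglongrightarrow> lam" by simp
  have upper: "nrm (T (f n)) \<le> lam" for n
    using norm_T_le[OF f(1)[of n]] mult_left_mono[OF f(3)[of n] lam_nonneg] by simp
  have "(\<lambda>n. nrm (T (f n))) \<longlonglongrightarrow> lam"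
  proof (rule tendsto_sandwich[OF _ _ lower tendsto_const])
    show "\<forall>\<^sub>F n in sequentially. lam - 1 / Suc n \<le> nrm (T (f n))"
      by (intro always_eventually allI less_imp_le f(4))
    show "\<forall>\<^sub>F n in sequentially. nrm (T (f n)) \<le> lam"
      by (intro always_eventually allI upper)
  qed
  with f(1-3) show ?thesis by (rule that)
qed

text \<open>Each row of the kernel is itself an admissible test function, so weak convergence of
  \<open>f (r n)\<close> is convergence of \<open>T (f (r n))\<close> at every point. The common
  bound \<open>C\<close> later upgrades this to norm convergence by dominated convergence.\<close>

lemma T_compact:
  fixes f :: "nat \<Rightarrow> 'a \<Rightarrow> real"
  assumes f: "\<And>n. sqi (f n)" and bd: "\<And>n. nrm (f n) \<le> 1"
  obtains r g where "strict_mono r" "g \<in> borel_measurable borel" "\<And>x. \<bar>g x\<bar> \<le> C"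
    "\<And>x. (\<lambda>n. T (f (r n)) x) \<longlonglongrightarrow> g x"
proof -
  obtain r where r: "strict_mono r" "\<And>g. sqi g \<Longrightarrow> convergent (\<lambda>n. \<integral>x. g x * f (r n) x \<partial>\<mu>)"
    using weak_sequential_compactness_L2[of \<mu> f, OF prob_space_axioms sets_eq f bd] by metis
  define g where "g x = lim (\<lambda>n. T (f (r n)) x)" for x
  have lim: "(\<lambda>n. T (f (r n)) x) \<longlonglongrightarrow> g x" for x
    using r(2)[OF kernel_square_integrable[of x]] by (simp add: g_def kernel_op_def convergent_LIMSEQ_iff)
  have [measurable]: "f n \<in> borel_measurable borel" for n using f[of n] by auto
  have m: "g \<in> borel_measurable borel"
    by (rule borel_measurable_LIMSEQ_real[OF lim]) measurable
  have "\<bar>g x\<bar> \<le> C" for x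
  proof (rule LIMSEQ_le_const2[OF tendsto_rabs[OF lim]])
    have "C * nrm (f n) \<le> C" for n using mult_left_mono[OF bd[of n], of C] C_pos by simp
    then show "\<exists>N. \<forall>n\<ge>N. \<bar>T (f (r n)) x\<bar> \<le> C" using T_bound[OF f, of _ x] by (meson order_trans)
  qed
  from that[OF r(1) m this lim] show ?thesis .
qed

lemma norm_diff_tendsto_0:
  assumes [measurable]: "\<And>n. f n \<in> borel_measurable borel" "g \<in> borel_measurable borel"
    and bd: "\<And>n x. \<bar>f n x\<bar> \<le> B" and lim: "\<And>x. (\<lambda>n. f n x) \<longlonglongrightarrow> g x"
  shows "(\<lambda>n. nrm (\<lambda>x. f n x - g x)) \<longlonglongrightarrow> 0"
proof -
  have gB: "\<bar>g x\<bar> \<le> B" for x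
    by (rule LIMSEQ_le_const2[OF tendsto_rabs[OF lim]]) (use bd in auto)
  have "(\<lambda>n. \<integral>x. (f n x - g x)\<^sup>2 \<partial>\<mu>) \<longlonglongrightarrow> (\<integral>x. 0 \<partial>\<mu>)"
  proof (rule integral_dominated_convergence[where w="\<lambda>_. (2 * B)\<^sup>2"])
    have "(\<lambda>n. (f n x - g x)\<^sup>2) \<longlonglongrightarrow> 0" for x
      using tendsto_power[OF tendsto_diff[OF lim[of x] tendsto_const], of "g x" 2] by simp
    then show "AE x in \<mu>. (\<lambda>n. (f n x - g x)\<^sup>2) \<longlonglongrightarrow> 0" by simp
    fix n
    have "(f n x - g x)\<^sup>2 \<le> (2 * B)\<^sup>2" for x
      unfolding abs_le_square_iff[symmetric] using bd[of n x] gB[of x] by linarith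
    then show "AE x in \<mu>. norm ((f n x - g x)\<^sup>2) \<le> (2 * B)\<^sup>2" by simp
  qed auto
  from tendsto_real_sqrt[OF this] show ?thesis by (simp add: norm2_def)
qed

lemma T_tendsto:
  assumes "\<And>n. sqi (f n)" "sqi g" "(\<lambda>n. nrm (\<lambda>x. f n x - g x)) \<longlonglongrightarrow> 0"
  shows "(\<lambda>n. T (f n) x) \<longlonglongrightarrow> T g x"
proof -
  have "(\<lambda>n. T (f n) x - T g x) \<longlonglongrightarrow> 0"
  proof (rule Lim_null_comparison)
    show "eventually (\<lambda>n. norm (T (f n) x - T g x) \<le> C * nrm (\<lambda>x. f n x - g x)) sequentially"
      using T_bound[OF square_integrable_diff[OF assms(1,2)], of _ x] T_diff[OF assms(1,2), of _ x] by simp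
    show "(\<lambda>n. C * nrm (\<lambda>x. f n x - g x)) \<longlonglongrightarrow> 0"
      using tendsto_mult_right_zero[OF assms(3)] by simp
  qed
  then show ?thesis by (simp add: LIM_zero_iff)
qed

end


section \<open>Eigenfunctions and spectral gap\<close>

locale irreducible_kernel_op = bounded_square_kernel +
  assumes irreducible: "irreducible_kernel \<mu> \<kappa>" and lam_pos: "0 < lam"
begin

lemma nrm_tendsto:
  assumes f: "\<And>n. sqi (f n)" and g: "sqi g" and lim: "(\<lambda>n. nrm (\<lambda>x. f n x - g x)) \<longlonglongrightarrow> 0"
  shows "(\<lambda>n. nrm (f n)) \<longlonglongrightarrow> nrm g"
proof -
  have "\<bar>nrm (f n) - nrm g\<bar> \<le> nrm (\<lambda>x. f n x - g x)" for n
  proof -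
    have "nrm (\<lambda>x. g x - f n x) = nrm (\<lambda>x. f n x - g x)"
      by (simp add: norm2_def power2_commute)
    then show ?thesis
      using norm2_triangle_diff[OF f[of n] g] norm2_triangle_diff[OF g f[of n]] by linarith
  qed
  then have "(\<lambda>n. nrm (f n) - nrm g) \<longlonglongrightarrow> 0"
    by (intro Lim_null_comparison[OF _ lim]) simp
  then show ?thesis by (simp add: LIM_zero_iff)
qed

lemma inner_tendsto:
  assumes f: "\<And>n. sqi (f n)" and g: "sqi g" and h: "sqi h"
    and lim: "(\<lambda>n. nrm (\<lambda>x. f n x - g x)) \<longlonglongrightarrow> 0"
  shows "(\<lambda>n. \<integral>x. f n x * h x \<partial>\<mu>) \<longlonglongrightarrow> (\<integral>x. g x * h x \<partial>\<mu>)"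
proof -
  have "\<bar>(\<integral>x. f n x * h x \<partial>\<mu>) - (\<integral>x. g x * h x \<partial>\<mu>)\<bar> \<le> nrm (\<lambda>x. f n x - g x) * nrm h" for n
    using Cauchy_Schwarz_norm2[OF square_integrable_diff[OF f[of n] g] h]
      square_integrable_mult[OF f[of n] h] square_integrable_mult[OF g h]
    by (simp add: left_diff_distrib)
  then have "(\<lambda>n. (\<integral>x. f n x * h x \<partial>\<mu>) - (\<integral>x. g x * h x \<partial>\<mu>)) \<longlonglongrightarrow> 0"
    by (intro Lim_null_comparison[OF _ tendsto_mult_left_zero[OF lim, of "nrm h"]]) simp
  then show ?thesis by (simp add: LIM_zero_iff)
qed

text \<open>Where f vanishes, T f is the integral of a non-negative function, so its vanishing
  forces the kernel to be 0 between that point and almost every point with f > 0. The zero set of f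
  and its complement are then disconnected.\<close>

lemma irreducible_dichotomy:
  assumes f: "sqi f" and nonneg: "AE x in \<mu>. 0 \<le> f x"
    and zero: "AE x in \<mu>. f x = 0 \<longrightarrow> T f x = 0"
  shows "(AE x in \<mu>. f x = 0) \<or> (AE x in \<mu>. 0 < f x)"
proof -
  interpret P: pair_sigma_finite \<mu> \<mu> ..
  have [measurable]: "f \<in> borel_measurable borel" using f by auto
  define A where "A = {x. f x = 0}"
  have A[measurable]: "A \<in> sets borel" unfolding A_def by measurable
  have "AE x in \<mu>. AE y in \<mu>. x \<in> A \<and> y \<in> space \<mu> - A \<longrightarrow> \<kappa> x y = 0"
    using zero
  proof eventually_elim
    case (elim x)
    show ?case
    proof (cases "x \<in> A")
      case True
      with elim have "(\<integral>y. \<kappa> x y * f y \<partial>\<mu>) = 0" by (simp add: A_def kernel_op_def)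
      moreover have "AE y in \<mu>. 0 \<le> \<kappa> x y * f y" using nonneg by eventually_elim simp
      ultimately have "AE y in \<mu>. \<kappa> x y * f y = 0"
        using integral_nonneg_eq_0_iff_AE[OF kernel_times_integrable[OF f]] by blast
      then show ?thesis by eventually_elim (auto simp: A_def)
    qed auto
  qed
  then have "AE (x, y) in \<mu> \<Otimes>\<^sub>M \<mu>. x \<in> A \<and> y \<in> space \<mu> - A \<longrightarrow> \<kappa> x y = 0"
  proof (intro P.AE_pair_measure)
    show "{z \<in> space (\<mu> \<Otimes>\<^sub>M \<mu>). case z of (x, y) \<Rightarrow> x \<in> A \<and> y \<in> space \<mu> - A \<longrightarrow> \<kappa> x y = 0} \<in> sets (\<mu> \<Otimes>\<^sub>M \<mu>)"
      by measurable
  qed simp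
  with irreducible A have "emeasure \<mu> A = 0 \<or> emeasure \<mu> (space \<mu> - A) = 0"
    by (auto simp: irreducible_kernel_def)
  then show ?thesis
  proof
    assume "emeasure \<mu> A = 0"
    then have "AE x in \<mu>. x \<notin> A" by (intro AE_not_in) (auto simp: null_sets_def)
    with nonneg have "AE x in \<mu>. 0 < f x" by eventually_elim (auto simp: A_def)
    then show ?thesis ..
  next
    assume "emeasure \<mu> (space \<mu> - A) = 0"
    then have "AE x in \<mu>. x \<notin> space \<mu> - A" by (intro AE_not_in) (auto simp: null_sets_def)
    then have "AE x in \<mu>. f x = 0" by eventually_elim (auto simp: A_def)
    then show ?thesis ..
  qed
qed

lemma nonneg_eigenfunction_dichotomy:
  assumes "sqi f" "AE x in \<mu>. 0 \<le> f x" "AE x in \<mu>. T f x = lam * f x"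
  shows "(AE x in \<mu>. f x = 0) \<or> (AE x in \<mu>. 0 < f x)"
  using assms(3) by (intro irreducible_dichotomy assms(1,2)) (auto elim: eventually_mono)

text \<open>A maximising sequence is an approximate eigenvector of the positive operator \<open>T\<^sup>2\<close>; the
  compactness of \<open>T\<close> gives an eigenvector \<open>g\<close> of \<open>T\<^sup>2\<close>, and then \<open>\<lambda>g + Tg\<close> is one of \<open>T\<close>.\<close>

lemma exists_positive_eigenfunction:
  obtains \<psi> B where "\<psi> \<in> borel_measurable borel" "\<And>x. 0 \<le> \<psi> x" "\<And>x. \<psi> x \<le> B"
    "\<And>x. T \<psi> x = lam * \<psi> x" "AE x in \<mu>. 0 < \<psi> x"
proof -
  obtain f where f: "\<And>n. sqi (f n)" "\<And>n x. 0 \<le> f n x" "\<And>n. nrm (f n) \<le> 1"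
    "(\<lambda>n. nrm (T (f n))) \<longlonglongrightarrow> lam"
    using norm_approx_sequence[OF lam_pos] by metis
  obtain r g where r: "strict_mono r" and g[measurable]: "g \<in> borel_measurable borel" and gC: "\<And>x. \<bar>g x\<bar> \<le> C"
    and lim: "\<And>x. (\<lambda>n. T (f (r n)) x) \<longlonglongrightarrow> g x"
    by (rule T_compact[of f, OF f(1,3)]) blast
  define h where "h n = f (r n)" for n
  have h: "\<And>n. sqi (h n)" "\<And>n x. 0 \<le> h n x" "\<And>n. nrm (h n) \<le> 1"
    using f by (auto simp: h_def)
  have [measurable]: "h n \<in> borel_measurable borel" for n using h(1)[of n] by auto
  have hlim: "(\<lambda>n. nrm (T (h n))) \<longlonglongrightarrow> lam"
    using LIMSEQ_subseq_LIMSEQ[OF f(4) r] by (simp add: h_def o_def)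
  have gs: "sqi g" using gC by (intro square_integrable_bounded[where B=C]) auto
  have ThC: "\<bar>T (h n) x\<bar> \<le> C" for n x
    using T_bound[OF h(1)[of n], of x] mult_left_mono[OF h(3)[of n], of C] C_pos by linarith
  have Th_g: "(\<lambda>n. nrm (\<lambda>x. T (h n) x - g x)) \<longlonglongrightarrow> 0"
    by (rule norm_diff_tendsto_0[OF _ _ ThC]) (use lim in \<open>auto simp: h_def[symmetric]\<close>)
  \<comment> \<open>Norm convergence of \<open>T (h n)\<close> keeps the limit from being zero,
    which weak convergence of \<open>h n\<close> could not do.\<close>
  have nrm_g: "nrm g = lam"
    by (rule LIMSEQ_unique[OF nrm_tendsto[OF T_sqi[OF h(1)] gs Th_g] hlim])
  have g0: "0 \<le> g x" for x
    by (rule LIMSEQ_le_const[OF lim]) (auto intro!: T_nonneg f(2))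
  have "nrm (T (h n)) \<le> C" for n by (rule norm2_bounded) (auto intro: ThC)
  then have TT_bound: "\<bar>T (T (h n)) x\<bar> \<le> C * C" for n x
    using T_bound[OF T_sqi[OF h(1)[of n]], of x] mult_left_mono[of "nrm (T (h n))" C C] C_pos
    by (meson less_imp_le order_trans)
  have TT_lim: "(\<lambda>n. T (T (h n)) x) \<longlonglongrightarrow> T g x" for x
    by (rule T_tendsto[OF T_sqi[OF h(1)] gs Th_g])
  have TT_nrm: "(\<lambda>n. nrm (\<lambda>x. T (T (h n)) x - T g x)) \<longlonglongrightarrow> 0"
    by (rule norm_diff_tendsto_0[OF _ _ TT_bound TT_lim]) auto
  \<comment> \<open>Expand the square: by symmetry the mixed term is the squared norm of
    \<open>T h\<close>, and the two outer terms are at most \<open>lam\<^sup>2\<close> times that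
    squared norm and \<open>lam ^ 4\<close>.\<close>
  have key: "(nrm (\<lambda>x. T (T (h n)) x - lam\<^sup>2 * h n x))\<^sup>2 \<le> lam\<^sup>2 * (lam\<^sup>2 - (nrm (T (h n)))\<^sup>2)" for n
  proof -
    let ?TT = "T (T (h n))"
    have sTT: "sqi ?TT" by (intro T_sqi h)
    have "(nrm (\<lambda>x. ?TT x - lam\<^sup>2 * h n x))\<^sup>2 = (\<integral>x. (?TT x)\<^sup>2 - 2 * lam\<^sup>2 * (h n x * ?TT x) + lam\<^sup>2 * lam\<^sup>2 * (h n x)\<^sup>2 \<partial>\<mu>)"
      unfolding norm2_power2 by (intro Bochner_Integration.integral_cong) (auto simp: power2_eq_square algebra_simps)
    also have "\<dots> = (nrm ?TT)\<^sup>2 - 2 * lam\<^sup>2 * (\<integral>x. h n x * ?TT x \<partial>\<mu>) + lam\<^sup>2 * lam\<^sup>2 * (nrm (h n))\<^sup>2"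
      using square_integrable_square[OF sTT] square_integrable_square[OF h(1)[of n]]
        square_integrable_mult[OF h(1)[of n] sTT] by (simp add: norm2_power2)
    also have "(\<integral>x. h n x * ?TT x \<partial>\<mu>) = (nrm (T (h n)))\<^sup>2"
      unfolding norm2_power2 unfolding power2_eq_square by (rule T_sym[OF h(1) T_sqi[OF h(1)]])
    also have "(nrm ?TT)\<^sup>2 \<le> lam\<^sup>2 * (nrm (T (h n)))\<^sup>2"
      using power_mono[OF norm_T_le[OF T_sqi[OF h(1)[of n]]], of 2] by (simp add: power_mult_distrib)
    also have "lam\<^sup>2 * lam\<^sup>2 * (nrm (h n))\<^sup>2 \<le> lam\<^sup>2 * lam\<^sup>2 * 1"
      using power_mono[OF h(3)[of n], of 2] by (intro mult_left_mono) auto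
    finally show ?thesis by (simp add: algebra_simps)
  qed
  have "(\<lambda>n. lam\<^sup>2 * (lam\<^sup>2 - (nrm (T (h n)))\<^sup>2)) \<longlonglongrightarrow> lam\<^sup>2 * (lam\<^sup>2 - lam\<^sup>2)"
    by (intro tendsto_intros hlim)
  then have "(\<lambda>n. lam\<^sup>2 * (lam\<^sup>2 - (nrm (T (h n)))\<^sup>2)) \<longlonglongrightarrow> 0" by simp
  then have "(\<lambda>n. (nrm (\<lambda>x. T (T (h n)) x - lam\<^sup>2 * h n x))\<^sup>2) \<longlonglongrightarrow> 0"
    by (rule Lim_null_comparison[rotated], intro always_eventually allI)
      (simp only: real_norm_def abs_power2 key)
  from tendsto_real_sqrt[OF this]
  have TT_h: "(\<lambda>n. nrm (\<lambda>x. T (T (h n)) x - lam\<^sup>2 * h n x)) \<longlonglongrightarrow> 0" by simp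
  have sqi_lh: "sqi (\<lambda>x. lam\<^sup>2 * h n x)" for n by (intro square_integrable_cmult h)
  have "nrm (\<lambda>x. lam\<^sup>2 * h n x - T g x) \<le>
      nrm (\<lambda>x. T (T (h n)) x - lam\<^sup>2 * h n x) + nrm (\<lambda>x. T (T (h n)) x - T g x)" for n
  proof -
    have 1: "sqi (\<lambda>x. lam\<^sup>2 * h n x - T (T (h n)) x)" "sqi (\<lambda>x. T (T (h n)) x - T g x)"
      by (intro square_integrable_diff T_sqi h sqi_lh gs)+
    have "nrm (\<lambda>x. lam\<^sup>2 * h n x - T (T (h n)) x) = nrm (\<lambda>x. T (T (h n)) x - lam\<^sup>2 * h n x)"
      by (simp add: norm2_def power2_commute)
    with norm2_triangle[OF 1] show ?thesis by simp
  qed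
  then have "(\<lambda>n. nrm (\<lambda>x. lam\<^sup>2 * h n x - T g x)) \<longlonglongrightarrow> 0"
    by (intro Lim_null_comparison[OF _ tendsto_add_zero[OF TT_h TT_nrm]]) simp
  \<comment> \<open>A multiple of \<open>h n\<close> now converges in norm to \<open>T g\<close>.
    One more application of \<open>T\<close> reaches \<open>T (T g)\<close>, while
    \<open>T (h n)\<close> itself tends to \<open>g\<close>.\<close>
  from T_tendsto[OF sqi_lh T_sqi[OF gs] this]
  have "(\<lambda>n. lam\<^sup>2 * T (h n) x) \<longlonglongrightarrow> T (T g) x" for x by (simp add: T_cmult)
  moreover have "(\<lambda>n. lam\<^sup>2 * T (h n) x) \<longlonglongrightarrow> lam\<^sup>2 * g x" for x
    using tendsto_mult_left[OF lim[of x], of "lam\<^sup>2"] by (simp add: h_def)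
  ultimately have TTg: "T (T g) x = lam\<^sup>2 * g x" for x using LIMSEQ_unique by blast
  define \<psi> where "\<psi> = (\<lambda>x. lam * g x + T g x)"
  have \<psi>_m[measurable]: "\<psi> \<in> borel_measurable borel" unfolding \<psi>_def by measurable
  have \<psi>0: "0 \<le> \<psi> x" for x unfolding \<psi>_def using g0 lam_pos by (auto intro!: add_nonneg_nonneg T_nonneg)
  have \<psi>B: "\<psi> x \<le> lam * C + C * nrm g" for x
    unfolding \<psi>_def using T_bound[OF gs, of x] mult_left_mono[OF order_trans[OF abs_ge_self gC[of x]], of lam] lam_pos
    by linarith
  have \<psi>s: "sqi \<psi>" by (rule square_integrable_bounded[where B="lam * C + C * nrm g"]) (use \<psi>0 \<psi>B in auto)
  have T\<psi>: "T \<psi> x = lam * \<psi> x" for x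
  proof -
    have "T \<psi> x = T (\<lambda>x. lam * g x) x + T (T g) x" unfolding \<psi>_def
      by (intro T_add square_integrable_cmult gs T_sqi)
    moreover have "lam * \<psi> x = lam * T g x + lam\<^sup>2 * g x"
      by (simp add: \<psi>_def power2_eq_square distrib_left)
    ultimately show ?thesis by (simp only: T_cmult TTg)
  qed
  have "\<not> (AE x in \<mu>. \<psi> x = 0)"
  proof
    assume "AE x in \<mu>. \<psi> x = 0"
    then have "AE x in \<mu>. g x = 0"
    proof eventually_elim
      case (elim x)
      have "0 \<le> T g x" by (intro T_nonneg g0)
      moreover have "0 \<le> lam * g x" using g0[of x] lam_pos by simp
      ultimately have "lam * g x = 0" using elim unfolding \<psi>_def by linarith
      with lam_pos show ?case by simp
    qed
    then have "nrm g = 0" using norm2_eq_0_iff[OF gs] by simp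
    with nrm_g lam_pos show False by simp
  qed
  moreover have "(AE x in \<mu>. \<psi> x = 0) \<or> (AE x in \<mu>. 0 < \<psi> x)"
    by (rule nonneg_eigenfunction_dichotomy[OF \<psi>s]) (use \<psi>0 T\<psi> in auto)
  ultimately have "AE x in \<mu>. 0 < \<psi> x" by blast
  from that[OF \<psi>_m \<psi>0 \<psi>B T\<psi> this] show ?thesis .
qed

end

text \<open>The eigenfunction is fixed through a representative for which equation, sign and bound
  hold at every point, so that it can be used in pointwise comparisons; strict positivity is almost
  everywhere.\<close>

locale kernel_with_eigenfunction = irreducible_kernel_op +
  fixes \<psi> :: "'a \<Rightarrow> real" and B :: real
  assumes \<psi>_measurable [measurable]: "\<psi> \<in> borel_measurable borel"
    and \<psi>_nonneg [simp]: "0 \<le> \<psi> x" and \<psi>_le: "\<psi> x \<le> B"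
    and T_\<psi>: "T \<psi> x = lam * \<psi> x" and \<psi>_pos: "AE x in \<mu>. 0 < \<psi> x"
begin

lemma \<psi>_sqi: "sqi \<psi>"
  by (rule square_integrable_bounded[where B=B]) (use \<psi>_le in auto)

lemma integral_T_\<psi>: "sqi f \<Longrightarrow> (\<integral>x. T f x * \<psi> x \<partial>\<mu>) = lam * (\<integral>x. f x * \<psi> x \<partial>\<mu>)"
proof -
  assume f: "sqi f"
  have "(\<integral>x. T f x * \<psi> x \<partial>\<mu>) = (\<integral>x. f x * T \<psi> x \<partial>\<mu>)" using T_sym[OF f \<psi>_sqi] by simp
  also have "\<dots> = (\<integral>x. lam * (f x * \<psi> x) \<partial>\<mu>)" by (simp add: T_\<psi> mult_ac)
  finally show ?thesis by simp
qed

text \<open>T|f| - \<lambda>|f| is almost everywhere non-negative, since |T f| \<le> T|f|, and by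
  symmetry its integral against \<psi> is 0. As \<psi> > 0 almost everywhere, it vanishes.\<close>

lemma abs_eigenfunction:
  assumes f: "sqi f" and eig: "AE x in \<mu>. T f x = lam * f x"
  shows "AE x in \<mu>. T (\<lambda>y. \<bar>f y\<bar>) x = lam * \<bar>f x\<bar>"
proof -
  let ?a = "\<lambda>y. \<bar>f y\<bar>"
  have a: "sqi ?a" by (rule square_integrable_abs[OF f])
  have la: "sqi (\<lambda>x. lam * ?a x)" by (rule square_integrable_cmult[OF a])
  have ge: "AE x in \<mu>. lam * ?a x \<le> T ?a x"
    using eig
  proof eventually_elim
    case (elim x)
    then show ?case using T_abs[of f x] lam_pos by (simp add: abs_mult)
  qed
  have "(\<integral>x. (T ?a x - lam * ?a x) * \<psi> x \<partial>\<mu>) = (\<integral>x. T ?a x * \<psi> x \<partial>\<mu>) - (\<integral>x. lam * ?a x * \<psi> x \<partial>\<mu>)"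
    unfolding left_diff_distrib
    by (intro Bochner_Integration.integral_diff square_integrable_mult \<psi>_sqi T_sqi a la)
  also have "\<dots> = 0" by (simp add: integral_T_\<psi>[OF a] mult.assoc)
  finally have "AE x in \<mu>. (T ?a x - lam * ?a x) * \<psi> x = 0"
    using ge by (subst (asm) integral_nonneg_eq_0_iff_AE)
      (auto intro!: square_integrable_mult square_integrable_diff T_sqi a la \<psi>_sqi elim!: eventually_mono)
  then show ?thesis using \<psi>_pos by eventually_elim auto
qed

text \<open>Both |f| + f and |f| - f are non-negative eigenfunctions, so each is either zero or
  strictly positive almost everywhere.\<close>

lemma eigenfunction_sign:
  assumes f: "sqi f" and eig: "AE x in \<mu>. T f x = lam * f x"
  shows "(AE x in \<mu>. f x = 0) \<or> (AE x in \<mu>. 0 < f x) \<or> (AE x in \<mu>. f x < 0)"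
proof -
  let ?a = "\<lambda>y. \<bar>f y\<bar>"
  have a: "sqi ?a" by (rule square_integrable_abs[OF f])
  note ae = abs_eigenfunction[OF f eig]
  have "AE x in \<mu>. T (\<lambda>y. ?a y + f y) x = lam * (?a x + f x)"
    using ae eig by eventually_elim (simp add: T_add[OF a f] distrib_left)
  then have p: "(AE x in \<mu>. ?a x + f x = 0) \<or> (AE x in \<mu>. 0 < ?a x + f x)"
    by (intro nonneg_eigenfunction_dichotomy square_integrable_add a f) auto
  have "AE x in \<mu>. T (\<lambda>y. ?a y - f y) x = lam * (?a x - f x)"
    using ae eig by eventually_elim (simp add: T_diff[OF a f] right_diff_distrib)
  then have m: "(AE x in \<mu>. ?a x - f x = 0) \<or> (AE x in \<mu>. 0 < ?a x - f x)"
    by (intro nonneg_eigenfunction_dichotomy square_integrable_diff a f) auto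
  show ?thesis
  proof (cases "AE x in \<mu>. 0 < ?a x + f x")
    case True
    then have "AE x in \<mu>. 0 < f x" by eventually_elim auto
    then show ?thesis by blast
  next
    case False
    with p have p: "AE x in \<mu>. ?a x + f x = 0" by blast
    from m show ?thesis
    proof
      assume "AE x in \<mu>. ?a x - f x = 0"
      with p have "AE x in \<mu>. f x = 0" by eventually_elim auto
      then show ?thesis by blast
    next
      assume "AE x in \<mu>. 0 < ?a x - f x"
      then have "AE x in \<mu>. f x < 0" by eventually_elim auto
      then show ?thesis by blast
    qed
  qed
qed

lemma orthogonal_eigenfunction_zero:
  assumes f: "sqi f" and eig: "AE x in \<mu>. T f x = lam * f x" and orth: "(\<integral>x. f x * \<psi> x \<partial>\<mu>) = 0"
  shows "AE x in \<mu>. f x = 0"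
proof -
  have int: "integrable \<mu> (\<lambda>x. f x * \<psi> x)" by (rule square_integrable_mult[OF f \<psi>_sqi])
  consider "AE x in \<mu>. f x = 0" | "AE x in \<mu>. 0 < f x" | "AE x in \<mu>. f x < 0"
    using eigenfunction_sign[OF f eig] by blast
  then show ?thesis
  proof cases
    case 2
    then have "AE x in \<mu>. 0 \<le> f x * \<psi> x" by eventually_elim simp
    with int orth have "AE x in \<mu>. f x * \<psi> x = 0" using integral_nonneg_eq_0_iff_AE[OF int] by simp
    then show ?thesis using \<psi>_pos by eventually_elim auto
  next
    case 3
    have int': "integrable \<mu> (\<lambda>x. - (f x * \<psi> x))" using int by simp
    from 3 have "AE x in \<mu>. 0 \<le> - (f x * \<psi> x)" by eventually_elim (simp add: mult_nonpos_nonneg)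
    moreover have "(\<integral>x. - (f x * \<psi> x) \<partial>\<mu>) = 0" using orth by simp
    ultimately have "AE x in \<mu>. - (f x * \<psi> x) = 0" using integral_nonneg_eq_0_iff_AE[OF int'] by blast
    then show ?thesis using \<psi>_pos by eventually_elim auto
  qed
qed

lemma integral_\<psi>_power_pos: "0 < (\<integral>x. \<psi> x ^ k \<partial>\<mu>)"
proof -
  have "\<psi> x ^ k \<le> B ^ k" for x by (intro power_mono \<psi>_le) simp
  then have int: "integrable \<mu> (\<lambda>x. \<psi> x ^ k)"
    by (intro integrable_const_bound[where B="B ^ k"]) (auto intro!: AE_I2)
  have "0 \<le> (\<integral>x. \<psi> x ^ k \<partial>\<mu>)" by simp
  moreover have "(\<integral>x. \<psi> x ^ k \<partial>\<mu>) \<noteq> 0"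
  proof
    assume "(\<integral>x. \<psi> x ^ k \<partial>\<mu>) = 0"
    then have "AE x in \<mu>. \<psi> x ^ k = 0" using integral_nonneg_eq_0_iff_AE[OF int] by simp
    then have "AE x in \<mu>. False" using \<psi>_pos by eventually_elim auto
    then show False by simp
  qed
  ultimately show ?thesis by (metis order_le_less)
qed

text \<open>Subtracting the projection onto \<psi> leaves an eigenfunction orthogonal to \<psi>, and
  one of constant strict sign cannot be orthogonal to a positive function.\<close>

lemma eigenfunction_multiple:
  assumes f: "sqi f" and eig: "AE x in \<mu>. T f x = lam * f x"
  obtains t where "AE x in \<mu>. f x = t * \<psi> x"
proof -
  define t where "t = (\<integral>x. f x * \<psi> x \<partial>\<mu>) / (\<integral>x. \<psi> x ^ 2 \<partial>\<mu>)"
  let ?d = "\<lambda>x. f x - t * \<psi> x"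
  have t\<psi>: "sqi (\<lambda>x. t * \<psi> x)" by (intro square_integrable_cmult \<psi>_sqi)
  have "(\<integral>x. ?d x * \<psi> x \<partial>\<mu>) = (\<integral>x. f x * \<psi> x - t * \<psi> x ^ 2 \<partial>\<mu>)"
    by (simp add: algebra_simps power2_eq_square)
  also have "\<dots> = (\<integral>x. f x * \<psi> x \<partial>\<mu>) - t * (\<integral>x. \<psi> x ^ 2 \<partial>\<mu>)"
    using square_integrable_mult[OF f \<psi>_sqi] square_integrable_square[OF \<psi>_sqi] by simp
  also have "\<dots> = 0" using integral_\<psi>_power_pos[of 2] by (simp add: t_def)
  finally have orth: "(\<integral>x. ?d x * \<psi> x \<partial>\<mu>) = 0" .
  have "AE x in \<mu>. T ?d x = lam * ?d x"
    using eig by eventually_elim (simp add: T_diff[OF f t\<psi>] T_cmult T_\<psi> algebra_simps)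
  from orthogonal_eigenfunction_zero[OF square_integrable_diff[OF f t\<psi>] this orth]
  have "AE x in \<mu>. f x = t * \<psi> x" by eventually_elim simp
  then show ?thesis by (rule that)
qed

text \<open>The estimate bounds the inverse of \<lambda> - T on the complement of \<psi>. If it
  failed, there would be unit vectors h orthogonal to \<psi> with \<lambda>h - Th tending to 0. By
  compactness Th, and with it \<lambda>h, would converge along a subsequence to an eigenfunction of
  norm \<lambda> orthogonal to \<psi>, which is impossible.\<close>

lemma spectral_gap:
  obtains L where "0 < L"
    "\<And>f. sqi f \<Longrightarrow> (\<integral>x. f x * \<psi> x \<partial>\<mu>) = 0 \<Longrightarrow> nrm f \<le> L * nrm (\<lambda>x. lam * f x - T f x)"
proof (rule ccontr)
  assume "\<not> thesis"
  then have "\<exists>f. sqi f \<and> (\<integral>x. f x * \<psi> x \<partial>\<mu>) = 0 \<and> \<not> nrm f \<le> Suc n * nrm (\<lambda>x. lam * f x - T f x)" for n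
    using that[of "Suc n"] by auto
  then obtain f where f: "\<And>n. sqi (f n)" "\<And>n. (\<integral>x. f n x * \<psi> x \<partial>\<mu>) = 0"
     "\<And>n. Suc n * nrm (\<lambda>x. lam * f n x - T (f n) x) < nrm (f n)"
    by (metis not_le)
  have pos: "0 < nrm (f n)" for n
    by (rule le_less_trans[OF _ f(3)]) simp
  define h where "h n = (\<lambda>x. inverse (nrm (f n)) * f n x)" for n
  have h: "sqi (h n)" for n unfolding h_def by (intro square_integrable_cmult f)
  have [measurable]: "h n \<in> borel_measurable borel" for n using h[of n] by auto
  have h1: "nrm (h n) = 1" for n unfolding h_def norm2_cmult using pos[of n] by simp
  have horth: "(\<integral>x. h n x * \<psi> x \<partial>\<mu>) = 0" for n
    unfolding h_def mult.assoc by (simp add: f(2))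
  have hgap: "nrm (\<lambda>x. lam * h n x - T (h n) x) \<le> 1 / Suc n" for n
  proof -
    have "(\<lambda>x. lam * h n x - T (h n) x) = (\<lambda>x. inverse (nrm (f n)) * (lam * f n x - T (f n) x))"
      unfolding h_def T_cmult by (simp only: right_diff_distrib mult.left_commute)
    then have "nrm (\<lambda>x. lam * h n x - T (h n) x) = inverse (nrm (f n)) * nrm (\<lambda>x. lam * f n x - T (f n) x)"
      using pos[of n] by (simp only: norm2_cmult) simp
    also have "\<dots> \<le> inverse (nrm (f n)) * (nrm (f n) / Suc n)"
    proof (rule mult_left_mono)
      show "nrm (\<lambda>x. lam * f n x - T (f n) x) \<le> nrm (f n) / Suc n"
        using f(3)[of n] by (simp add: pos_le_divide_eq mult.commute del: of_nat_Suc)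
    qed simp
    also have "\<dots> = 1 / Suc n" using pos[of n] by simp
    finally show ?thesis .
  qed
  obtain r g where r: "strict_mono r" and g[measurable]: "g \<in> borel_measurable borel" and gC: "\<And>x. \<bar>g x\<bar> \<le> C"
    and lim: "\<And>x. (\<lambda>n. T (h (r n)) x) \<longlonglongrightarrow> g x"
    by (rule T_compact[of h, OF h]) (auto simp: h1)
  have gs: "sqi g" using gC by (intro square_integrable_bounded[where B=C]) auto
  have ThC: "\<bar>T (h n) x\<bar> \<le> C" for n x
    using T_bound[OF h[of n], of x] h1[of n] by simp
  have Th_g: "(\<lambda>n. nrm (\<lambda>x. T (h (r n)) x - g x)) \<longlonglongrightarrow> 0"
    by (rule norm_diff_tendsto_0[OF _ _ ThC]) (use lim in auto)
  have "(\<lambda>n. 1 / Suc (r n)) \<longlonglongrightarrow> 0"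
    using LIMSEQ_subseq_LIMSEQ[OF LIMSEQ_Suc[OF lim_1_over_n] r] by (simp add: o_def)
  then have "(\<lambda>n. nrm (\<lambda>x. lam * h (r n) x - T (h (r n)) x)) \<longlonglongrightarrow> 0"
    by (rule Lim_null_comparison[rotated]) (use hgap in auto)
  note sum0 = tendsto_add_zero[OF this Th_g]
  have lh: "sqi (\<lambda>x. lam * h n x)" for n by (intro square_integrable_cmult h)
  have "nrm (\<lambda>x. lam * h n x - g x) \<le> nrm (\<lambda>x. lam * h n x - T (h n) x) + nrm (\<lambda>x. T (h n) x - g x)" for n
    using norm2_triangle[OF square_integrable_diff[OF lh[of n] T_sqi[OF h[of n]]] square_integrable_diff[OF T_sqi[OF h[of n]] gs]]
    by simp
  then have lh_g: "(\<lambda>n. nrm (\<lambda>x. lam * h (r n) x - g x)) \<longlonglongrightarrow> 0"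
    by (intro Lim_null_comparison[OF _ sum0]) simp
  from T_tendsto[OF lh gs this] have "(\<lambda>n. lam * T (h (r n)) x) \<longlonglongrightarrow> T g x" for x
    by (simp add: T_cmult)
  then have Tg: "T g x = lam * g x" for x
    using LIMSEQ_unique[OF _ tendsto_mult_left[OF lim]] by blast
  have "(\<lambda>n. nrm (\<lambda>x. lam * h (r n) x)) \<longlonglongrightarrow> nrm g" by (rule nrm_tendsto[OF lh gs lh_g])
  then have nrm_g: "nrm g = lam" unfolding norm2_cmult h1 using lam_pos LIMSEQ_unique[OF _ tendsto_const] by fastforce
  have "(\<lambda>n. \<integral>x. lam * h (r n) x * \<psi> x \<partial>\<mu>) \<longlonglongrightarrow> (\<integral>x. g x * \<psi> x \<partial>\<mu>)"
    by (rule inner_tendsto[OF lh gs \<psi>_sqi lh_g])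
  then have "(\<integral>x. g x * \<psi> x \<partial>\<mu>) = 0" by (simp add: mult.assoc horth LIMSEQ_const_iff)
  then have "AE x in \<mu>. g x = 0" by (intro orthogonal_eigenfunction_zero gs) (simp_all add: Tg)
  then have "nrm g = 0" using norm2_eq_0_iff[OF gs] by simp
  with nrm_g lam_pos show False by simp
qed

end


section \<open>The fixed point equation\<close>

lemma one_minus_exp_ge_quadratic:
  fixes u :: real assumes "0 \<le> u"
  shows "u - u\<^sup>2 / 2 \<le> 1 - exp (- u)"
proof -
  have "(\<lambda>u. 1 - u + u\<^sup>2 / 2 - exp (- u)) 0 \<le> (\<lambda>u. 1 - u + u\<^sup>2 / 2 - exp (- u)) u"
  proof (rule DERIV_nonneg_imp_nondecreasing[OF assms])
    fix x :: real
    have "((\<lambda>u. 1 - u + u\<^sup>2 / 2 - exp (- u)) has_real_derivative (- 1 + x + exp (- x))) (at x)"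
      by (auto intro!: derivative_eq_intros simp: algebra_simps)
    moreover have "0 \<le> - 1 + x + exp (- x)" using exp_ge_add_one_self[of "- x"] by simp
    ultimately show "\<exists>y. ((\<lambda>u. 1 - u + u\<^sup>2 / 2 - exp (- u)) has_real_derivative y) (at x) \<and> 0 \<le> y" by blast
  qed
  then show ?thesis by simp
qed

text \<open>In terms of \<open>r = 1 - e\<^sup>-\<^sup>u\<close> this is \<open>r + r\<^sup>2/2 \<le> - ln (1 - r)\<close>.\<close>

lemma le_of_one_minus_exp:
  fixes u :: real assumes "0 \<le> u"
  shows "(1 - exp (- u)) + (1 - exp (- u))\<^sup>2 / 2 \<le> u"
proof -
  let ?h = "\<lambda>u :: real. u - (1 - exp (- u)) - (1 - exp (- u))\<^sup>2 / 2"
  have "?h 0 \<le> ?h u"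
  proof (rule DERIV_nonneg_imp_nondecreasing[OF assms])
    fix x :: real
    have "(?h has_real_derivative (1 - exp (- x))\<^sup>2) (at x)"
      by (auto intro!: derivative_eq_intros simp: power2_eq_square field_simps)
    then show "\<exists>y. (?h has_real_derivative y) (at x) \<and> 0 \<le> y" using zero_le_power2 by blast
  qed
  then show ?thesis by simp
qed

context kernel_with_eigenfunction
begin

abbreviation scaled :: "real \<Rightarrow> 'a \<Rightarrow> 'a \<Rightarrow> real" where
  "scaled c \<equiv> (\<lambda>x y. c * \<kappa> x y)"

abbreviation surv_prob :: "real \<Rightarrow> real" where
  "surv_prob c \<equiv> survival \<mu> (scaled c)"

definition R :: "real \<Rightarrow> 'a \<Rightarrow> real" where
  "R c = survival_from \<mu> (scaled c)"

lemma finite_kernel_scaled: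
  assumes "0 < c" shows "finite_kernel \<mu> (scaled c)"
proof
  have "integrable \<mu> (\<kappa> x)" for x
    using square_integrable_integrable[OF kernel_square_integrable] .
  then show "integrable \<mu> (scaled c x)" for x by simp
qed (use assms in auto)

lemma surv_step: "surv \<mu> (scaled c) (Suc n) x = 1 - exp (- (c * T (surv \<mu> (scaled c) n) x))"
  by (simp add: kernel_op_def mult.assoc)

context
  fixes c :: real
  assumes c: "0 < c"
begin

interpretation finite_kernel \<mu> "scaled c" by (rule finite_kernel_scaled[OF c])

lemma s_measurable [measurable]: "surv \<mu> (scaled c) n \<in> borel_measurable borel"
  by (rule surv_measurable)

lemma s_bounds: "0 \<le> surv \<mu> (scaled c) n x" "surv \<mu> (scaled c) n x \<le> 1"
  by (rule surv_nonneg, rule surv_le_1)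

lemma s_sqi: "sqi (surv \<mu> (scaled c) n)"
  by (rule square_integrable_bounded[where B=1]) (use s_bounds in auto)

lemma s_tendsto: "(\<lambda>n. surv \<mu> (scaled c) n x) \<longlonglongrightarrow> R c x"
  unfolding R_def by (rule surv_tendsto_survival_from)

lemma R_measurable [measurable]: "R c \<in> borel_measurable borel"
  by (rule borel_measurable_LIMSEQ_real[OF s_tendsto]) auto

lemma R_nonneg: "0 \<le> R c x"
  by (rule LIMSEQ_le_const[OF s_tendsto]) (use s_bounds in auto)

lemma R_le_1: "R c x \<le> 1"
  by (rule LIMSEQ_le_const2[OF s_tendsto]) (use s_bounds in auto)

lemma R_sqi: "sqi (R c)"
  by (rule square_integrable_bounded[where B=1]) (use R_nonneg R_le_1 in auto)

lemma R_fixed: "R c x = 1 - exp (- (c * T (R c) x))"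
proof -
  have "\<bar>surv \<mu> (scaled c) n x\<bar> \<le> 1" for n x using s_bounds[of n x] by simp
  from norm_diff_tendsto_0[OF s_measurable R_measurable this s_tendsto]
  have "(\<lambda>n. T (surv \<mu> (scaled c) n) x) \<longlonglongrightarrow> T (R c) x"
    by (rule T_tendsto[OF s_sqi R_sqi])
  then have "(\<lambda>n. 1 - exp (- (c * T (surv \<mu> (scaled c) n) x))) \<longlonglongrightarrow> 1 - exp (- (c * T (R c) x))"
    by (intro tendsto_intros)
  moreover have "(\<lambda>n. surv \<mu> (scaled c) (Suc n) x) \<longlonglongrightarrow> R c x"
    using s_tendsto by (rule LIMSEQ_Suc)
  ultimately show ?thesis unfolding surv_step by (rule LIMSEQ_unique[rotated])
qed

lemma TR_nonneg: "0 \<le> T (R c) x"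
  by (intro T_nonneg R_nonneg)

text \<open>The map f -> 1 - exp (- c T f) is monotone, so a subsolution that starts below 1 stays
  below all iterates started at 1. Monotonicity in c and every lower bound on the survival
  probability come from this comparison.\<close>

lemma le_R:
  assumes f: "sqi f" "\<And>x. f x \<le> 1" "\<And>x. f x \<le> 1 - exp (- (c * T f x))"
  shows "f x \<le> R c x"
proof -
  have "f x \<le> surv \<mu> (scaled c) n x" for n x
  proof (induction n arbitrary: x)
    case (Suc n)
    have "c * T f x \<le> c * T (surv \<mu> (scaled c) n) x"
      using c Suc by (intro mult_left_mono T_mono f s_sqi) auto
    with f(3)[of x] show ?case unfolding surv_step by (smt (verit) exp_le_cancel_iff)
  qed (use f in auto)
  then show ?thesis by (intro LIMSEQ_le_const[OF s_tendsto]) auto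
qed

lemma survival_eq_R: "surv_prob c = (\<integral>x. R c x \<partial>\<mu>)"
  by (simp add: survival_def R_def)

end

lemma R_mono:
  assumes "0 < c" "c \<le> d" shows "R c x \<le> R d x"
proof (rule le_R)
  show "0 < d" using assms by simp
  show "sqi (R c)" by (rule R_sqi[OF assms(1)])
  show "R c x \<le> 1" for x by (rule R_le_1[OF assms(1)])
  show "R c x \<le> 1 - exp (- (d * T (R c) x))" for x
    using R_fixed[OF assms(1), of x] mult_right_mono[OF assms(2) TR_nonneg[OF assms(1), of x]]
    by simp
qed

text \<open>Testing against \<psi> turns \<open>T\<close> into multiplication by \<open>lam\<close>;
  all that is left of the linear part is the distance of c \<lambda> from 1.\<close>

lemma integral_TR_minus_R:
  assumes c: "0 < c"
  shows "(\<integral>x. (c * T (R c) x - R c x) * \<psi> x \<partial>\<mu>) = (c * lam - 1) * (\<integral>x. R c x * \<psi> x \<partial>\<mu>)"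
proof -
  have "(\<integral>x. (c * T (R c) x - R c x) * \<psi> x \<partial>\<mu>) = (\<integral>x. c * (T (R c) x * \<psi> x) - R c x * \<psi> x \<partial>\<mu>)"
    by (simp add: left_diff_distrib mult.assoc)
  also have "\<dots> = c * (\<integral>x. T (R c) x * \<psi> x \<partial>\<mu>) - (\<integral>x. R c x * \<psi> x \<partial>\<mu>)"
    using square_integrable_mult[OF T_sqi[OF R_sqi[OF c]] \<psi>_sqi] square_integrable_mult[OF R_sqi[OF c] \<psi>_sqi] by simp
  finally show ?thesis by (simp add: integral_T_\<psi>[OF R_sqi[OF c]] left_diff_distrib)
qed

lemma TR_minus_R_ge:
  assumes c: "0 < c"
  shows "(R c x)\<^sup>2 / 2 \<le> c * T (R c) x - R c x"
proof -
  have "0 \<le> c * T (R c) x" using c TR_nonneg[OF c, of x] by simp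
  from le_of_one_minus_exp[OF this] show ?thesis unfolding R_fixed[OF c, of x, symmetric] by linarith
qed

text \<open>The tested defect is non-negative, as it dominates R^2 \<psi> / 2, but its integral is
  at most 0 when c \<lambda> \<le> 1. The quadratic lower bound makes the argument work at the
  critical value as well.\<close>

lemma R_eq_0_AE:
  assumes c: "0 < c" and sub: "c * lam \<le> 1"
  shows "AE x in \<mu>. R c x = 0"
proof -
  have s: "sqi (\<lambda>x. c * T (R c) x - R c x)"
    by (intro square_integrable_diff square_integrable_cmult T_sqi R_sqi c)
  have int: "integrable \<mu> (\<lambda>x. (c * T (R c) x - R c x) * \<psi> x)"
    by (rule square_integrable_mult[OF s \<psi>_sqi])
  have nn: "0 \<le> (c * T (R c) x - R c x) * \<psi> x" for x
    using TR_minus_R_ge[OF c, of x] zero_le_power2[of "R c x"] by (intro mult_nonneg_nonneg \<psi>_nonneg) linarith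
  have "0 \<le> (\<integral>x. (c * T (R c) x - R c x) * \<psi> x \<partial>\<mu>)" by (intro integral_nonneg_AE AE_I2 nn)
  moreover have "(c * lam - 1) * (\<integral>x. R c x * \<psi> x \<partial>\<mu>) \<le> 0"
    using sub R_nonneg[OF c] by (intro mult_nonpos_nonneg integral_nonneg_AE AE_I2 mult_nonneg_nonneg) auto
  ultimately have "(\<integral>x. (c * T (R c) x - R c x) * \<psi> x \<partial>\<mu>) = 0" using integral_TR_minus_R[OF c] by simp
  then have "AE x in \<mu>. (c * T (R c) x - R c x) * \<psi> x = 0"
    using integral_nonneg_eq_0_iff_AE[OF int] nn by simp
  then show ?thesis using \<psi>_pos
  proof eventually_elim
    case (elim x)
    then have "c * T (R c) x - R c x = 0" by simp
    with TR_minus_R_ge[OF c, of x] show ?case by simp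
  qed
qed

lemma survival_eq_0: "0 < c \<Longrightarrow> c * lam \<le> 1 \<Longrightarrow> surv_prob c = 0"
  unfolding survival_eq_R by (intro integral_eq_zero_AE R_eq_0_AE)

lemma B_pos: "0 < B"
proof -
  have "\<exists>x. 0 < \<psi> x"
  proof (rule ccontr)
    assume "\<not> (\<exists>x. 0 < \<psi> x)"
    then have "\<not> 0 < \<psi> x" for x by blast
    with \<psi>_pos have "AE x in \<mu>. False" by (auto elim!: eventually_mono)
    then show False by simp
  qed
  then show ?thesis using \<psi>_le by (meson less_le_trans)
qed

text \<open>With m = c \<lambda> and v = t \<psi>(x), being a subsolution means v \<le> 1 - exp (- m
  v). By the quadratic bound it suffices that v \<le> m v - (m v)^2 / 2, that is m^2 v \<le> 2 (m -
  1), and v \<le> t B.\<close>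

lemma R_lower_bound:
  assumes c: "0 < c" and t: "0 \<le> t" "t * B \<le> 1" "(c * lam)\<^sup>2 * (t * B) \<le> 2 * (c * lam - 1)"
  shows "t * \<psi> x \<le> R c x"
proof (rule le_R[OF c])
  show "sqi (\<lambda>x. t * \<psi> x)" by (intro square_integrable_cmult \<psi>_sqi)
  fix x
  have tB: "t * \<psi> x \<le> t * B" by (intro mult_left_mono t \<psi>_le)
  then show "t * \<psi> x \<le> 1" using t by simp
  define v where "v = t * \<psi> x"
  have v: "0 \<le> v" "v \<le> t * B" using tB t by (auto simp: v_def)
  define m where "m = c * lam"
  have m: "0 < m" using c lam_pos by (simp add: m_def)
  have "m\<^sup>2 * v \<le> 2 * (m - 1)"
    using mult_left_mono[OF v(2), of "m\<^sup>2"] t(3) by (simp add: m_def)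
  from mult_right_mono[OF this v(1)] have "v \<le> m * v - (m * v)\<^sup>2 / 2"
    by (simp add: power2_eq_square algebra_simps)
  also have "\<dots> \<le> 1 - exp (- (m * v))" using m v by (intro one_minus_exp_ge_quadratic) simp
  also have "m * v = c * T (\<lambda>x. t * \<psi> x) x" by (simp add: m_def v_def T_cmult T_\<psi>)
  finally show "t * \<psi> x \<le> 1 - exp (- (c * T (\<lambda>x. t * \<psi> x) x))" by (simp add: v_def)
qed

lemma R_pos:
  assumes c: "0 < c" and super: "1 < c * lam"
  shows "AE x in \<mu>. 0 < R c x"
proof -
  \<comment> \<open>The largest t that both side conditions of the lower bound permit.\<close>
  define t where "t = min 1 (2 * (c * lam - 1) / (c * lam)\<^sup>2) / B"
  have m: "0 < (c * lam)\<^sup>2" using super by (intro zero_less_power) linarith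
  have "0 < 2 * (c * lam - 1) / (c * lam)\<^sup>2" using m super by (intro divide_pos_pos) auto
  then have t: "0 < t" unfolding t_def by (intro divide_pos_pos B_pos) (simp only: min_less_iff_conj zero_less_one)
  have tB: "t * B = min 1 (2 * (c * lam - 1) / (c * lam)\<^sup>2)" using B_pos by (simp add: t_def)
  have "(c * lam)\<^sup>2 * (t * B) \<le> (c * lam)\<^sup>2 * (2 * (c * lam - 1) / (c * lam)\<^sup>2)"
    unfolding tB by (intro mult_left_mono) auto
  also have "\<dots> = 2 * (c * lam - 1)" using m by simp
  finally have "t * \<psi> x \<le> R c x" for x
    using t by (intro R_lower_bound[OF c]) (auto simp: tB)
  then show ?thesis using \<psi>_pos t by (auto elim!: eventually_mono intro: less_le_trans[OF mult_pos_pos])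
qed

lemma survival_pos:
  assumes c: "0 < c" and super: "1 < c * lam"
  shows "0 < surv_prob c"
proof -
  have "0 \<le> (\<integral>x. R c x \<partial>\<mu>)" by (intro integral_nonneg_AE AE_I2 R_nonneg c)
  moreover have "(\<integral>x. R c x \<partial>\<mu>) \<noteq> 0"
  proof
    assume "(\<integral>x. R c x \<partial>\<mu>) = 0"
    then have "AE x in \<mu>. R c x = 0"
      using integral_nonneg_eq_0_iff_AE[OF square_integrable_integrable[OF R_sqi[OF c]]] R_nonneg[OF c] by simp
    with R_pos[OF c super] have "AE x in \<mu>. False" by eventually_elim auto
    then show False by simp
  qed
  ultimately show ?thesis unfolding survival_eq_R[OF c] by linarith
qed

end


section \<open>Expansion at the critical point\<close>

context kernel_with_eigenfunction
begin

text \<open>The orthogonal decomposition of \<open>R c\<close> into a multiple of \<psi> and a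
  remainder. The excess is the relative distance from the critical value 1 /
  \<open>lam\<close>.\<close>

definition excess :: "real \<Rightarrow> real" where "excess c = c * lam - 1"
definition mean\<psi> :: "real \<Rightarrow> real" where "mean\<psi> c = (\<integral>x. R c x * \<psi> x \<partial>\<mu>)"
definition amp :: "real \<Rightarrow> real" where "amp c = mean\<psi> c / (\<integral>x. \<psi> x ^ 2 \<partial>\<mu>)"
definition remainder :: "real \<Rightarrow> 'a \<Rightarrow> real" where "remainder c = (\<lambda>x. R c x - amp c * \<psi> x)"

lemma integrable_\<psi>_power: "integrable \<mu> (\<lambda>x. \<psi> x ^ k)"
proof -
  have "\<psi> x ^ k \<le> B ^ k" for x by (intro power_mono \<psi>_le) simp
  then show ?thesis by (intro integrable_const_bound[where B="B ^ k"]) (auto intro!: AE_I2)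
qed

lemma nrm_const: "nrm (\<lambda>_. k) = \<bar>k\<bar>"
  using prob_space by (simp add: norm2_def)

lemma int\<psi>_pos: "0 < (\<integral>x. \<psi> x \<partial>\<mu>)"
  using integral_\<psi>_power_pos[of 1] by simp

text \<open>Bounding the excess by 1 gives c \<lambda> \<le> 2, which makes all constants below
  independent of c.\<close>

context
  fixes c :: real
  assumes super: "0 < excess c" and le2: "excess c \<le> 1"
begin

lemma c_pos: "0 < c"
proof (rule ccontr)
  assume "\<not> 0 < c"
  then have "c * lam \<le> 0" using lam_pos by (simp add: mult_nonpos_nonneg)
  then show False using super by (simp add: excess_def)
qed

lemma c_le: "c \<le> 2 / lam"
  using le2 lam_pos by (simp add: excess_def field_simps)

lemma remainder_sqi: "sqi (remainder c)"
  unfolding remainder_def by (intro square_integrable_diff square_integrable_cmult R_sqi c_pos \<psi>_sqi)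

lemma amp_eq: "amp c * (\<integral>x. \<psi> x ^ 2 \<partial>\<mu>) = mean\<psi> c"
  using integral_\<psi>_power_pos[of 2] by (simp add: amp_def)

lemma remainder_orth: "(\<integral>x. remainder c x * \<psi> x \<partial>\<mu>) = 0"
proof -
  have "(\<integral>x. remainder c x * \<psi> x \<partial>\<mu>) = (\<integral>x. R c x * \<psi> x - amp c * \<psi> x ^ 2 \<partial>\<mu>)"
    by (simp add: remainder_def algebra_simps power2_eq_square)
  also have "\<dots> = mean\<psi> c - amp c * (\<integral>x. \<psi> x ^ 2 \<partial>\<mu>)"
    unfolding mean\<psi>_def using square_integrable_mult[OF R_sqi[OF c_pos] \<psi>_sqi] integrable_\<psi>_power[of 2] by simp
  finally show ?thesis using amp_eq by simp
qed

lemma TR_le_norm: "c * T (R c) x \<le> 2 * C / lam * nrm (R c)"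
proof -
  have "T (R c) x \<le> C * nrm (R c)" using T_bound[OF R_sqi[OF c_pos], of x] by simp
  then have "c * T (R c) x \<le> 2 / lam * (C * nrm (R c))"
    using c_le TR_nonneg[OF c_pos, of x] c_pos lam_pos C_pos by (intro mult_mono) auto
  then show ?thesis by simp
qed

lemma TR_minus_R_le: "c * T (R c) x - R c x \<le> (c * T (R c) x)\<^sup>2 / 2"
proof -
  have "0 \<le> c * T (R c) x" using c_pos TR_nonneg[OF c_pos, of x] by simp
  from one_minus_exp_ge_quadratic[OF this] show ?thesis unfolding R_fixed[OF c_pos, of x, symmetric] by linarith
qed

lemma R_le_TR: "R c x \<le> c * T (R c) x"
  using TR_minus_R_ge[OF c_pos, of x] zero_le_power2[of "R c x"] by linarith

lemma mean\<psi>_nonneg: "0 \<le> mean\<psi> c"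
  unfolding mean\<psi>_def by (intro integral_nonneg_AE AE_I2 mult_nonneg_nonneg R_nonneg c_pos \<psi>_nonneg)

lemma amp_nonneg: "0 \<le> amp c"
  unfolding amp_def by (intro divide_nonneg_nonneg mean\<psi>_nonneg) simp

lemma square_mean_le: "(\<integral>x. (R c x)\<^sup>2 * \<psi> x \<partial>\<mu>) \<le> 2 * excess c * mean\<psi> c"
proof -
  have s: "sqi (\<lambda>x. c * T (R c) x - R c x)"
    by (intro square_integrable_diff square_integrable_cmult T_sqi R_sqi c_pos)
  have "sqi (\<lambda>x. (R c x)\<^sup>2)"
    using R_nonneg[OF c_pos] R_le_1[OF c_pos] c_pos
    by (intro square_integrable_bounded[where B=1]) (auto simp: power_le_one)
  from square_integrable_mult[OF this \<psi>_sqi] have i: "integrable \<mu> (\<lambda>x. (R c x)\<^sup>2 * \<psi> x)" .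
  have "(\<integral>x. (R c x)\<^sup>2 * \<psi> x \<partial>\<mu>) \<le> (\<integral>x. 2 * ((c * T (R c) x - R c x) * \<psi> x) \<partial>\<mu>)"
  proof (rule integral_mono)
    show "(R c x)\<^sup>2 * \<psi> x \<le> 2 * ((c * T (R c) x - R c x) * \<psi> x)" for x
      using mult_right_mono[OF TR_minus_R_ge[OF c_pos, of x] \<psi>_nonneg[of x]] by simp
  qed (use i square_integrable_mult[OF s \<psi>_sqi] in auto)
  also have "\<dots> = 2 * excess c * mean\<psi> c"
    using integral_TR_minus_R[OF c_pos] by (simp add: excess_def mean\<psi>_def)
  finally show ?thesis .
qed

text \<open>Cauchy-Schwarz with weight \<psi>, splitting R \<psi> as R sqrt \<psi> times sqrt
  \<psi>, bounds the square of the mean J by the integral of R^2 \<psi> times that of \<psi>. The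
  former is at most 2 J times the excess, so one factor J cancels.\<close>

lemma mean\<psi>_le: "mean\<psi> c \<le> 2 * excess c * (\<integral>x. \<psi> x \<partial>\<mu>)"
proof (cases "mean\<psi> c = 0")
  case True
  then show ?thesis using super int\<psi>_pos by simp
next
  case False
  then have J: "0 < mean\<psi> c" using mean\<psi>_nonneg by simp
  have m[measurable]: "R c \<in> borel_measurable borel" by (rule R_measurable[OF c_pos])
  have b: "R c x * sqrt (\<psi> x) \<le> 1 * sqrt B" for x
    using R_nonneg[OF c_pos] R_le_1[OF c_pos] \<psi>_le by (intro mult_mono) auto
  have s1: "sqi (\<lambda>x. R c x * sqrt (\<psi> x))"
    using b R_nonneg[OF c_pos] by (intro square_integrable_bounded[where B="sqrt B"]) auto
  have s2: "sqi (\<lambda>x. sqrt (\<psi> x))" using \<psi>_le by (intro square_integrable_bounded[where B="sqrt B"]) auto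
  have "mean\<psi> c = (\<integral>x. (R c x * sqrt (\<psi> x)) * sqrt (\<psi> x) \<partial>\<mu>)"
    by (simp add: mean\<psi>_def mult.assoc)
  also have "\<dots> \<le> nrm (\<lambda>x. R c x * sqrt (\<psi> x)) * nrm (\<lambda>x. sqrt (\<psi> x))"
    using Cauchy_Schwarz_norm2[OF s1 s2] by simp
  finally have "(mean\<psi> c)\<^sup>2 \<le> (nrm (\<lambda>x. R c x * sqrt (\<psi> x)) * nrm (\<lambda>x. sqrt (\<psi> x)))\<^sup>2"
    using J by (intro power_mono) auto
  also have "\<dots> = (\<integral>x. (R c x)\<^sup>2 * \<psi> x \<partial>\<mu>) * (\<integral>x. \<psi> x \<partial>\<mu>)"
    by (simp add: power_mult_distrib norm2_power2)
  also have "\<dots> \<le> 2 * excess c * mean\<psi> c * (\<integral>x. \<psi> x \<partial>\<mu>)"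
    using square_mean_le int\<psi>_pos by (intro mult_right_mono) auto
  finally have "mean\<psi> c * mean\<psi> c \<le> mean\<psi> c * (2 * excess c * (\<integral>x. \<psi> x \<partial>\<mu>))"
    by (simp add: power2_eq_square mult_ac)
  with J show ?thesis by simp
qed

text \<open>\<open>R c\<close> is an eigenfunction up to second order. With u = c T R and e the
  excess, multiplication by c \<lambda> \<ge> 1 turns the defect \<lambda>R - TR into \<lambda> (e R
  - (u - R)), where 0 \<le> u - R \<le> u^2 / 2. The supremum of u is controlled by the norm of R
  through c \<le> 2 / \<lambda> and the row bound, whence 2 C / \<lambda>.\<close>

lemma nrm_lam_minus_T:
  "nrm (\<lambda>x. lam * R c x - T (R c) x) \<le>
    lam * (1 + (2 * C / lam)\<^sup>2) * (excess c * nrm (R c) + (nrm (R c))\<^sup>2)"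
proof -
  let ?D = "2 * C / lam" and ?N = "nrm (R c)"
  have sR: "sqi (R c)" by (rule R_sqi[OF c_pos])
  have pw: "\<bar>lam * R c x - T (R c) x\<bar> \<le> \<bar>lam * (excess c * R c x + ?D\<^sup>2 * ?N\<^sup>2)\<bar>" for x
  proof -
    let ?u = "c * T (R c) x"
    have u0: "0 \<le> ?u" using c_pos TR_nonneg[OF c_pos, of x] by simp
    have u: "?u - R c x \<le> ?D\<^sup>2 * ?N\<^sup>2"
    proof -
      have "?u\<^sup>2 \<le> (?D * ?N)\<^sup>2" using TR_le_norm u0 by (intro power_mono)
      with TR_minus_R_le[of x] show ?thesis unfolding power_mult_distrib using zero_le_power2[of "?D * ?N"]
        unfolding power_mult_distrib by linarith
    qed
    have e0: "0 \<le> excess c * R c x" using super R_nonneg[OF c_pos, of x] by simp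
    have m: "1 \<le> c * lam" using super by (simp add: excess_def)
    have "(c * lam) * (lam * R c x - T (R c) x) = lam * (excess c * R c x - (?u - R c x))"
      by (simp add: excess_def algebra_simps)
    then have 1: "(c * lam) * \<bar>lam * R c x - T (R c) x\<bar> = lam * \<bar>excess c * R c x - (?u - R c x)\<bar>"
      using c_pos lam_pos by (metis abs_mult abs_of_pos mult_pos_pos)
    have 2: "1 * \<bar>lam * R c x - T (R c) x\<bar> \<le> (c * lam) * \<bar>lam * R c x - T (R c) x\<bar>"
      by (intro mult_right_mono m) simp
    have "\<bar>excess c * R c x - (?u - R c x)\<bar> \<le> excess c * R c x + ?D\<^sup>2 * ?N\<^sup>2"
      using u e0 R_le_TR[of x] by linarith
    then have "lam * \<bar>excess c * R c x - (?u - R c x)\<bar> \<le> lam * (excess c * R c x + ?D\<^sup>2 * ?N\<^sup>2)"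
      using lam_pos by (intro mult_left_mono) auto
    from order_trans[OF 2 order_trans[OF eq_refl[OF 1] this]] abs_ge_self[of "lam * (excess c * R c x + ?D\<^sup>2 * ?N\<^sup>2)"]
    show ?thesis by simp
  qed
  have s1: "sqi (\<lambda>x. excess c * R c x)" by (intro square_integrable_cmult sR)
  have s2: "sqi (\<lambda>x. ?D\<^sup>2 * ?N\<^sup>2)" by (rule square_integrable_const)
  have "nrm (\<lambda>x. lam * R c x - T (R c) x) \<le> nrm (\<lambda>x. lam * (excess c * R c x + ?D\<^sup>2 * ?N\<^sup>2))"
    by (intro norm2_mono_AE square_integrable_diff square_integrable_cmult square_integrable_add s1 s2 sR T_sqi AE_I2 pw)
  also have "\<dots> = lam * nrm (\<lambda>x. excess c * R c x + ?D\<^sup>2 * ?N\<^sup>2)"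
    using lam_pos by (simp add: norm2_cmult)
  also have "nrm (\<lambda>x. excess c * R c x + ?D\<^sup>2 * ?N\<^sup>2) \<le> nrm (\<lambda>x. excess c * R c x) + nrm (\<lambda>x. ?D\<^sup>2 * ?N\<^sup>2)"
    by (rule norm2_triangle[OF s1 s2])
  also have "nrm (\<lambda>x. excess c * R c x) = excess c * ?N" using super by (simp add: norm2_cmult)
  also have "nrm (\<lambda>x. ?D\<^sup>2 * ?N\<^sup>2) = ?D\<^sup>2 * ?N\<^sup>2" by (simp add: nrm_const)
  also have "excess c * ?N + ?D\<^sup>2 * ?N\<^sup>2 \<le> (1 + ?D\<^sup>2) * (excess c * ?N + ?N\<^sup>2)"
    using super by (simp add: algebra_simps)
  finally show ?thesis using lam_pos by (simp add: mult.assoc)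
qed

text \<open>Excludes the zero solution, so that the scalar equation may later be divided by the
  amplitude. The choice t B = e / 2, with e the excess, meets the condition of the lower bound
  because (c \<lambda>)^2 \<le> 4.\<close>

lemma amp_lower: "excess c / (2 * B) \<le> amp c"
proof -
  define t where "t = excess c / (2 * B)"
  have tB: "t * B = excess c / 2" using B_pos by (simp add: t_def)
  have "(c * lam)\<^sup>2 \<le> 2\<^sup>2" using le2 super by (intro power_mono) (auto simp: excess_def)
  then have "(c * lam)\<^sup>2 * (t * B) \<le> 4 * (excess c / 2)"
    unfolding tB using super by (intro mult_right_mono) auto
  then have le: "t * \<psi> x \<le> R c x" for x
    using super le2 B_pos tB by (intro R_lower_bound[OF c_pos]) (auto simp: t_def excess_def)
  have "(\<integral>x. t * (\<psi> x ^ 2) \<partial>\<mu>) \<le> mean\<psi> c"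
    unfolding mean\<psi>_def
  proof (rule integral_mono)
    show "t * \<psi> x ^ 2 \<le> R c x * \<psi> x" for x
      using mult_right_mono[OF le[of x] \<psi>_nonneg[of x]] by (simp add: power2_eq_square mult.assoc)
  qed (use integrable_\<psi>_power[of 2] square_integrable_mult[OF R_sqi[OF c_pos] \<psi>_sqi] in auto)
  then have "t * (\<integral>x. \<psi> x ^ 2 \<partial>\<mu>) \<le> mean\<psi> c" by simp
  then show ?thesis using integral_\<psi>_power_pos[of 2] unfolding amp_def t_def[symmetric] by (simp add: pos_le_divide_eq)
qed

end

text \<open>A function positive almost everywhere may lack a positive lower bound; small measure of
  its low level sets is the substitute, used for \<psi> here and for \<open>R c\<close>
  later.\<close>

lemma measure_small_levels_tendsto:
  assumes f [measurable]: "f \<in> borel_measurable borel" and pos: "AE x in \<mu>. 0 < f x"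
  shows "(\<lambda>n. measure \<mu> {x. f x < 1 / real (Suc n)}) \<longlonglongrightarrow> 0"
proof -
  let ?A = "\<lambda>n. {x. f x < 1 / real (Suc n)}"
  have "(\<lambda>n. measure \<mu> (?A n)) \<longlonglongrightarrow> measure \<mu> (\<Inter>n. ?A n)"
  proof (rule finite_Lim_measure_decseq)
    show "decseq ?A"
      unfolding decseq_Suc_iff
    proof safe
      fix n x assume "f x < 1 / real (Suc (Suc n))"
      also have "\<dots> \<le> 1 / real (Suc n)" by (simp add: frac_le)
      finally show "f x < 1 / real (Suc n)" .
    qed
  qed auto
  moreover have "AE x in \<mu>. x \<notin> (\<Inter>n. ?A n)"
    using pos
  proof eventually_elim
    case (elim x)
    then obtain n where "1 / real (Suc n) < f x" using nat_approx_posE by blast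
    then have "\<not> f x < 1 / real (Suc n)" by simp
    then show ?case by blast
  qed
  moreover have "(\<Inter>n. ?A n) \<in> sets \<mu>" by measurable
  ultimately show ?thesis using AE_iff_null_sets measure_eq_0_null_sets by metis
qed

text \<open>Smallness without a rate, to start the bootstrap that follows. The mean against \<psi>
  controls R only where \<psi> is not small: below the level 1 / (n + 1) one uses R \<le> 1 on a set
  of small measure, above it R^2 \<le> (n + 1) R \<psi>.\<close>

lemma nrm_R_small:
  assumes "0 < \<eta>"
  obtains \<delta> where "0 < \<delta>" "\<delta> \<le> 1" "\<And>c. 0 < excess c \<Longrightarrow> excess c \<le> \<delta> \<Longrightarrow> nrm (R c) \<le> \<eta>"
proof -
  note measure_small_levels_tendsto[OF \<psi>_measurable \<psi>_pos]
  moreover have "0 < \<eta>\<^sup>2 / 2" using assms by simp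
  ultimately have "eventually (\<lambda>n. measure \<mu> {x. \<psi> x < 1 / Suc n} < \<eta>\<^sup>2 / 2) sequentially"
    by (rule order_tendstoD(2))
  then obtain n where n: "measure \<mu> {x. \<psi> x < 1 / Suc n} < \<eta>\<^sup>2 / 2" by (auto simp: eventually_sequentially)
  define K where "K = Suc n * (2 * (\<integral>x. \<psi> x \<partial>\<mu>))"
  have K: "0 < K" using int\<psi>_pos by (simp add: K_def)
  define \<delta> where "\<delta> = min 1 (\<eta>\<^sup>2 / 2 / K)"
  have \<delta>: "0 < \<delta>" "\<delta> \<le> 1" using K assms by (auto simp: \<delta>_def)
  have "nrm (R c) \<le> \<eta>" if e: "0 < excess c" "excess c \<le> \<delta>" for c
  proof (rule power2_le_imp_le)
    have e1: "excess c \<le> 1" using e \<delta> by simp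
    note cp = c_pos[OF e(1) e1]
    have pw: "(R c x)\<^sup>2 \<le> indicator {x. \<psi> x < 1 / Suc n} x + Suc n * (R c x * \<psi> x)" for x
    proof (cases "\<psi> x < 1 / Suc n")
      case True
      then show ?thesis using R_nonneg[OF cp, of x] R_le_1[OF cp, of x] by (simp add: power_le_one add_increasing2)
    next
      case False
      then have "1 \<le> Suc n * \<psi> x" by (simp add: field_simps)
      then have "R c x * R c x \<le> R c x * (Suc n * \<psi> x)"
        using R_nonneg[OF cp, of x] R_le_1[OF cp, of x] by (intro mult_left_mono) auto
      with False show ?thesis by (simp add: power2_eq_square mult_ac)
    qed
    have "(nrm (R c))\<^sup>2 = (\<integral>x. (R c x)\<^sup>2 \<partial>\<mu>)" by (rule norm2_power2)
    also have "\<dots> \<le> (\<integral>x. indicator {x. \<psi> x < 1 / Suc n} x + Suc n * (R c x * \<psi> x) \<partial>\<mu>)"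
      using square_integrable_square[OF R_sqi[OF cp]] square_integrable_mult[OF R_sqi[OF cp] \<psi>_sqi] pw
      by (intro integral_mono Bochner_Integration.integrable_add integrable_mult_right integrable_real_indicator)
        (auto simp: less_top[symmetric])
    also have "\<dots> = measure \<mu> {x. \<psi> x < 1 / Suc n} + Suc n * mean\<psi> c"
      using square_integrable_mult[OF R_sqi[OF cp] \<psi>_sqi]
      by (subst Bochner_Integration.integral_add) (auto simp: mean\<psi>_def less_top[symmetric] simp del: of_nat_Suc)
    also have "Suc n * mean\<psi> c \<le> Suc n * (2 * excess c * (\<integral>x. \<psi> x \<partial>\<mu>))"
      by (intro mult_left_mono mean\<psi>_le e e1) auto
    also have "\<dots> = K * excess c" by (simp add: K_def)
    also have "\<dots> \<le> K * (\<eta>\<^sup>2 / 2 / K)" using e K unfolding \<delta>_def by (intro mult_left_mono) auto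
    also have "\<dots> = \<eta>\<^sup>2 / 2" using K by simp
    finally show "(nrm (R c))\<^sup>2 \<le> \<eta>\<^sup>2" using n by simp
  qed (use assms in simp)
  with \<delta> show ?thesis by (rule that)
qed

text \<open>With e the excess and N the norm of R, the gap bounds the remainder by E (e N + N^2).
  Once e and N are at most 1 / (4 E), this is at most N / 2 and is absorbed on the left, so N =
  O(e). Inserting this once more makes the remainder O(e^2).\<close>

lemma linear_bounds:
  obtains \<delta> K1 K2 where "0 < \<delta>" "\<delta> \<le> 1" "0 < K1" "0 < K2"
    "\<And>c. 0 < excess c \<Longrightarrow> excess c \<le> \<delta> \<Longrightarrow> nrm (R c) \<le> K1 * excess c"
    "\<And>c. 0 < excess c \<Longrightarrow> excess c \<le> \<delta> \<Longrightarrow> nrm (remainder c) \<le> K2 * (excess c)\<^sup>2"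
proof -
  obtain L where L: "0 < L"
    "\<And>f. sqi f \<Longrightarrow> (\<integral>x. f x * \<psi> x \<partial>\<mu>) = 0 \<Longrightarrow> nrm f \<le> L * nrm (\<lambda>x. lam * f x - T f x)"
    by (rule spectral_gap) blast
  define E where "E = L * (lam * (1 + (2 * C / lam)\<^sup>2))"
  have E: "0 < E" using L lam_pos unfolding E_def by (intro mult_pos_pos) (auto intro: add_pos_nonneg)
  have rem: "nrm (remainder c) \<le> E * (excess c * nrm (R c) + (nrm (R c))\<^sup>2)"
    if e: "0 < excess c" "excess c \<le> 1" for c
  proof -
    have cp: "0 < c" by (rule c_pos[OF e])
    \<comment> \<open>\<lambda> - T annihilates \<psi>, so it takes the same value on the remainder
      as on R.\<close>
    have "T (remainder c) x = T (R c) x - amp c * (lam * \<psi> x)" for x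
      unfolding remainder_def by (subst T_diff) (auto intro!: R_sqi cp square_integrable_cmult \<psi>_sqi simp: T_cmult T_\<psi>)
    then have "(\<lambda>x. lam * remainder c x - T (remainder c) x) = (\<lambda>x. lam * R c x - T (R c) x)"
      by (auto simp: remainder_def algebra_simps)
    then have "nrm (remainder c) \<le> L * nrm (\<lambda>x. lam * R c x - T (R c) x)"
      using L(2)[OF remainder_sqi[OF e] remainder_orth[OF e]] by simp
    also have "\<dots> \<le> L * (lam * (1 + (2 * C / lam)\<^sup>2) * (excess c * nrm (R c) + (nrm (R c))\<^sup>2))"
      using L(1) by (intro mult_left_mono nrm_lam_minus_T e) auto
    finally show ?thesis by (simp add: E_def mult.assoc)
  qed
  obtain \<delta>0 where \<delta>0: "0 < \<delta>0" "\<delta>0 \<le> 1" 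
    "\<And>c. 0 < excess c \<Longrightarrow> excess c \<le> \<delta>0 \<Longrightarrow> nrm (R c) \<le> 1 / (4 * E)"
    using nrm_R_small[of "1 / (4 * E)"] E by auto
  define \<delta> where "\<delta> = min \<delta>0 (1 / (4 * E))"
  have \<delta>: "0 < \<delta>" "\<delta> \<le> 1" using \<delta>0 E by (auto simp: \<delta>_def)
  define P1 P2 where "P1 = (\<integral>x. \<psi> x \<partial>\<mu>)" and "P2 = (\<integral>x. \<psi> x ^ 2 \<partial>\<mu>)"
  have P: "0 < P1" "0 < P2" using int\<psi>_pos integral_\<psi>_power_pos[of 2] by (auto simp: P1_def P2_def)
  define K1 where "K1 = 4 * P1 / P2 * nrm \<psi> + 1"
  have K1: "0 < K1" using P by (simp add: K1_def add_nonneg_pos)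
  define K2 where "K2 = E * (K1 + K1\<^sup>2)"
  have K2: "0 < K2" using E K1 by (simp add: K2_def add_pos_pos)
  have b1: "nrm (R c) \<le> K1 * excess c" if e: "0 < excess c" "excess c \<le> \<delta>" for c
  proof -
    have e1: "excess c \<le> 1" using e \<delta> by simp
    have cp: "0 < c" by (rule c_pos[OF e(1) e1])
    let ?N = "nrm (R c)"
    have co: "amp c \<le> 2 * P1 / P2 * excess c"
      using mean\<psi>_le[OF e(1) e1] P unfolding amp_def P1_def[symmetric] P2_def[symmetric]
      by (simp add: field_simps)
    have small: "E * (excess c + ?N) \<le> 1 / 2"
    proof -
      have "excess c + ?N \<le> 1 / (4 * E) + 1 / (4 * E)"
        using e \<delta>0(3)[of c] by (intro add_mono) (auto simp: \<delta>_def)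
      then have "E * (excess c + ?N) \<le> E * (1 / (4 * E) + 1 / (4 * E))"
        using E by (intro mult_left_mono) auto
      also have "\<dots> = 1 / 2" using E by (simp add: field_simps)
      finally show ?thesis .
    qed
    have "?N \<le> nrm (remainder c) + nrm (\<lambda>x. amp c * \<psi> x)"
      unfolding remainder_def by (rule norm2_triangle_diff) (intro R_sqi cp square_integrable_cmult \<psi>_sqi)+
    also have "nrm (\<lambda>x. amp c * \<psi> x) = amp c * nrm \<psi>" using amp_nonneg[OF e(1) e1] by (simp add: norm2_cmult)
    also have "\<dots> \<le> 2 * P1 / P2 * excess c * nrm \<psi>" by (intro mult_right_mono co) simp
    also have "nrm (remainder c) \<le> E * (excess c + ?N) * ?N"
      using rem[OF e(1) e1] by (simp add: power2_eq_square algebra_simps)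
    also have "\<dots> \<le> 1 / 2 * ?N" by (intro mult_right_mono small) simp
    finally have "?N \<le> 1 / 2 * ?N + 2 * P1 / P2 * excess c * nrm \<psi>" by simp
    then have "?N \<le> 2 * (2 * P1 / P2 * excess c * nrm \<psi>)" by linarith
    also have "\<dots> = 4 * P1 / P2 * nrm \<psi> * excess c" by simp
    also have "\<dots> \<le> K1 * excess c" using e by (simp add: K1_def distrib_right)
    finally show ?thesis .
  qed
  have b2: "nrm (remainder c) \<le> K2 * (excess c)\<^sup>2" if e: "0 < excess c" "excess c \<le> \<delta>" for c
  proof -
    have e1: "excess c \<le> 1" using e \<delta> by simp
    have "excess c * nrm (R c) + (nrm (R c))\<^sup>2 \<le> excess c * (K1 * excess c) + (K1 * excess c)\<^sup>2"
      using e by (intro add_mono mult_left_mono power_mono b1) auto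
    also have "\<dots> = (K1 + K1\<^sup>2) * (excess c)\<^sup>2" by (simp add: power2_eq_square algebra_simps)
    finally have "E * (excess c * nrm (R c) + (nrm (R c))\<^sup>2) \<le> E * ((K1 + K1\<^sup>2) * (excess c)\<^sup>2)"
      using E by (intro mult_left_mono) auto
    with rem[OF e(1) e1] show ?thesis by (simp add: K2_def mult.assoc)
  qed
  from \<delta> K1 K2 b1 b2 show ?thesis by (rule that)
qed

text \<open>The tested equation to third order in the excess e. With u = c T R, two errors occur: u
  - R - R^2 / 2 lies between 0 and u^3 / 2, and replacing R by its \<psi>-component in the quadratic
  term costs a remainder of norm O(e^2) times a factor O(e).\<close>

lemma amp_asymptotics:
  obtains \<delta> K where "0 < \<delta>" "\<delta> \<le> 1" "0 < K"
    "\<And>c. 0 < excess c \<Longrightarrow> excess c \<le> \<delta> \<Longrightarrow>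
      \<bar>excess c * mean\<psi> c - (amp c)\<^sup>2 * (\<integral>x. \<psi> x ^ 3 \<partial>\<mu>) / 2\<bar> \<le> K * (excess c) ^ 3"
    "\<And>c. 0 < excess c \<Longrightarrow> excess c \<le> \<delta> \<Longrightarrow> nrm (remainder c) \<le> K * (excess c)\<^sup>2"
proof -
  obtain \<delta> K1 K2 where lb: "0 < \<delta>" "\<delta> \<le> 1" "0 < K1" "0 < K2"
    "\<And>c. 0 < excess c \<Longrightarrow> excess c \<le> \<delta> \<Longrightarrow> nrm (R c) \<le> K1 * excess c"
    "\<And>c. 0 < excess c \<Longrightarrow> excess c \<le> \<delta> \<Longrightarrow> nrm (remainder c) \<le> K2 * (excess c)\<^sup>2"
    by (rule linear_bounds) blast
  define P1 P2 P3 where "P1 = (\<integral>x. \<psi> x \<partial>\<mu>)" and "P2 = (\<integral>x. \<psi> x ^ 2 \<partial>\<mu>)" and "P3 = (\<integral>x. \<psi> x ^ 3 \<partial>\<mu>)"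
  have P: "0 < P1" "0 < P2" using int\<psi>_pos integral_\<psi>_power_pos[of 2] by (auto simp: P1_def P2_def)
  define D where "D = 2 * C / lam * K1"
  have D: "0 < D" using C_pos lam_pos lb(3) by (simp add: D_def)
  define K4 where "K4 = (D + 2 * P1 / P2 * B) * B"
  have K4: "0 < K4" using D P B_pos by (auto simp: K4_def intro!: mult_pos_pos add_pos_pos)
  define K where "K = D ^ 3 / 2 * P1 + K2 * K4 / 2 + K2"
  have K: "0 < K" using D P K4 lb by (auto simp: K_def intro!: add_pos_pos mult_pos_pos)
  have main: "\<bar>excess c * mean\<psi> c - (amp c)\<^sup>2 * P3 / 2\<bar> \<le> K * (excess c) ^ 3"
    if e: "0 < excess c" "excess c \<le> \<delta>" for c
  proof -
    let ?e = "excess c"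
    have e1: "?e \<le> 1" using e lb by simp
    have cp: "0 < c" by (rule c_pos[OF e(1) e1])
    have [measurable]: "R c \<in> borel_measurable borel" by (rule R_measurable[OF cp])
    let ?u = "\<lambda>x. c * T (R c) x"
    have u0: "0 \<le> ?u x" for x using cp TR_nonneg[OF cp, of x] by simp
    have uD: "?u x \<le> D * ?e" for x
    proof -
      have "?u x \<le> 2 * C / lam * nrm (R c)" by (rule TR_le_norm[OF e(1) e1])
      also have "\<dots> \<le> 2 * C / lam * (K1 * ?e)"
        using C_pos lam_pos by (intro mult_left_mono lb(5) e) auto
      finally show ?thesis by (simp add: D_def mult.assoc)
    qed
    have R0: "0 \<le> R c x" for x by (rule R_nonneg[OF cp])
    have RD: "R c x \<le> D * ?e" for x using R_le_TR[OF e(1) e1, of x] uD[of x] by linarith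
    have q: "0 \<le> ?u x - R c x - (R c x)\<^sup>2 / 2" "?u x - R c x - (R c x)\<^sup>2 / 2 \<le> (D * ?e) ^ 3 / 2" for x
    proof -
      show "0 \<le> ?u x - R c x - (R c x)\<^sup>2 / 2" using TR_minus_R_ge[OF cp, of x] by linarith
      have "(?u x)\<^sup>2 - (R c x)\<^sup>2 = (?u x - R c x) * (?u x + R c x)"
        by (simp add: power2_eq_square algebra_simps)
      also have "\<dots> \<le> ((?u x)\<^sup>2 / 2) * (?u x + ?u x)"
        using TR_minus_R_le[OF e(1) e1, of x] R_le_TR[OF e(1) e1, of x] R0[of x] by (intro mult_mono) auto
      also have "\<dots> = (?u x) ^ 3" by (simp add: power2_eq_square power3_eq_cube)
      also have "\<dots> \<le> (D * ?e) ^ 3" by (intro power_mono uD u0)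
      finally show "?u x - R c x - (R c x)\<^sup>2 / 2 \<le> (D * ?e) ^ 3 / 2"
        using TR_minus_R_le[OF e(1) e1, of x] by linarith
    qed
    have su: "sqi ?u" by (intro square_integrable_cmult T_sqi R_sqi cp)
    have sR: "sqi (R c)" by (rule R_sqi[OF cp])
    have sR2: "sqi (\<lambda>x. (R c x)\<^sup>2)"
      using R0 R_le_1[OF cp] by (intro square_integrable_bounded[where B=1]) (auto simp: power_le_one)
    have i1: "integrable \<mu> (\<lambda>x. (?u x - R c x) * \<psi> x)" and i2: "integrable \<mu> (\<lambda>x. (R c x)\<^sup>2 * \<psi> x)"
      by (intro square_integrable_mult square_integrable_diff su sR sR2 \<psi>_sqi)+
    have i\<psi>: "integrable \<mu> \<psi>" by (rule square_integrable_integrable[OF \<psi>_sqi])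
    define S where "S = (\<integral>x. (R c x)\<^sup>2 * \<psi> x \<partial>\<mu>)"
    have "?e * mean\<psi> c = (\<integral>x. (?u x - R c x) * \<psi> x \<partial>\<mu>)"
      using integral_TR_minus_R[OF cp] by (simp add: excess_def mean\<psi>_def)
    then have eq: "?e * mean\<psi> c - S / 2 = (\<integral>x. (?u x - R c x - (R c x)\<^sup>2 / 2) * \<psi> x \<partial>\<mu>)"
      using i1 i2 unfolding S_def by (subst left_diff_distrib) simp
    have "0 \<le> ?e * mean\<psi> c - S / 2"
      unfolding eq by (intro integral_nonneg_AE AE_I2 mult_nonneg_nonneg q \<psi>_nonneg)
    moreover have "?e * mean\<psi> c - S / 2 \<le> (D * ?e) ^ 3 / 2 * P1"
    proof -
      have "?e * mean\<psi> c - S / 2 \<le> (\<integral>x. (D * ?e) ^ 3 / 2 * \<psi> x \<partial>\<mu>)"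
        unfolding eq
      proof (rule integral_mono)
        show "integrable \<mu> (\<lambda>x. (?u x - R c x - (R c x)\<^sup>2 / 2) * \<psi> x)"
          using i1 i2 by (subst left_diff_distrib) auto
        show "(?u x - R c x - (R c x)\<^sup>2 / 2) * \<psi> x \<le> (D * ?e) ^ 3 / 2 * \<psi> x" for x
          by (intro mult_right_mono q \<psi>_nonneg)
      qed (use i\<psi> in auto)
      then show ?thesis by (simp add: P1_def)
    qed
    ultimately have A: "\<bar>?e * mean\<psi> c - S / 2\<bar> \<le> (D * ?e) ^ 3 / 2 * P1" by linarith
    \<comment> \<open>The second factor of the difference of squares R^2 - (a \<psi>)^2, with a the
      amplitude, weighted by \<psi>; the first factor is the remainder.\<close>
    let ?g = "\<lambda>x. (R c x + amp c * \<psi> x) * \<psi> x"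
    have co0: "0 \<le> amp c" by (rule amp_nonneg[OF e(1) e1])
    have co: "amp c \<le> 2 * P1 / P2 * ?e"
      using mean\<psi>_le[OF e(1) e1] P unfolding amp_def P1_def[symmetric] P2_def[symmetric]
      by (simp add: field_simps)
    have gb: "\<bar>?g x\<bar> \<le> K4 * ?e" for x
    proof -
      have *: "amp c * \<psi> x \<le> (2 * P1 / P2 * ?e) * B"
        using co0 B_pos P e by (intro mult_mono co \<psi>_le) auto
      then have "?g x \<le> (D * ?e + (2 * P1 / P2 * ?e) * B) * B"
        using R0[of x] D e co0 P B_pos by (intro mult_mono add_mono[OF RD *] \<psi>_le) auto
      also have "\<dots> = K4 * ?e" by (simp add: K4_def algebra_simps)
      finally show ?thesis using R0[of x] co0 by simp
    qed
    have sg: "sqi ?g" by (rule square_integrable_bounded[OF _ gb]) measurable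
    have ng: "nrm ?g \<le> K4 * ?e" by (rule norm2_bounded[OF _ gb]) measurable
    have "S - (amp c)\<^sup>2 * P3 = (\<integral>x. remainder c x * ?g x \<partial>\<mu>)"
    proof -
      have "(\<integral>x. remainder c x * ?g x \<partial>\<mu>) = (\<integral>x. (R c x)\<^sup>2 * \<psi> x - (amp c)\<^sup>2 * \<psi> x ^ 3 \<partial>\<mu>)"
        by (intro Bochner_Integration.integral_cong) (auto simp: remainder_def power2_eq_square power3_eq_cube algebra_simps)
      also have "\<dots> = S - (amp c)\<^sup>2 * P3" unfolding S_def P3_def using i2 integrable_\<psi>_power[of 3] by simp
      finally show ?thesis by simp
    qed
    then have "\<bar>S - (amp c)\<^sup>2 * P3\<bar> \<le> nrm (remainder c) * nrm ?g"
      using Cauchy_Schwarz_norm2[OF remainder_sqi[OF e(1) e1] sg] by simp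
    also have "\<dots> \<le> (K2 * ?e\<^sup>2) * (K4 * ?e)" using lb e by (intro mult_mono lb(6) ng) auto
    finally have Bd: "\<bar>S - (amp c)\<^sup>2 * P3\<bar> \<le> K2 * K4 * ?e ^ 3" by (simp add: power2_eq_square power3_eq_cube mult_ac)
    have "\<bar>?e * mean\<psi> c - (amp c)\<^sup>2 * P3 / 2\<bar> \<le> (D * ?e) ^ 3 / 2 * P1 + K2 * K4 * ?e ^ 3 / 2"
      using A Bd by linarith
    also have "\<dots> \<le> K * ?e ^ 3"
      using lb(4) e by (simp add: K_def power_mult_distrib algebra_simps)
    finally show ?thesis .
  qed
  have "nrm (remainder c) \<le> K * (excess c)\<^sup>2" if e: "0 < excess c" "excess c \<le> \<delta>" for c
  proof -
    have "K2 \<le> K" using D P K4 lb unfolding K_def by (simp add: add_nonneg_nonneg)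
    then have "K2 * (excess c)\<^sup>2 \<le> K * (excess c)\<^sup>2" by (intro mult_right_mono) auto
    with lb(6)[OF e] show ?thesis by linarith
  qed
  from that[OF lb(1,2) K main[unfolded P3_def] this] show ?thesis .
qed

text \<open>Write e for the excess, a for the amplitude and P1, P2, P3 for the integrals of the
  powers of \<psi>. As the mean is a P2, the scalar estimate reads a (e P2 - a P3 / 2) = O(e^3).
  Division by a \<ge> e / (2 B) gives a = 2 (P2 / P3) e + O(e^2), and the survival probability is a
  P1 up to the norm of the remainder.\<close>

theorem survival_expansion:
  obtains \<delta> K where "0 < \<delta>" "0 < K"
    "\<And>c. 0 < excess c \<Longrightarrow> excess c \<le> \<delta> \<Longrightarrow>
      \<bar>surv_prob c - 2 * ((\<integral>x. \<psi> x \<partial>\<mu>) * (\<integral>x. \<psi> x ^ 2 \<partial>\<mu>) / (\<integral>x. \<psi> x ^ 3 \<partial>\<mu>)) * excess c\<bar>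
        \<le> K * (excess c)\<^sup>2"
proof -
  obtain \<delta> K where a: "0 < \<delta>" "\<delta> \<le> 1" "0 < K"
    "\<And>c. 0 < excess c \<Longrightarrow> excess c \<le> \<delta> \<Longrightarrow>
      \<bar>excess c * mean\<psi> c - (amp c)\<^sup>2 * (\<integral>x. \<psi> x ^ 3 \<partial>\<mu>) / 2\<bar> \<le> K * (excess c) ^ 3"
    "\<And>c. 0 < excess c \<Longrightarrow> excess c \<le> \<delta> \<Longrightarrow> nrm (remainder c) \<le> K * (excess c)\<^sup>2"
    by (rule amp_asymptotics) blast
  define P1 P2 P3 where "P1 = (\<integral>x. \<psi> x \<partial>\<mu>)" and "P2 = (\<integral>x. \<psi> x ^ 2 \<partial>\<mu>)" and "P3 = (\<integral>x. \<psi> x ^ 3 \<partial>\<mu>)"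
  have P: "0 < P1" "0 < P2" "0 < P3"
    using int\<psi>_pos integral_\<psi>_power_pos[of 2] integral_\<psi>_power_pos[of 3] by (auto simp: P1_def P2_def P3_def)
  define K' where "K' = 4 * B * K / P3 * P1 + K"
  have K': "0 < K'" using P a(3) B_pos by (auto simp: K'_def intro!: add_nonneg_pos)
  have "\<bar>surv_prob c - 2 * (P1 * P2 / P3) * excess c\<bar> \<le> K' * (excess c)\<^sup>2"
    if e: "0 < excess c" "excess c \<le> \<delta>" for c
  proof -
    let ?e = "excess c" and ?a = "amp c"
    have e1: "?e \<le> 1" using e a by simp
    have cp: "0 < c" by (rule c_pos[OF e(1) e1])
    have alow: "?e / (2 * B) \<le> ?a" by (rule amp_lower[OF e(1) e1])
    then have apos: "0 < ?a" using e B_pos by (intro less_le_trans[OF _ alow] divide_pos_pos) auto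
    have "\<bar>?a * (?e * P2 - ?a * P3 / 2)\<bar> \<le> K * ?e ^ 3"
    proof -
      have "?a * (?e * P2 - ?a * P3 / 2) = ?e * (?a * P2) - ?a\<^sup>2 * P3 / 2"
        by (simp add: power2_eq_square algebra_simps)
      then show ?thesis
        using a(4)[OF e] unfolding P2_def P3_def by (simp only: amp_eq[OF e(1) e1])
    qed
    then have "?a * \<bar>?e * P2 - ?a * P3 / 2\<bar> \<le> K * ?e ^ 3" using apos by (simp add: abs_mult)
    moreover have "?e / (2 * B) * \<bar>?e * P2 - ?a * P3 / 2\<bar> \<le> ?a * \<bar>?e * P2 - ?a * P3 / 2\<bar>"
      by (intro mult_right_mono alow) simp
    ultimately have "?e / (2 * B) * \<bar>?e * P2 - ?a * P3 / 2\<bar> \<le> K * ?e ^ 3" by linarith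
    then have "?e * \<bar>?e * P2 - ?a * P3 / 2\<bar> \<le> ?e * (2 * B * K * ?e\<^sup>2)"
      using B_pos by (simp add: field_simps power2_eq_square power3_eq_cube)
    then have "\<bar>?e * P2 - ?a * P3 / 2\<bar> \<le> 2 * B * K * ?e\<^sup>2" using e by simp
    moreover have "?a - 2 * P2 / P3 * ?e = - (2 / P3) * (?e * P2 - ?a * P3 / 2)"
      using P by (simp add: field_simps)
    then have "\<bar>?a - 2 * P2 / P3 * ?e\<bar> = 2 / P3 * \<bar>?e * P2 - ?a * P3 / 2\<bar>"
      using P by (simp only: abs_mult) simp
    ultimately have "\<bar>?a - 2 * P2 / P3 * ?e\<bar> \<le> 2 / P3 * (2 * B * K * ?e\<^sup>2)"
      using P by (simp only:) (intro mult_left_mono, auto)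
    then have "P1 * \<bar>?a - 2 * P2 / P3 * ?e\<bar> \<le> P1 * (2 / P3 * (2 * B * K * ?e\<^sup>2))"
      using P by (intro mult_left_mono) auto
    then have 1: "\<bar>?a * P1 - 2 * (P1 * P2 / P3) * ?e\<bar> \<le> 4 * B * K / P3 * P1 * ?e\<^sup>2"
    proof -
      have "?a * P1 - 2 * (P1 * P2 / P3) * ?e = P1 * (?a - 2 * P2 / P3 * ?e)" by (simp add: algebra_simps)
      then have "\<bar>?a * P1 - 2 * (P1 * P2 / P3) * ?e\<bar> = P1 * \<bar>?a - 2 * P2 / P3 * ?e\<bar>"
        using P by (simp add: abs_mult)
      also have "\<dots> \<le> P1 * (2 / P3 * (2 * B * K * ?e\<^sup>2))" by fact
      finally show ?thesis by (simp add: mult_ac)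
    qed
    have i: "integrable \<mu> (R c)" "integrable \<mu> \<psi>"
      by (intro square_integrable_integrable R_sqi cp \<psi>_sqi)+
    have "surv_prob c - ?a * P1 = (\<integral>x. remainder c x * 1 \<partial>\<mu>)"
      unfolding survival_eq_R[OF cp] remainder_def P1_def using i by simp
    also have "\<bar>\<dots>\<bar> \<le> nrm (remainder c) * nrm (\<lambda>_. 1)"
      by (rule Cauchy_Schwarz_norm2[OF remainder_sqi[OF e(1) e1] square_integrable_const])
    also have "nrm (\<lambda>_. 1) = 1" by (simp add: nrm_const)
    finally have "\<bar>surv_prob c - ?a * P1\<bar> \<le> K * ?e\<^sup>2" using a(5)[OF e] by simp
    with 1 have "\<bar>surv_prob c - 2 * (P1 * P2 / P3) * ?e\<bar> \<le> 4 * B * K / P3 * P1 * ?e\<^sup>2 + K * ?e\<^sup>2"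
      by linarith
    then show ?thesis by (simp add: K'_def distrib_right)
  qed
  with a(1) K' show ?thesis unfolding P1_def P2_def P3_def by (rule that)
qed

end


section \<open>Uniqueness and contraction above the critical point\<close>

lemma norm_exp_minus_one_le:
  fixes w :: complex
  shows "norm (exp w - 1) \<le> norm w * exp (norm w)"
proof -
  have "norm (exp w - exp 0) \<le> exp (norm w) * norm (w - 0)"
  proof (rule field_differentiable_bound[OF convex_cball[of 0 "norm w"]])
    fix z :: complex assume z: "z \<in> cball 0 (norm w)"
    show "(exp has_field_derivative exp z) (at z within cball 0 (norm w))"
      by (intro DERIV_exp has_field_derivative_at_within)
    show "norm (exp z) \<le> exp (norm w)"
      using norm_exp[of z] z by (auto intro: order_trans)
  qed auto
  then show ?thesis by (simp add: mult.commute)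
qed

text \<open>Cauchy's inequality converts the bound g on the integrand into the bound g / e on its
  derivative. Difference quotients then have the integrable majorant g / e, and dominated
  convergence differentiates under the integral.\<close>

lemma holomorphic_on_integral:
  fixes f :: "complex \<Rightarrow> 'a \<Rightarrow> complex"
  assumes S: "open S"
    and hol: "\<And>y. y \<in> space M \<Longrightarrow> (\<lambda>z. f z y) holomorphic_on S"
    and meas: "\<And>z. z \<in> S \<Longrightarrow> f z \<in> borel_measurable M"
    and bd: "\<And>z y. z \<in> S \<Longrightarrow> y \<in> space M \<Longrightarrow> norm (f z y) \<le> g y"
    and g: "integrable M g"
  shows "(\<lambda>z. \<integral>y. f z y \<partial>M) holomorphic_on S"
  unfolding holomorphic_on_open[OF S]
proof
  fix z0 assume z0: "z0 \<in> S"
  then obtain e' where e': "0 < e'" "cball z0 e' \<subseteq> S" using S open_contains_cball by blast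
  \<comment> \<open>Half the radius, so that the closed disc of radius e about any point of
    \<open>ball z0 e\<close> still lies in \<open>S\<close>.\<close>
  define e where "e = e' / 2"
  have e: "0 < e" "cball z0 (2 * e) \<subseteq> S" using e' by (auto simp: e_def)
  have ball_S: "ball z0 e \<subseteq> S" using e by (force simp: subset_iff dist_norm)
  have int: "integrable M (f z)" if "z \<in> S" for z
    by (rule Bochner_Integration.integrable_bound[OF g meas[OF that]])
      (use bd[OF that] in \<open>auto intro!: AE_I2 order_trans[OF bd[OF that] abs_ge_self]\<close>)
  have der: "((\<lambda>z. f z y) has_field_derivative deriv (\<lambda>z. f z y) z) (at z)" if "y \<in> space M" "z \<in> S" for y z
    using hol[OF that(1)] S that(2) by (rule holomorphic_derivI)
  have dbd: "norm (deriv (\<lambda>z. f z y) z) \<le> g y / e" if y: "y \<in> space M" and z: "z \<in> ball z0 e" for y z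
  proof -
    have sub: "cball z e \<subseteq> S"
    proof
      fix w assume "w \<in> cball z e"
      then have "dist z0 w \<le> 2 * e" using z dist_triangle[of z0 w z] by (auto simp: dist_commute)
      then show "w \<in> S" using e(2) by auto
    qed
    have h: "(\<lambda>z. f z y) holomorphic_on cball z e" by (rule holomorphic_on_subset[OF hol[OF y] sub])
    have "norm ((deriv ^^ 1) (\<lambda>z. f z y) z) \<le> fact 1 * g y / e ^ 1"
    proof (rule Cauchy_inequality)
      show "(\<lambda>z. f z y) holomorphic_on ball z e" using h ball_subset_cball by (rule holomorphic_on_subset)
      show "continuous_on (cball z e) (\<lambda>z. f z y)" by (rule holomorphic_on_imp_continuous_on[OF h])
      fix x assume "norm (z - x) = e"
      then have "x \<in> S" using sub by (auto simp: dist_norm)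
      then show "norm (f x y) \<le> g y" using bd y by blast
    qed (use e in auto)
    then show ?thesis by simp
  qed
  have lip: "norm (f z y - f z0 y) \<le> g y / e * norm (z - z0)" if y: "y \<in> space M" and z: "z \<in> ball z0 e" for y z
    by (rule field_differentiable_bound[OF convex_ball[of z0 e], where f' = "\<lambda>z. deriv (\<lambda>z. f z y) z"])
      (use e z ball_S dbd[OF y] in \<open>auto intro!: has_field_derivative_at_within der[OF y]\<close>)
  define D where "D y = deriv (\<lambda>z. f z y) z0" for y
  have quot: "((\<lambda>z. (f z y - f z0 y) / (z - z0)) \<longlongrightarrow> D y) (at z0)" if "y \<in> space M" for y
    using der[OF that z0] unfolding has_field_derivative_iff D_def .
  \<comment> \<open>A concrete sequence tending to z0; along it the difference quotients exhibit the
    derivative as a measurable function of y.\<close>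
  define X where "X n = z0 + of_real (e / real (n + 2))" for n
  have X: "X n \<in> S" "X n \<noteq> z0" for n
  proof -
    have "e / real (n + 2) < e" using e(1) by (simp add: divide_less_eq)
    then have "X n \<in> ball z0 e"
      using e(1) by (simp add: X_def dist_norm del: of_real_divide of_nat_add)
    then show "X n \<in> S" using ball_S by blast
    show "X n \<noteq> z0" using e(1) by (simp add: X_def del: of_real_divide of_nat_add)
  qed
  have X_lim: "X \<longlonglongrightarrow> z0"
  proof -
    have "(\<lambda>n. e / real (n + 2)) \<longlonglongrightarrow> 0" by real_asymp
    then have "(\<lambda>n. complex_of_real (e / real (n + 2))) \<longlonglongrightarrow> of_real 0" by (rule tendsto_of_real)
    from tendsto_add[OF tendsto_const this, of z0] show ?thesis
      unfolding X_def[abs_def] by (simp del: of_real_divide of_nat_add)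
  qed
  have D_meas: "D \<in> borel_measurable M"
  proof (rule borel_measurable_LIMSEQ_metric)
    show "(\<lambda>y. (f (X n) y - f z0 y) / (X n - z0)) \<in> borel_measurable M" for n
      using meas[OF X(1)[of n]] meas[OF z0] by measurable
    fix y assume y: "y \<in> space M"
    from quot[OF y, unfolded tendsto_at_iff_sequentially, rule_format, of X, OF _ X_lim] X(2)
    show "(\<lambda>n. (f (X n) y - f z0 y) / (X n - z0)) \<longlonglongrightarrow> D y" by (simp add: o_def)
  qed
  have "((\<lambda>z. ((\<integral>y. f z y \<partial>M) - (\<integral>y. f z0 y \<partial>M)) / (z - z0)) \<longlongrightarrow> (\<integral>y. D y \<partial>M)) (at z0 within ball z0 e)"
    unfolding tendsto_at_iff_sequentially
  proof (intro allI impI)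
    fix X :: "nat \<Rightarrow> complex" assume X: "\<forall>i. X i \<in> ball z0 e - {z0}" "X \<longlonglongrightarrow> z0"
    then have XS: "X i \<in> S" "X i \<in> ball z0 e" "X i \<noteq> z0" for i using ball_S by auto
    have "(\<lambda>i. \<integral>y. (f (X i) y - f z0 y) / (X i - z0) \<partial>M) \<longlonglongrightarrow> (\<integral>y. D y \<partial>M)"
    proof (rule integral_dominated_convergence[where w="\<lambda>y. g y / e"])
      show "AE y in M. (\<lambda>i. (f (X i) y - f z0 y) / (X i - z0)) \<longlonglongrightarrow> D y"
      proof (rule AE_I2)
        fix y assume "y \<in> space M"
        from quot[OF this, unfolded tendsto_at_iff_sequentially, rule_format, of X, OF _ X(2)] XS(3)
        show "(\<lambda>i. (f (X i) y - f z0 y) / (X i - z0)) \<longlonglongrightarrow> D y" by (simp add: o_def)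
      qed
      fix i
      show "(\<lambda>y. (f (X i) y - f z0 y) / (X i - z0)) \<in> borel_measurable M"
        using meas[OF XS(1)[of i]] meas[OF z0] by measurable
      show "AE y in M. norm ((f (X i) y - f z0 y) / (X i - z0)) \<le> g y / e"
        using lip[OF _ XS(2)[of i]] XS(3)[of i] by (intro AE_I2) (auto simp: norm_divide divide_le_eq)
    qed (use g D_meas in auto)
    moreover have "(\<integral>y. (f (X i) y - f z0 y) / (X i - z0) \<partial>M) = ((\<integral>y. f (X i) y \<partial>M) - (\<integral>y. f z0 y \<partial>M)) / (X i - z0)" for i
      using int[OF XS(1)[of i]] int[OF z0] by simp
    ultimately show "((\<lambda>z. ((\<integral>y. f z y \<partial>M) - (\<integral>y. f z0 y \<partial>M)) / (z - z0)) \<circ> X) \<longlonglongrightarrow> (\<integral>y. D y \<partial>M)"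
      by (simp only: o_def)
  qed
  then have "((\<lambda>z. ((\<integral>y. f z y \<partial>M) - (\<integral>y. f z0 y \<partial>M)) / (z - z0)) \<longlongrightarrow> (\<integral>y. D y \<partial>M)) (at z0)"
    using e(1) by (subst (asm) at_within_open) auto
  then show "\<exists>f'. ((\<lambda>z. \<integral>y. f z y \<partial>M) has_field_derivative f') (at z0)"
    unfolding has_field_derivative_iff by blast
qed

text \<open>For r = 1 - exp (- u) this reads (1 - r) u \<le> r - r^2 / 2, so the linearisation at
  the survival probability gains the factor 1 - r / 2 when applied to r itself.\<close>

lemma exp_minus_times_le:
  fixes u :: real assumes "0 \<le> u"
  shows "exp (- u) * u \<le> (1 - exp (- u)) - (1 - exp (- u))\<^sup>2 / 2"
proof -
  let ?h = "\<lambda>u :: real. (1 - exp (- u)) - (1 - exp (- u))\<^sup>2 / 2 - exp (- u) * u"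
  have "?h 0 \<le> ?h u"
  proof (rule DERIV_nonneg_imp_nondecreasing[OF assms])
    fix x :: real
    have "(?h has_real_derivative exp (- x) * (exp (- x) - 1 + x)) (at x)"
      by (auto intro!: derivative_eq_intros simp: power2_eq_square field_simps)
    moreover have "0 \<le> exp (- x) * (exp (- x) - 1 + x)"
      using exp_ge_add_one_self[of "- x"] by (intro mult_nonneg_nonneg) auto
    ultimately show "\<exists>y. (?h has_real_derivative y) (at x) \<and> 0 \<le> y" by blast
  qed
  then show ?thesis by simp
qed

text \<open>Strict concavity of a -> 1 - exp (- a), with the quotients by a and b cross-multiplied.
  This sublinearity makes the positive fixed point unique.\<close>

lemma one_minus_exp_ratio_strict_decreasing:
  fixes a b :: real assumes "0 < b" "b < a"
  shows "(1 - exp (- a)) * b < (1 - exp (- b)) * a"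
proof -
  let ?g = "\<lambda>a. (1 - exp (- b)) * a - (1 - exp (- a)) * b"
  have "?g b < ?g a"
  proof (rule DERIV_pos_imp_increasing[OF assms(2)])
    fix x assume "b \<le> x"
    have "(?g has_real_derivative (1 - exp (- b) - exp (- x) * b)) (at x)"
      by (auto intro!: derivative_eq_intros)
    moreover have "exp (- x) * b \<le> exp (- b) * b" using \<open>b \<le> x\<close> assms by (intro mult_right_mono) auto
    moreover have "1 + b < exp b"
    proof -
      have "0 < b\<^sup>2 / 2" using assms(1) by simp
      with exp_lower_Taylor_quadratic[of b] assms(1) show ?thesis by linarith
    qed
    then have "exp (- b) * (1 + b) < exp (- b) * exp b" by (intro mult_strict_left_mono) auto
    then have "exp (- b) * b < 1 - exp (- b)" by (simp add: exp_minus field_simps)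
    ultimately show "\<exists>y. (?g has_real_derivative y) (at x) \<and> 0 < y"
      by (intro exI[of _ "1 - exp (- b) - exp (- x) * b"]) linarith
  qed
  then show ?thesis by simp
qed

context kernel_with_eigenfunction
begin

text \<open>The right-hand side of the fixed point equation is contracting at \<open>R c\<close> in a weighted supremum
  norm. The weight \<open>R c\<close> alone gives the factor \<open>1 - R c/2\<close>, which is not bounded away from 1 where
  \<open>R c\<close> is small; adding a small constant repairs this, because \<open>c T 1\<^sub>A\<close> is uniformly small
  for sets \<open>A\<close> of small measure.\<close>

lemma contraction_weight:
  assumes c: "0 < c" and super: "1 < c * lam"
  obtains w \<theta> W where "w \<in> borel_measurable borel" "\<And>x. 1 \<le> w x" "\<And>x. w x \<le> W" "0 \<le> \<theta>" "\<theta> < 1"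
    "\<And>x. c * (1 - R c x) * T w x \<le> \<theta> * w x"
proof -
  note [measurable] = R_measurable[OF c]
  define A where "A n = {x. R c x < 1 / Suc n}" for n
  have [measurable]: "A n \<in> sets borel" for n unfolding A_def by measurable
  have "(\<lambda>n. measure \<mu> (A n)) \<longlonglongrightarrow> 0"
    unfolding A_def by (rule measure_small_levels_tendsto[OF R_measurable[OF c] R_pos[OF c super]])
  from tendsto_mult_right_zero[OF tendsto_real_sqrt[OF this, simplified], of "c * C"]
  have "eventually (\<lambda>n. c * C * sqrt (measure \<mu> (A n)) < 1 / 4) sequentially"
    by (rule order_tendstoD(2)) simp
  then obtain n where n: "c * C * sqrt (measure \<mu> (A n)) < 1 / 4" by (auto simp: eventually_sequentially)
  define \<delta> :: real where "\<delta> = 1 / Suc n"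
  have \<delta>: "0 < \<delta>" "\<delta> \<le> 1" by (auto simp: \<delta>_def)
  have A_eq: "A n = {x. R c x < \<delta>}" by (simp add: A_def \<delta>_def)
  \<comment> \<open>Chosen so that \<eta> / \<delta> = \<delta>^2 / 32. Where R > \<delta> / 4, the
    gain R^2 / 2 is at least this and pays for the added constant; where R \<le> \<delta> / 4, the
    image of that constant is at most \<eta> / 2.\<close>
  define \<eta> where "\<eta> = \<delta> ^ 3 / 32"
  have \<eta>: "0 < \<eta>" "\<eta> \<le> 1" using \<delta> power_le_one[of \<delta> 3] by (auto simp: \<eta>_def)
  have sR: "sqi (R c)" by (rule R_sqi[OF c])
  have sA: "sqi (indicator (A n))" by (rule square_integrable_bounded[where B=1]) auto
  have nA: "nrm (indicator (A n)) = sqrt (measure \<mu> (A n))"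
  proof -
    have "(\<integral>x. (indicat_real (A n) x)\<^sup>2 \<partial>\<mu>) = (\<integral>x. indicat_real (A n) x \<partial>\<mu>)"
      by (intro Bochner_Integration.integral_cong) (auto simp: indicator_def power2_eq_square)
    then show ?thesis by (simp add: norm2_def)
  qed
  define v where "v = (\<lambda>x. R c x + \<eta> * 1)"
  have Kv: "c * (1 - R c x) * T v x \<le> v x - \<eta> / 2" for x
  proof -
    let ?r = "R c x" and ?u = "c * T (R c) x"
    have r: "0 \<le> ?r" "?r \<le> 1" by (rule R_nonneg[OF c], rule R_le_1[OF c])
    have u0: "0 \<le> ?u" using c TR_nonneg[OF c, of x] by simp
    have one_r: "1 - ?r = exp (- ?u)" using R_fixed[OF c, of x] by linarith
    have KR: "(1 - ?r) * ?u \<le> ?r - ?r\<^sup>2 / 2"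
      using exp_minus_times_le[OF u0] unfolding one_r[symmetric] by simp
    \<comment> \<open>The constant 1 is dominated by the indicator of the set where R < \<delta>
      plus R / \<delta>; the first part contributes at most 1 / 4 by the choice of n.\<close>
    have T1: "c * T (\<lambda>_. 1) x \<le> 1 / 4 + ?u / \<delta>"
    proof -
      have "T (\<lambda>_. 1) x \<le> T (\<lambda>y. indicator (A n) y + (1 / \<delta>) * R c y) x"
      proof (rule T_mono)
        fix y
        show "1 \<le> indicator (A n) y + (1 / \<delta>) * R c y"
          using R_nonneg[OF c, of y] \<delta> by (auto simp: A_eq indicator_def field_simps)
      qed (intro square_integrable_const square_integrable_add square_integrable_cmult sA sR)+
      also have "\<dots> = T (indicator (A n)) x + (1 / \<delta>) * T (R c) x"
        by (subst T_add[OF sA square_integrable_cmult[OF sR]]) (simp only: T_cmult)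
      finally have "c * T (\<lambda>_. 1) x \<le> c * (T (indicator (A n)) x + (1 / \<delta>) * T (R c) x)"
        using c by (intro mult_left_mono) auto
      moreover have "c * T (indicator (A n)) x \<le> c * (C * nrm (indicator (A n)))"
        using T_bound[OF sA, of x] c by (intro mult_left_mono) auto
      ultimately show ?thesis using n by (simp add: nA distrib_left mult.assoc)
    qed
    have "T v x = T (R c) x + \<eta> * T (\<lambda>_. 1) x"
      unfolding v_def by (subst T_add[OF sR square_integrable_cmult[OF square_integrable_const]]) (simp only: T_cmult)
    then have "c * (1 - ?r) * T v x = (1 - ?r) * ?u + \<eta> * ((1 - ?r) * (c * T (\<lambda>_. 1) x))"
      by (simp add: algebra_simps)
    also have "(1 - ?r) * (c * T (\<lambda>_. 1) x) \<le> (1 - ?r) * (1 / 4 + ?u / \<delta>)"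
      using r by (intro mult_left_mono T1) auto
    also have "\<dots> = (1 - ?r) * (1 / 4) + ((1 - ?r) * ?u) / \<delta>" by (simp add: distrib_left)
    also have "(1 - ?r) * (1 / 4) \<le> 1 / 4" using r by simp
    also have "((1 - ?r) * ?u) / \<delta> \<le> ?r / \<delta>"
      using KR zero_le_power2[of ?r] \<delta> by (intro divide_right_mono) linarith+
    finally have "c * (1 - ?r) * T v x \<le> (1 - ?r) * ?u + \<eta> * (1 / 4 + ?r / \<delta>)"
      using \<eta> by simp
    then have le: "c * (1 - ?r) * T v x \<le> ?r - ?r\<^sup>2 / 2 + \<eta> * (1 / 4 + ?r / \<delta>)" using KR by linarith
    have vx: "v x = ?r + \<eta>" by (simp add: v_def)
    show ?thesis
    proof (cases "?r \<le> \<delta> / 4")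
      case True
      then have "?r / \<delta> \<le> 1 / 4" using \<delta> by (simp add: field_simps)
      then have "1 / 4 + ?r / \<delta> \<le> 1 / 2" by linarith
      then have "\<eta> * (1 / 4 + ?r / \<delta>) \<le> \<eta> * (1 / 2)" using \<eta> by (intro mult_left_mono) auto
      then show ?thesis using le zero_le_power2[of ?r] vx by linarith
    next
      case False
      then have "(\<delta> / 4)\<^sup>2 \<le> ?r\<^sup>2" using \<delta> by (intro power_mono) auto
      then have 1: "\<delta>\<^sup>2 / 32 \<le> ?r\<^sup>2 / 2" by (simp add: power_divide)
      have "?r / \<delta> \<le> 1 / \<delta>" using r \<delta> by (intro divide_right_mono) auto
      then have "\<eta> * (1 / 4 + ?r / \<delta>) \<le> \<eta> * (1 / 4 + 1 / \<delta>)" using \<eta> by (intro mult_left_mono) auto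
      also have "\<dots> = \<eta> / 4 + \<delta>\<^sup>2 / 32" using \<delta> by (simp add: \<eta>_def field_simps power2_eq_square power3_eq_cube)
      finally show ?thesis using le 1 \<eta> vx by linarith
    qed
  qed
  have v: "\<eta> \<le> v x" "v x \<le> 2" for x
    using R_nonneg[OF c, of x] R_le_1[OF c, of x] \<eta> by (auto simp: v_def)
  \<comment> \<open>Rescaling makes the weight at least 1. Since v \<le> 2, the additive gain \<eta>
    / 2 becomes the multiplicative factor 1 - \<eta> / 4.\<close>
  define w where "w = (\<lambda>x. (1 / \<eta>) * v x)"
  show ?thesis
  proof (rule that[of w "2 / \<eta>" "1 - \<eta> / 4"])
    show "w \<in> borel_measurable borel" unfolding w_def v_def by measurable
    show "1 \<le> w x" "w x \<le> 2 / \<eta>" for x using v[of x] \<eta> by (auto simp: w_def field_simps)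
    show "0 \<le> 1 - \<eta> / 4" "1 - \<eta> / 4 < 1" using \<eta> by auto
    fix x
    have "c * (1 - R c x) * T v x \<le> v x - \<eta> / 2" by (rule Kv)
    also have "\<dots> \<le> (1 - \<eta> / 4) * v x"
      using mult_left_mono[OF v(2)[of x], of "\<eta> / 4"] \<eta> by (simp add: algebra_simps)
    finally have "(1 / \<eta>) * (c * (1 - R c x) * T v x) \<le> (1 / \<eta>) * ((1 - \<eta> / 4) * v x)"
      using \<eta> by (intro mult_left_mono) auto
    then show "c * (1 - R c x) * T w x \<le> (1 - \<eta> / 4) * w x"
      unfolding w_def T_cmult by (simp only: mult.left_commute mult.assoc)
  qed
qed

text \<open>Each equation is tested against the other solution: by symmetry the integral of p (c T
  R) - R (c T p) is 0. Sublinearity of 1 - exp (- u) gives the integrand one sign, strict where 0 <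
  T p < T R, so the exponents, and with them p and R, agree almost everywhere.\<close>

lemma fixed_point_unique:
  fixes p :: "'a \<Rightarrow> real"
  assumes c: "0 < c" and p[measurable]: "p \<in> borel_measurable borel"
    and fixp: "\<And>x. p x = 1 - exp (- (c * T p x))"
    and pos: "AE x in \<mu>. 0 < p x" and nn: "\<And>x. 0 \<le> p x" and le: "\<And>x. p x \<le> R c x"
  shows "AE x in \<mu>. p x = R c x"
proof -
  have sp: "sqi p" using nn le R_le_1[OF c] by (intro square_integrable_bounded[where B=1]) (auto intro: order_trans)
  have sR: "sqi (R c)" by (rule R_sqi[OF c])
  let ?b = "\<lambda>x. c * T p x" and ?a = "\<lambda>x. c * T (R c) x"
  have ba: "?b x \<le> ?a x" for x using c by (intro mult_left_mono T_mono sp sR le) auto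
  have b0: "0 \<le> ?b x" for x using c T_nonneg[of p x, OF nn] by simp
  have key: "R c x * ?b x \<le> p x * ?a x" for x
  proof (cases "?b x = 0 \<or> ?b x = ?a x")
    case True
    then show ?thesis
    proof
      assume "?b x = 0"
      then show ?thesis
        by (simp only: mult_zero_right) (intro mult_nonneg_nonneg nn order_trans[OF b0 ba])
    next
      assume *: "?b x = ?a x"
      then have "p x = R c x" using fixp[of x] R_fixed[OF c, of x] by simp
      then show ?thesis by (simp only: * order_refl)
    qed
  next
    case False
    then have "0 < ?b x" "?b x < ?a x" using b0[of x] ba[of x] by (metis order_le_less)+
    from one_minus_exp_ratio_strict_decreasing[OF this] show ?thesis
      unfolding fixp[of x, symmetric] R_fixed[OF c, of x, symmetric] by simp
  qed
  have i1: "integrable \<mu> (\<lambda>x. p x * ?a x)" and i2: "integrable \<mu> (\<lambda>x. R c x * ?b x)"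
    by (intro square_integrable_mult square_integrable_cmult T_sqi sp sR)+
  have int: "integrable \<mu> (\<lambda>x. p x * ?a x - R c x * ?b x)" using i1 i2 by simp
  have "(\<integral>x. p x * ?a x \<partial>\<mu>) = c * (\<integral>x. p x * T (R c) x \<partial>\<mu>)"
    by (simp add: mult.left_commute)
  also have "\<dots> = c * (\<integral>x. T p x * R c x \<partial>\<mu>)" by (simp only: T_sym[OF sp sR])
  also have "\<dots> = (\<integral>x. R c x * ?b x \<partial>\<mu>)" by (simp add: mult_ac)
  finally have "(\<integral>x. p x * ?a x - R c x * ?b x \<partial>\<mu>) = 0" using i1 i2 by simp
  then have "AE x in \<mu>. p x * ?a x - R c x * ?b x = 0"
    using integral_nonneg_eq_0_iff_AE[OF int] key by simp
  then show ?thesis using pos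
  proof eventually_elim
    case (elim x)
    have "?b x \<noteq> 0" using elim(2) fixp[of x] by auto
    then have "0 < ?b x" using b0[of x] by (metis order_le_less)
    moreover have "\<not> ?b x < ?a x"
    proof
      assume "?b x < ?a x"
      from one_minus_exp_ratio_strict_decreasing[OF \<open>0 < ?b x\<close> this] elim(1)
      show False unfolding fixp[of x, symmetric] R_fixed[OF c, of x, symmetric] by simp
    qed
    ultimately have "?b x = ?a x" using ba[of x] by simp
    then show ?case using fixp[of x] R_fixed[OF c, of x] by simp
  qed
qed

end


section \<open>Analyticity above the critical point\<close>

context kernel_with_eigenfunction
begin

section \<open>The operator on complex-valued functions\<close>

definition cT :: "('a \<Rightarrow> complex) \<Rightarrow> 'a \<Rightarrow> complex" where
  "cT f x = (\<integral>y. complex_of_real (\<kappa> x y) * f y \<partial>\<mu>)"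

lemma cT_measurable [measurable]:
  assumes [measurable]: "f \<in> borel_measurable borel"
  shows "cT f \<in> borel_measurable borel"
  unfolding cT_def[abs_def] by measurable

lemma cT_of_real: "cT (\<lambda>y. complex_of_real (f y)) x = complex_of_real (T f x)"
  unfolding cT_def kernel_op_def of_real_mult[symmetric] by (rule integral_complex_of_real)

lemma cT_integrable:
  assumes [measurable]: "f \<in> borel_measurable borel" and "sqi g" "\<And>y. norm (f y) \<le> g y"
  shows "integrable \<mu> (\<lambda>y. complex_of_real (\<kappa> x y) * f y)"
proof (rule Bochner_Integration.integrable_bound[OF kernel_times_integrable[OF assms(2), of x]])
  show "AE y in \<mu>. norm (complex_of_real (\<kappa> x y) * f y) \<le> norm (\<kappa> x y * g y)"
  proof (rule AE_I2)
    fix y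
    have "\<kappa> x y * norm (f y) \<le> \<kappa> x y * g y" by (intro mult_left_mono assms(3)) simp
    then show "norm (complex_of_real (\<kappa> x y) * f y) \<le> norm (\<kappa> x y * g y)"
      by (simp add: norm_mult)
  qed
qed measurable

lemma norm_cT_le:
  assumes [measurable]: "f \<in> borel_measurable borel" and g: "sqi g" and le: "\<And>y. norm (f y) \<le> g y"
  shows "norm (cT f x) \<le> T g x"
proof -
  have "norm (cT f x) \<le> (\<integral>y. norm (complex_of_real (\<kappa> x y) * f y) \<partial>\<mu>)"
    unfolding cT_def by (rule integral_norm_bound)
  also have "\<dots> \<le> (\<integral>y. \<kappa> x y * g y \<partial>\<mu>)"
    using cT_integrable[OF assms(1) g le, of x] kernel_times_integrable[OF g, of x] le
    by (intro integral_mono integrable_norm) (auto simp: norm_mult intro!: mult_left_mono)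
  finally show ?thesis by (simp add: kernel_op_def)
qed

context
  fixes c :: real and w :: "'a \<Rightarrow> real" and W \<theta> :: real
  assumes c: "0 < c" and w_meas [measurable]: "w \<in> borel_measurable borel"
    and w_ge: "\<And>x. 1 \<le> w x" and w_le: "\<And>x. w x \<le> W" and \<theta>: "0 \<le> \<theta>"
    and contr: "\<And>x. c * (1 - R c x) * T w x \<le> \<theta> * w x"
begin

lemma abs_w_le: "\<bar>w x\<bar> \<le> W"
  using w_ge[of x] w_le[of x] by linarith

lemma w_sqi: "sqi w"
  by (rule square_integrable_bounded[OF _ abs_w_le]) measurable

lemma Tw_bound: "0 \<le> T w x" "T w x \<le> C * W"
proof -
  show "0 \<le> T w x" using w_ge by (intro T_nonneg) (auto intro: order_trans[OF zero_le_one])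
  have "nrm w \<le> W"
    by (rule norm2_bounded[OF _ abs_w_le]) measurable
  then have "C * nrm w \<le> C * W" using C_pos by (intro mult_left_mono) auto
  then show "T w x \<le> C * W" using T_bound[OF w_sqi, of x] by linarith
qed

lemma TR_le_C: "T (R c) x \<le> C"
proof -
  have "nrm (R c) \<le> 1" using R_nonneg[OF c] R_le_1[OF c] R_measurable[OF c] by (intro norm2_bounded) auto
  then have "C * nrm (R c) \<le> C" using C_pos by simp
  then show ?thesis using T_bound[OF R_sqi[OF c], of x] by linarith
qed

text \<open>The ball of radius d about \<open>R c\<close> in the weighted supremum norm is mapped
  into itself for every z within \<eta> of c. The error of the image is (1 - R) (1 - exp (- u)),
  where u is the deviation of the exponent. Its linear part contracts by \<theta>; moving the
  parameter adds the terms with \<eta>, absorbed using w \<ge> 1, and the nonlinearity adds the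
  exponential factor.\<close>

lemma complex_step_invariant:
  fixes z :: complex and f :: "'a \<Rightarrow> complex"
  assumes f[measurable]: "f \<in> borel_measurable borel"
    and fd: "\<And>x. norm (f x - of_real (R c x)) \<le> d * w x"
    and z: "norm (z - of_real c) \<le> \<eta>" and d: "0 \<le> d"
    and small: "exp ((c + \<eta>) * d * (C * W) + \<eta> * C) * ((1 + \<eta> / c) * \<theta> * d + \<eta> * C) \<le> d"
  shows "norm ((1 - exp (- (z * cT f x))) - of_real (R c x)) \<le> d * w x"
proof -
  note [measurable] = R_measurable[OF c]
  have \<eta>: "0 \<le> \<eta>" using z norm_ge_zero order_trans by blast
  let ?r = "\<lambda>x. complex_of_real (R c x)"
  have dw: "sqi (\<lambda>x. d * w x)" by (intro square_integrable_cmult w_sqi)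
  have i1: "integrable \<mu> (\<lambda>y. complex_of_real (\<kappa> x y) * (f y - ?r y))"
    by (rule cT_integrable[OF _ dw]) (use fd in measurable)
  have i2: "integrable \<mu> (\<lambda>y. complex_of_real (\<kappa> x y) * ?r y)"
    by (rule cT_integrable[OF _ R_sqi[OF c]]) (use R_nonneg[OF c] in auto)
  have split: "cT f x = cT (\<lambda>y. f y - ?r y) x + of_real (T (R c) x)"
    unfolding cT_of_real[symmetric] unfolding cT_def
    by (subst Bochner_Integration.integral_add[symmetric, OF i1 i2]) (simp add: distrib_left[symmetric])
  have n1: "norm (cT (\<lambda>y. f y - ?r y) x) \<le> d * T w x"
    using norm_cT_le[OF _ dw fd, of x] by (simp add: T_cmult)
  define u where "u = z * cT f x - of_real (c * T (R c) x)"
  have u_eq: "u = z * cT (\<lambda>y. f y - ?r y) x + (z - of_real c) * of_real (T (R c) x)"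
    unfolding u_def split by (simp add: algebra_simps)
  have nz: "norm z \<le> c + \<eta>"
    using norm_triangle_ineq[of "z - of_real c" "of_real c"] z c by simp
  have TR: "0 \<le> T (R c) x" "T (R c) x \<le> C" by (rule TR_nonneg[OF c], rule TR_le_C)
  have nu: "norm u \<le> (c + \<eta>) * (d * T w x) + \<eta> * C"
  proof -
    have "norm u \<le> norm z * norm (cT (\<lambda>y. f y - ?r y) x) + norm (z - of_real c) * T (R c) x"
      unfolding u_eq using TR norm_triangle_ineq[of "z * cT (\<lambda>y. f y - ?r y) x" "(z - of_real c) * of_real (T (R c) x)"]
      by (simp add: norm_mult)
    also have "\<dots> \<le> (c + \<eta>) * (d * T w x) + \<eta> * C"
      using c \<eta> TR z C_pos by (intro add_mono mult_mono nz n1) auto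
    finally show ?thesis .
  qed
  have nu': "norm u \<le> (c + \<eta>) * d * (C * W) + \<eta> * C"
  proof -
    have "(c + \<eta>) * (d * T w x) \<le> (c + \<eta>) * (d * (C * W))"
      using c \<eta> d by (intro mult_left_mono Tw_bound) auto
    with nu show ?thesis by (simp add: mult.assoc)
  qed
  have r1: "complex_of_real (1 - R c x) = exp (- of_real (c * T (R c) x))"
  proof -
    have "1 - R c x = exp (- (c * T (R c) x))" using R_fixed[OF c, of x] by linarith
    then show ?thesis by (simp only: exp_of_real[symmetric] of_real_minus[symmetric])
  qed
  have r01: "0 \<le> 1 - R c x" "1 - R c x \<le> 1" using R_nonneg[OF c, of x] R_le_1[OF c, of x] by auto
  have "exp (- (z * cT f x)) = exp (- of_real (c * T (R c) x)) * exp (- u)"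
    by (simp add: u_def exp_add[symmetric])
  then have "(1 - exp (- (z * cT f x))) - ?r x = of_real (1 - R c x) * (1 - exp (- u))"
    unfolding r1[symmetric] by (simp add: algebra_simps)
  then have "norm ((1 - exp (- (z * cT f x))) - ?r x) = (1 - R c x) * norm (exp (- u) - 1)"
    using r01 by (simp only: norm_mult norm_of_real norm_minus_commute abs_of_nonneg)
  also have "\<dots> \<le> (1 - R c x) * (norm u * exp (norm u))"
    using norm_exp_minus_one_le[of "- u"] r01 by (intro mult_left_mono) auto
  also have "\<dots> = ((1 - R c x) * norm u) * exp (norm u)" by simp
  also have "\<dots> \<le> (((1 + \<eta> / c) * \<theta> * d + \<eta> * C) * w x) * exp ((c + \<eta>) * d * (C * W) + \<eta> * C)"
  proof (rule mult_mono)
    have "(1 - R c x) * norm u \<le> (1 - R c x) * ((c + \<eta>) * (d * T w x) + \<eta> * C)"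
      using r01 by (intro mult_left_mono nu) auto
    also have "\<dots> = (1 + \<eta> / c) * d * (c * (1 - R c x) * T w x) + (1 - R c x) * (\<eta> * C)"
      using c by (simp add: field_simps)
    also have "\<dots> \<le> (1 + \<eta> / c) * d * (\<theta> * w x) + (\<eta> * C) * w x"
    proof (rule add_mono)
      show "(1 + \<eta> / c) * d * (c * (1 - R c x) * T w x) \<le> (1 + \<eta> / c) * d * (\<theta> * w x)"
        using c \<eta> d by (intro mult_left_mono contr) auto
      have "(1 - R c x) * (\<eta> * C) \<le> 1 * (\<eta> * C)" using r01 \<eta> C_pos by (intro mult_right_mono) auto
      also have "\<dots> \<le> w x * (\<eta> * C)" using w_ge \<eta> C_pos by (intro mult_right_mono) auto
      finally show "(1 - R c x) * (\<eta> * C) \<le> (\<eta> * C) * w x" by (simp add: mult.commute)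
    qed
    also have "\<dots> = ((1 + \<eta> / c) * \<theta> * d + \<eta> * C) * w x" by (simp add: algebra_simps)
    finally show "(1 - R c x) * norm u \<le> ((1 + \<eta> / c) * \<theta> * d + \<eta> * C) * w x" .
    show "exp (norm u) \<le> exp ((c + \<eta>) * d * (C * W) + \<eta> * C)" using nu' by simp
    show "0 \<le> ((1 + \<eta> / c) * \<theta> * d + \<eta> * C) * w x"
      using c \<eta> d \<theta> C_pos w_ge[of x] by (intro mult_nonneg_nonneg add_nonneg_nonneg) auto
  qed simp
  also have "\<dots> = (exp ((c + \<eta>) * d * (C * W) + \<eta> * C) * ((1 + \<eta> / c) * \<theta> * d + \<eta> * C)) * w x"
    by (simp add: mult_ac)
  also have "\<dots> \<le> d * w x" using small w_ge[of x] by (intro mult_right_mono) auto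
  finally show ?thesis .
qed

end

text \<open>The parameter radius is tied to the ball by \<eta> = k d. After division by d the left
  side tends to \<theta> + k C as d -> 0, and k C = (1 - \<theta>) / 2 puts this limit halfway
  between \<theta> and 1. The extra bound d < c / k keeps the real parameters positive.\<close>

lemma small_parameters:
  fixes c \<theta> W :: real
  assumes "0 < c" "\<theta> < 1"
  obtains d \<eta> where "0 < d" "0 < \<eta>" "\<eta> < c"
    "exp ((c + \<eta>) * d * (C * W) + \<eta> * C) * ((1 + \<eta> / c) * \<theta> * d + \<eta> * C) \<le> d"
proof -
  define k where "k = (1 - \<theta>) / (2 * C)"
  have k: "0 < k" "k * C = (1 - \<theta>) / 2" using assms C_pos by (auto simp: k_def)
  let ?g = "\<lambda>d. exp ((c + k * d) * d * (C * W) + k * d * C) * ((1 + k * d / c) * \<theta> + k * C)"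
  have "(?g \<longlongrightarrow> exp ((c + k * 0) * 0 * (C * W) + k * 0 * C) * ((1 + k * 0 / c) * \<theta> + k * C)) (at_right 0)"
    by (intro tendsto_intros) (use assms in auto)
  moreover have "exp ((c + k * 0) * 0 * (C * W) + k * 0 * C) * ((1 + k * 0 / c) * \<theta> + k * C) < 1"
    using assms k by (simp add: field_simps)
  ultimately have "eventually (\<lambda>d. ?g d < 1) (at_right 0)" by (rule order_tendstoD(2))
  moreover have "eventually (\<lambda>d. d \<in> {0<..<c / k}) (at_right (0::real))"
    using assms k by (intro eventually_at_right_real) simp
  ultimately have "eventually (\<lambda>d. ?g d < 1 \<and> d \<in> {0<..<c / k}) (at_right 0)"
    by (rule eventually_conj)
  then obtain d where d: "?g d < 1" "0 < d" "d < c / k"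
    using eventually_happens[of _ "at_right (0::real)"] trivial_limit_at_right_real by (metis (no_types, lifting) greaterThanLessThan_iff)
  show ?thesis
  proof (rule that[of d "k * d"])
    show "k * d < c" using d k by (simp add: field_simps)
    have "exp ((c + k * d) * d * (C * W) + k * d * C) * ((1 + k * d / c) * \<theta> * d + k * d * C) = ?g d * d"
      by (simp add: algebra_simps)
    also have "\<dots> \<le> 1 * d" using d by (intro mult_right_mono) auto
    finally show "exp ((c + k * d) * d * (C * W) + k * d * C) * ((1 + k * d / c) * \<theta> * d + k * d * C) \<le> d" by simp
  qed (use d k in auto)
qed

section \<open>Real and complex iterates\<close>

primrec real_iter :: "('a \<Rightarrow> real) \<Rightarrow> real \<Rightarrow> nat \<Rightarrow> 'a \<Rightarrow> real" where
  "real_iter f c 0 x = f x"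
| "real_iter f c (Suc n) x = 1 - exp (- (c * T (real_iter f c n) x))"

text \<open>The start is a separate argument, to be frozen at one reference parameter while z
  varies; starting from a function constant in z makes every iterate holomorphic in z.\<close>

primrec complex_iter :: "('a \<Rightarrow> real) \<Rightarrow> complex \<Rightarrow> nat \<Rightarrow> 'a \<Rightarrow> complex" where
  "complex_iter f z 0 x = of_real (f x)"
| "complex_iter f z (Suc n) x = 1 - exp (- (z * cT (complex_iter f z n) x))"

lemma real_iter_0: "real_iter f c 0 = f"
  by (rule ext) simp

lemma complex_iter_of_real: "complex_iter f (of_real c) n x = of_real (real_iter f c n x)"
proof (induction n arbitrary: x)
  case (Suc n)
  then have "complex_iter f (of_real c) n = (\<lambda>y. of_real (real_iter f c n y))" by auto
  then show ?case by (simp add: cT_of_real exp_of_real[symmetric])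
qed simp

lemma real_iter_measurable:
  assumes [measurable]: "f \<in> borel_measurable borel"
  shows "real_iter f c n \<in> borel_measurable borel"
  by (induction n) auto

lemma complex_iter_measurable:
  assumes [measurable]: "f \<in> borel_measurable borel"
  shows "complex_iter f z n \<in> borel_measurable borel"
  by (induction n) auto

lemma real_iter_mono:
  assumes c: "0 < c" and f: "\<And>x. 0 \<le> f x" "f \<in> borel_measurable borel"
    and g: "\<And>x. f x \<le> g x" "\<And>x. g x \<le> 1" "g \<in> borel_measurable borel"
  shows "0 \<le> real_iter f c n x \<and> real_iter f c n x \<le> real_iter g c n x \<and> real_iter g c n x \<le> 1"
proof (induction n arbitrary: x)
  case (Suc n)
  note [measurable] = real_iter_measurable[OF f(2)] real_iter_measurable[OF g(3)]
  have "\<bar>real_iter f c n x\<bar> \<le> 1" "\<bar>real_iter g c n x\<bar> \<le> 1" for x using Suc[of x] by linarith+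
  then have sf: "sqi (real_iter f c n)" and sg: "sqi (real_iter g c n)"
    by (auto intro!: square_integrable_bounded[where B=1])
  have "0 \<le> T (real_iter f c n) x" using Suc by (intro T_nonneg) auto
  moreover have "T (real_iter f c n) x \<le> T (real_iter g c n) x" using Suc by (intro T_mono sf sg) auto
  ultimately show ?case using c by (simp add: mult_left_mono)
qed (use f g in auto)

lemma real_iter_fixed: "(\<And>x. f x = 1 - exp (- (c * T f x))) \<Longrightarrow> real_iter f c n x = f x"
proof (induction n arbitrary: x)
  case (Suc n)
  have "real_iter f c n = f" by (rule ext) (rule Suc.IH[OF Suc.prems])
  then show ?case by (simp only: real_iter.simps Suc.prems[of x, symmetric])
qed simp

lemma real_iter_one: "real_iter (\<lambda>_. 1) c n x = surv \<mu> (scaled c) n x"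
proof (induction n arbitrary: x)
  case (Suc n)
  then have "real_iter (\<lambda>_. 1) c n = surv \<mu> (scaled c) n" by auto
  then show ?case by (simp only: surv_step real_iter.simps)
qed simp

text \<open>Identifies the limit at real parameters. For c \<le> c1 the iterates are squeezed
  between \<open>R c\<close> and the iterates started at 1. For c > c1 they increase to a fixed
  point above \<open>R c1\<close>, which is positive almost everywhere, so uniqueness
  applies.\<close>

lemma integral_real_iter_tendsto:
  assumes c1: "0 < c1" "1 < c1 * lam" and c: "0 < c"
  shows "(\<lambda>n. \<integral>x. real_iter (R c1) c n x \<partial>\<mu>) \<longlonglongrightarrow> surv_prob c"
proof -
  note [measurable] = R_measurable[OF c1(1)] R_measurable[OF c] real_iter_measurable
  let ?g = "real_iter (R c1) c"
  have one: "0 \<le> ?g n x \<and> ?g n x \<le> surv \<mu> (scaled c) n x \<and> surv \<mu> (scaled c) n x \<le> 1" for n x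
    using real_iter_mono[OF c, of "R c1" "\<lambda>_. 1" n x] R_nonneg[OF c1(1)] R_le_1[OF c1(1)]
    unfolding real_iter_one by auto
  have "\<exists>p. (\<forall>x. (\<lambda>n. ?g n x) \<longlonglongrightarrow> p x) \<and> p \<in> borel_measurable borel \<and> (AE x in \<mu>. p x = R c x)"
  proof (cases "c \<le> c1")
    case True
    have lower: "R c x \<le> ?g n x" for n x
      using real_iter_mono[OF c, of "R c" "R c1" n x] R_nonneg[OF c] R_mono[OF c True] R_le_1[OF c1(1)]
        real_iter_fixed[OF R_fixed[OF c], of n x] by auto
    have "(\<lambda>n. ?g n x) \<longlonglongrightarrow> R c x" for x
      by (rule tendsto_sandwich[OF _ _ tendsto_const s_tendsto[OF c]])
        (use lower one in \<open>auto intro!: always_eventually\<close>)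
    then show ?thesis by (intro exI[of _ "R c"]) auto
  next
    case False
    then have le: "R c1 x \<le> R c x" for x by (intro R_mono c1) auto
    have upper: "?g n x \<le> R c x" for n x
      using real_iter_mono[OF c, of "R c1" "R c" n x] R_nonneg[OF c1(1)] le R_le_1[OF c]
        real_iter_fixed[OF R_fixed[OF c], of n x] by auto
    have gb: "\<bar>?g n x\<bar> \<le> 1" for n x using one[of n x] by linarith
    have sg: "sqi (?g n)" for n by (rule square_integrable_bounded[OF _ gb]) measurable
    have inc: "?g n x \<le> ?g (Suc n) x" for n x
    proof (induction n arbitrary: x)
      case 0
      have "c1 * T (R c1) x \<le> c * T (R c1) x" using False by (intro mult_right_mono TR_nonneg c1) auto
      then show ?case using R_fixed[OF c1(1), of x] by (simp add: real_iter_0)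
    next
      case (Suc n)
      have "c * T (?g n) x \<le> c * T (?g (Suc n)) x" using c by (intro mult_left_mono T_mono sg Suc) auto
      then show ?case by simp
    qed
    have "convergent (\<lambda>n. ?g n x)" for x
    proof (rule Bseq_monoseq_convergent)
      show "Bseq (\<lambda>n. ?g n x)" by (rule BseqI'[of _ 1]) (simp add: gb)
      show "monoseq (\<lambda>n. ?g n x)" unfolding monoseq_Suc by (intro disjI1 allI inc)
    qed
    then obtain p where p: "\<And>x. (\<lambda>n. ?g n x) \<longlonglongrightarrow> p x" unfolding convergent_def by metis
    have pm[measurable]: "p \<in> borel_measurable borel"
      by (rule borel_measurable_LIMSEQ_real[OF p]) measurable
    have pR: "p x \<le> R c x" for x by (rule LIMSEQ_le_const2[OF p]) (use upper in auto)
    have Rp: "R c1 x \<le> p x" for x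
    proof (rule LIMSEQ_le_const[OF p])
      have "R c1 x \<le> ?g n x" for n by (induction n) (use inc in \<open>auto intro: order_trans simp del: real_iter.simps(2)\<close>)
      then show "\<exists>N. \<forall>n\<ge>N. R c1 x \<le> ?g n x" by blast
    qed
    have p0: "0 \<le> p x" for x using Rp[of x] R_nonneg[OF c1(1), of x] by linarith
    have sp: "sqi p" using p0 pR R_le_1[OF c]
      by (intro square_integrable_bounded[where B=1]) (auto intro: order_trans)
    have "p x = 1 - exp (- (c * T p x))" for x
    proof -
      have "(\<lambda>n. T (?g n) x) \<longlonglongrightarrow> T p x"
        by (rule T_tendsto[OF sg sp norm_diff_tendsto_0[OF _ pm gb p]]) measurable
      then have "(\<lambda>n. ?g (Suc n) x) \<longlonglongrightarrow> 1 - exp (- (c * T p x))"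
        unfolding real_iter.simps by (intro tendsto_intros)
      with LIMSEQ_Suc[OF p] show ?thesis by (rule LIMSEQ_unique)
    qed
    moreover have "AE x in \<mu>. 0 < p x"
      using R_pos[OF c1] by eventually_elim (use Rp in \<open>auto intro: less_le_trans\<close>)
    ultimately have "AE x in \<mu>. p x = R c x" by (intro fixed_point_unique c pm p0 pR)
    with p pm show ?thesis by blast
  qed
  then obtain p where p: "\<And>x. (\<lambda>n. ?g n x) \<longlonglongrightarrow> p x" and pm: "p \<in> borel_measurable borel"
    and pR: "AE x in \<mu>. p x = R c x" by blast
  have "(\<lambda>n. \<integral>x. ?g n x \<partial>\<mu>) \<longlonglongrightarrow> (\<integral>x. p x \<partial>\<mu>)"
  proof (rule integral_dominated_convergence[where w="\<lambda>_. 1"])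
    show "AE x in \<mu>. norm (?g n x) \<le> 1" for n
    proof (rule AE_I2)
      show "norm (?g n x) \<le> 1" for x using one[of n x] by auto
    qed
  qed (use p pm in auto)
  also have "(\<integral>x. p x \<partial>\<mu>) = (\<integral>x. R c x \<partial>\<mu>)"
    using pm pR by (intro integral_cong_AE) auto
  finally show ?thesis by (simp add: survival_eq_R[OF c])
qed

text \<open>The integrals of the complex iterates are uniformly bounded and holomorphic, so a
  subsequence converges to a holomorphic function; on the real interval the full sequence is known
  to converge to the survival probability, which is therefore the restriction of that
  function.\<close>

theorem survival_analytic_supercritical:
  assumes c1: "0 < c1" "1 < c1 * lam"
  shows "real_analytic_at surv_prob c1"
proof -
  note [measurable] = R_measurable[OF c1(1)] complex_iter_measurable[OF R_measurable[OF c1(1)]]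
  obtain w \<theta> W where w: "w \<in> borel_measurable borel" "\<And>x. 1 \<le> w x" "\<And>x. w x \<le> W" "0 \<le> \<theta>" "\<theta> < 1"
    "\<And>x. c1 * (1 - R c1 x) * T w x \<le> \<theta> * w x"
    by (rule contraction_weight[OF c1]) blast
  obtain d \<eta> where d: "0 < d" "0 < \<eta>" "\<eta> < c1"
    "exp ((c1 + \<eta>) * d * (C * W) + \<eta> * C) * ((1 + \<eta> / c1) * \<theta> * d + \<eta> * C) \<le> d"
    by (rule small_parameters[OF c1(1) w(5), where W=W]) blast
  let ?S = "ball (complex_of_real c1) \<eta>"
  let ?G = "complex_iter (R c1)"
  have zS: "norm (z - of_real c1) \<le> \<eta>" if "z \<in> ?S" for z
    using that by (auto simp: dist_norm norm_minus_commute)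
  have inv: "norm (?G z n x - of_real (R c1 x)) \<le> d * w x" if z: "z \<in> ?S" for z n x
  proof (induction n arbitrary: x)
    case 0
    then show ?case using d w(2)[of x] by simp
  next
    case (Suc n)
    have "norm ((1 - exp (- (z * cT (?G z n) x))) - of_real (R c1 x)) \<le> d * w x"
      by (rule complex_step_invariant[where f="?G z n" and d=d and \<eta>=\<eta> and \<theta>=\<theta> and W=W])
         (use c1 w d Suc zS[OF z] in \<open>auto intro: less_imp_le\<close>)
    then show ?case by simp
  qed
  define Bd where "Bd = 1 + d * W"
  have bd: "norm (?G z n x) \<le> Bd" if z: "z \<in> ?S" for z n x
  proof -
    have "norm (?G z n x) \<le> norm (?G z n x - of_real (R c1 x)) + norm (complex_of_real (R c1 x))"
      using norm_triangle_ineq[of "?G z n x - of_real (R c1 x)" "of_real (R c1 x)"] by simp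
    also have "norm (complex_of_real (R c1 x)) \<le> 1" using R_nonneg[OF c1(1)] R_le_1[OF c1(1)] by simp
    also have "norm (?G z n x - of_real (R c1 x)) \<le> d * w x" by (rule inv[OF z])
    also have "d * w x \<le> d * W" using d w by (intro mult_left_mono) auto
    finally show ?thesis by (simp add: Bd_def)
  qed
  have hol: "(\<lambda>z. ?G z n x) holomorphic_on ?S" for n x
  proof (induction n arbitrary: x)
    case (Suc n)
    have "(\<lambda>z. \<integral>y. complex_of_real (\<kappa> x y) * ?G z n y \<partial>\<mu>) holomorphic_on ?S"
    proof (rule holomorphic_on_integral[where g="\<lambda>y. \<kappa> x y * Bd"])
      show "(\<lambda>z. complex_of_real (\<kappa> x y) * ?G z n y) holomorphic_on ?S" for y
        by (intro holomorphic_intros Suc)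
      show "norm (complex_of_real (\<kappa> x y) * ?G z n y) \<le> \<kappa> x y * Bd" if "z \<in> ?S" for z y
        using bd[OF that, of n y] by (simp add: norm_mult mult_left_mono)
      show "integrable \<mu> (\<lambda>y. \<kappa> x y * Bd)" by (intro kernel_times_integrable square_integrable_const)
    qed auto
    then have "(\<lambda>z. cT (?G z n) x) holomorphic_on ?S" by (simp add: cT_def)
    then show ?case unfolding complex_iter.simps by (intro holomorphic_intros)
  qed simp
  define H where "H n z = (\<integral>x. ?G z n x \<partial>\<mu>)" for n z
  have Hhol: "H n holomorphic_on ?S" for n
    unfolding H_def by (rule holomorphic_on_integral[where g="\<lambda>_. Bd"]) (use bd hol in auto)
  have Hbd: "norm (H n z) \<le> Bd" if "z \<in> ?S" for n z
  proof -
    have i: "integrable \<mu> (?G z n)" by (rule integrable_const_bound[where B=Bd]) (use bd[OF that] in auto)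
    have "norm (H n z) \<le> (\<integral>x. norm (?G z n x) \<partial>\<mu>)" unfolding H_def by (rule integral_norm_bound)
    also have "\<dots> \<le> (\<integral>x. Bd \<partial>\<mu>)" using i by (intro integral_mono integrable_norm bd[OF that]) auto
    also have "\<dots> = Bd" using prob_space by simp
    finally show ?thesis .
  qed
  obtain g r where g: "g holomorphic_on ?S" and r: "strict_mono (r :: nat \<Rightarrow> nat)"
    and lim: "\<And>z. z \<in> ?S \<Longrightarrow> (\<lambda>n. H (r n) z) \<longlonglongrightarrow> g z"
    by (rule Montel[of ?S "range H" H]) (use Hhol Hbd in \<open>auto, blast\<close>)
  have g_eq: "g (of_real c) = of_real (surv_prob c)" if "\<bar>c - c1\<bar> < \<eta>" for c
  proof -
    have c: "0 < c" using that d(3) by linarith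
    have cS: "complex_of_real c \<in> ?S"
      using that by (simp add: dist_norm of_real_diff[symmetric] abs_minus_commute del: of_real_diff)
    have "H n (of_real c) = of_real (\<integral>x. real_iter (R c1) c n x \<partial>\<mu>)" for n
      unfolding H_def complex_iter_of_real by (rule integral_complex_of_real)
    then have "(\<lambda>n. H n (of_real c)) \<longlonglongrightarrow> of_real (surv_prob c)"
      using tendsto_of_real[OF integral_real_iter_tendsto[OF c1 c]] by simp
    from LIMSEQ_subseq_LIMSEQ[OF this r] have "(\<lambda>n. H (r n) (of_real c)) \<longlonglongrightarrow> of_real (surv_prob c)"
      by (simp add: o_def)
    with lim[OF cS] show ?thesis by (rule LIMSEQ_unique)
  qed
  \<comment> \<open>On the real axis the powers of y - c1 are real, so taking real parts of the
    complex Taylor series term by term leaves a real power series.\<close>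
  define a where "a n = Re ((deriv ^^ n) g (of_real c1) / fact n)" for n
  have "(\<lambda>n. a n * (y - c1) ^ n) sums surv_prob y" if y: "\<bar>y - c1\<bar> < \<eta>" for y
  proof -
    have yS: "complex_of_real y \<in> ?S"
      using y by (simp add: dist_norm of_real_diff[symmetric] abs_minus_commute del: of_real_diff)
    from sums_Re[OF holomorphic_power_series[OF g yS]]
    have "(\<lambda>n. Re ((deriv ^^ n) g (of_real c1) / fact n * (of_real y - of_real c1) ^ n)) sums Re (g (of_real y))" .
    moreover have "Re ((deriv ^^ n) g (of_real c1) / fact n * (of_real y - of_real c1) ^ n) = a n * (y - c1) ^ n" for n
    proof -
      have "(complex_of_real y - of_real c1) ^ n = of_real ((y - c1) ^ n)" by simp
      then show ?thesis by (simp only: a_def times_complex.sel Re_complex_of_real Im_complex_of_real mult_zero_right diff_zero)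
    qed
    ultimately show ?thesis using g_eq[OF y] by simp
  qed
  with d(2) show ?thesis unfolding real_analytic_at_def by blast
qed

end


section \<open>The phase transition\<close>

text \<open>The consequence of analyticity that the critical point will violate.\<close>

lemma real_analytic_at_imp_differentiable:
  assumes "real_analytic_at f x"
  obtains L where "(f has_real_derivative L) (at x)"
proof -
  obtain a r where r: "0 < r" and s: "\<And>y. \<bar>y - x\<bar> < r \<Longrightarrow> (\<lambda>n. a n * (y - x) ^ n) sums f y"
    using assms unfolding real_analytic_at_def by blast
  let ?g = "\<lambda>t. \<Sum>n. a n * t ^ n"
  have "summable (\<lambda>n. a n * (r / 2) ^ n)" using s[of "x + r / 2"] r by (auto simp: sums_iff)
  from termdiffs_strong[OF this, of 0] r
  have "(?g has_real_derivative (\<Sum>n. diffs a n * 0 ^ n)) (at (x - x))" by simp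
  moreover have "((\<lambda>y. y - x) has_real_derivative 1) (at x)"
    by (auto intro!: derivative_eq_intros)
  ultimately have "((\<lambda>y. ?g (y - x)) has_real_derivative (\<Sum>n. diffs a n * 0 ^ n) * 1) (at x)"
    by (rule DERIV_chain2[where g="\<lambda>y. y - x"])
  then have "((\<lambda>y. ?g (y - x)) has_real_derivative (\<Sum>n. diffs a n * 0 ^ n)) (at x)" by simp
  then have "(f has_real_derivative (\<Sum>n. diffs a n * 0 ^ n)) (at x)"
  proof (rule has_field_derivative_transform_within[OF _ r])
    fix y assume "dist y x < r"
    then show "?g (y - x) = f y" using s[of y] by (simp add: dist_real_def sums_iff)
  qed simp
  then show ?thesis by (rule that)
qed

context kernel_with_eigenfunction
begin

section \<open>Behaviour at the critical value\<close>

abbreviation c0 :: real where "c0 \<equiv> inverse lam"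

text \<open>The expansion was obtained in the excess, which equals \<lambda> \<epsilon> at c0 +
  \<epsilon>; this explains the factor \<open>lam\<close>, the inverse of c0.\<close>

definition slope :: real where
  "slope = 2 * lam * ((\<integral>x. \<psi> x \<partial>\<mu>) * (\<integral>x. (\<psi> x)\<^sup>2 \<partial>\<mu>) / (\<integral>x. (\<psi> x) ^ 3 \<partial>\<mu>))"

lemma slope_pos: "0 < slope"
  unfolding slope_def using lam_pos int\<psi>_pos integral_\<psi>_power_pos[of 2] integral_\<psi>_power_pos[of 3]
  by (intro mult_pos_pos divide_pos_pos) auto

lemma c0_pos: "0 < c0" using lam_pos by simp

lemma le_c0_iff: "c * lam \<le> 1 \<longleftrightarrow> c \<le> c0"
  using lam_pos by (simp add: field_simps)

lemma survival_near_c0: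
  obtains K e where "0 < K" "0 < e"
    "\<And>\<epsilon>. 0 < \<epsilon> \<Longrightarrow> \<epsilon> \<le> e \<Longrightarrow> \<bar>surv_prob (c0 + \<epsilon>) - slope * \<epsilon>\<bar> \<le> K * \<epsilon>\<^sup>2"
proof -
  obtain \<delta> K where k: "0 < \<delta>" "0 < K"
    "\<And>c. 0 < excess c \<Longrightarrow> excess c \<le> \<delta> \<Longrightarrow>
      \<bar>surv_prob c - 2 * ((\<integral>x. \<psi> x \<partial>\<mu>) * (\<integral>x. \<psi> x ^ 2 \<partial>\<mu>) / (\<integral>x. \<psi> x ^ 3 \<partial>\<mu>)) * excess c\<bar>
        \<le> K * (excess c)\<^sup>2"
    by (rule survival_expansion) blast
  show ?thesis
  proof (rule that[of "K * lam\<^sup>2" "\<delta> / lam"])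
    show "0 < K * lam\<^sup>2" "0 < \<delta> / lam" using k lam_pos by auto
    fix \<epsilon> :: real assume \<epsilon>: "0 < \<epsilon>" "\<epsilon> \<le> \<delta> / lam"
    have ex: "excess (c0 + \<epsilon>) = lam * \<epsilon>" using lam_pos by (simp add: excess_def distrib_right)
    have "0 < lam * \<epsilon>" "lam * \<epsilon> \<le> \<delta>" using \<epsilon> lam_pos by (auto simp: field_simps)
    from k(3)[of "c0 + \<epsilon>", unfolded ex, OF this]
    show "\<bar>surv_prob (c0 + \<epsilon>) - slope * \<epsilon>\<bar> \<le> K * lam\<^sup>2 * \<epsilon>\<^sup>2"
      by (simp add: slope_def power_mult_distrib mult_ac)
  qed
qed

lemma survival_c0: "surv_prob c0 = 0"
  using lam_pos by (intro survival_eq_0) auto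

lemma survival_expansion_bigo:
  "(\<lambda>\<epsilon>. surv_prob (c0 + \<epsilon>) - slope * \<epsilon>) \<in> O[at_right 0](\<lambda>\<epsilon>. \<epsilon>\<^sup>2)"
proof -
  obtain K e where k: "0 < K" "0 < e"
    "\<And>\<epsilon>. 0 < \<epsilon> \<Longrightarrow> \<epsilon> \<le> e \<Longrightarrow> \<bar>surv_prob (c0 + \<epsilon>) - slope * \<epsilon>\<bar> \<le> K * \<epsilon>\<^sup>2"
    by (rule survival_near_c0) blast
  show ?thesis
  proof (rule bigoI[where c=K])
    have "eventually (\<lambda>\<epsilon>. \<epsilon> \<in> {0<..<e}) (at_right 0)" using k by (intro eventually_at_right_real)
    then show "\<forall>\<^sub>F \<epsilon> in at_right 0. norm (surv_prob (c0 + \<epsilon>) - slope * \<epsilon>) \<le> K * norm (\<epsilon>\<^sup>2)"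
      by eventually_elim (use k(3) in auto)
  qed
qed

lemma survival_right_derivative:
  "(surv_prob has_real_derivative slope) (at_right c0)"
  unfolding has_field_derivative_iff
proof -
  obtain K e where k: "0 < K" "0 < e"
    "\<And>\<epsilon>. 0 < \<epsilon> \<Longrightarrow> \<epsilon> \<le> e \<Longrightarrow> \<bar>surv_prob (c0 + \<epsilon>) - slope * \<epsilon>\<bar> \<le> K * \<epsilon>\<^sup>2"
    by (rule survival_near_c0) blast
  let ?q = "\<lambda>y. (surv_prob y - surv_prob c0) / (y - c0)"
  have "((\<lambda>y. ?q y - slope) \<longlongrightarrow> 0) (at_right c0)"
  proof (rule Lim_null_comparison)
    have "((\<lambda>y. K * (y - c0)) \<longlongrightarrow> K * (c0 - c0)) (at_right c0)" by (intro tendsto_intros)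
    then show "((\<lambda>y. K * (y - c0)) \<longlongrightarrow> 0) (at_right c0)" by simp
    have "eventually (\<lambda>y. y \<in> {c0<..<c0 + e}) (at_right c0)" using k by (intro eventually_at_right_real) simp
    then show "\<forall>\<^sub>F y in at_right c0. norm (?q y - slope) \<le> K * (y - c0)"
    proof eventually_elim
      case (elim y)
      then have "\<bar>surv_prob y - slope * (y - c0)\<bar> \<le> K * (y - c0)\<^sup>2"
        using k(3)[of "y - c0"] by simp
      then have "\<bar>surv_prob y - slope * (y - c0)\<bar> / (y - c0) \<le> K * (y - c0)"
        using elim by (simp add: divide_le_eq power2_eq_square mult_ac)
      moreover have "?q y - slope = (surv_prob y - slope * (y - c0)) / (y - c0)"
        using elim survival_c0 by (simp add: field_simps)
      ultimately show ?case using elim by (simp only: real_norm_def abs_divide) simp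
    qed
  qed
  then show "(?q \<longlongrightarrow> slope) (at_right c0)" by (simp only: LIM_zero_iff)
qed

text \<open>The one-sided derivatives differ: 0 from the left, where the survival probability
  vanishes, and the positive slope from the right.\<close>

lemma not_analytic_at_c0: "\<not> real_analytic_at surv_prob c0"
proof
  assume "real_analytic_at surv_prob c0"
  then obtain L where L: "(surv_prob has_real_derivative L) (at c0)"
    by (rule real_analytic_at_imp_differentiable)
  let ?q = "\<lambda>y. (surv_prob y - surv_prob c0) / (y - c0)"
  have q: "(?q \<longlongrightarrow> L) (at c0)" using L unfolding has_field_derivative_iff .
  have "(?q \<longlongrightarrow> L) (at_right c0)" by (rule tendsto_within_subset[OF q]) auto
  moreover have "(?q \<longlongrightarrow> slope) (at_right c0)"
    using survival_right_derivative unfolding has_field_derivative_iff .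
  ultimately have "L = slope" using tendsto_unique trivial_limit_at_right_real by blast
  have "(?q \<longlongrightarrow> L) (at_left c0)" by (rule tendsto_within_subset[OF q]) auto
  moreover have "(?q \<longlongrightarrow> 0) (at_left c0)"
  proof (rule tendsto_eventually)
    have "eventually (\<lambda>y. y \<in> {0<..<c0}) (at_left c0)" using c0_pos by (rule eventually_at_left_real)
    then show "\<forall>\<^sub>F y in at_left c0. ?q y = 0"
    proof eventually_elim
      case (elim y)
      then have "surv_prob y = 0" using le_c0_iff[of y] by (intro survival_eq_0) auto
      then show ?case by (simp add: survival_c0)
    qed
  qed
  ultimately have "L = 0" using tendsto_unique trivial_limit_at_left_real by blast
  with \<open>L = slope\<close> slope_pos show False by simp
qed

lemma analytic_iff:
  assumes c: "0 < c"
  shows "real_analytic_at surv_prob c \<longleftrightarrow> c \<noteq> c0"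
proof
  assume "real_analytic_at surv_prob c"
  then show "c \<noteq> c0" using not_analytic_at_c0 by blast
next
  assume "c \<noteq> c0"
  then consider "c < c0" | "c0 < c" by linarith
  then show "real_analytic_at surv_prob c"
  proof cases
    case 1
    have "(\<lambda>n. 0 * (y - c) ^ n) sums surv_prob y" if "\<bar>y - c\<bar> < min c (c0 - c)" for y
    proof -
      have "0 < y" "y \<le> c0" using that by linarith+
      then have "surv_prob y = 0" using le_c0_iff[of y] by (intro survival_eq_0) auto
      then show ?thesis by simp
    qed
    moreover have "0 < min c (c0 - c)" using 1 c by simp
    ultimately show ?thesis unfolding real_analytic_at_def by (intro exI[of _ "\<lambda>_. 0"]) blast
  next
    case 2
    then have "1 < c * lam" using le_c0_iff[of c] by linarith
    with c show ?thesis by (rule survival_analytic_supercritical)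
  qed
qed

lemma phase_transition: "phase_transition_exponent surv_prob c0 1"
  unfolding phase_transition_exponent_def
proof (intro conjI allI impI)
  show "0 < c0" by (rule c0_pos)
  show "surv_prob c = 0" if "0 < c \<and> c \<le> c0" for c
    using that le_c0_iff[of c] by (intro survival_eq_0) auto
  show "0 < surv_prob c" if "c0 < c" for c
    using that le_c0_iff[of c] c0_pos by (intro survival_pos) linarith+
  obtain K e where k: "0 < K" "0 < e"
    "\<And>\<epsilon>. 0 < \<epsilon> \<Longrightarrow> \<epsilon> \<le> e \<Longrightarrow> \<bar>surv_prob (c0 + \<epsilon>) - slope * \<epsilon>\<bar> \<le> K * \<epsilon>\<^sup>2"
    by (rule survival_near_c0) blast
  \<comment> \<open>Below slope / (2 K) the error K \<epsilon>^2 is at most half of the linear term,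
    so the survival probability lies between 1/2 and 3/2 of it.\<close>
  have "0 < min e (slope / (2 * K))" using k slope_pos by simp
  then have "eventually (\<lambda>\<epsilon>. \<epsilon> \<in> {0<..<min e (slope / (2 * K))}) (at_right 0)"
    by (rule eventually_at_right_real)
  then have ev: "\<forall>\<^sub>F \<epsilon> in at_right 0. 0 < \<epsilon> \<and> \<bar>surv_prob (c0 + \<epsilon>) - slope * \<epsilon>\<bar> \<le> slope / 2 * \<epsilon>"
  proof eventually_elim
    case (elim \<epsilon>)
    then have \<epsilon>: "0 < \<epsilon>" "\<epsilon> \<le> e" "\<epsilon> \<le> slope / (2 * K)" by auto
    have "K * \<epsilon> \<le> K * (slope / (2 * K))" using k \<epsilon> by (intro mult_left_mono) auto
    also have "\<dots> = slope / 2" using k by simp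
    finally have "K * \<epsilon> * \<epsilon> \<le> slope / 2 * \<epsilon>" using \<epsilon> by (intro mult_right_mono) auto
    moreover have "K * \<epsilon>\<^sup>2 = K * \<epsilon> * \<epsilon>" by (simp add: power2_eq_square)
    ultimately show ?case using k(3)[OF \<epsilon>(1,2)] \<epsilon>(1) by linarith
  qed
  show "(\<lambda>\<epsilon>. surv_prob (c0 + \<epsilon>)) \<in> \<Theta>[at_right 0](\<lambda>\<epsilon>. \<epsilon> powr 1)"
  proof (rule bigthetaI)
    show "(\<lambda>\<epsilon>. surv_prob (c0 + \<epsilon>)) \<in> O[at_right 0](\<lambda>\<epsilon>. \<epsilon> powr 1)"
    proof (rule bigoI[where c="3 / 2 * slope"])
      show "\<forall>\<^sub>F \<epsilon> in at_right 0. norm (surv_prob (c0 + \<epsilon>)) \<le> 3 / 2 * slope * norm (\<epsilon> powr 1)"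
        using ev
      proof eventually_elim
        case (elim \<epsilon>)
        then have "0 < slope * \<epsilon>" using slope_pos by simp
        with elim have "\<bar>surv_prob (c0 + \<epsilon>)\<bar> \<le> 3 / 2 * (slope * \<epsilon>)" by linarith
        with elim show ?case by simp
      qed
    qed
    show "(\<lambda>\<epsilon>. surv_prob (c0 + \<epsilon>)) \<in> \<Omega>[at_right 0](\<lambda>\<epsilon>. \<epsilon> powr 1)"
    proof (rule landau_omega.bigI[where c="slope / 2"])
      show "0 < slope / 2" using slope_pos by simp
      show "\<forall>\<^sub>F \<epsilon> in at_right 0. slope / 2 * norm (\<epsilon> powr 1) \<le> norm (surv_prob (c0 + \<epsilon>))"
        using ev
      proof eventually_elim
        case (elim \<epsilon>)
        then have "slope / 2 * \<epsilon> \<le> \<bar>surv_prob (c0 + \<epsilon>)\<bar>" by linarith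
        with elim show ?case by simp
      qed
    qed
  qed
qed

end

section \<open>Passage to arbitrary eigenfunctions\<close>

lemma (in bounded_square_kernel) eigenfunction_iff:
  "eigenfunction \<mu> \<kappa> r f \<longleftrightarrow> sqi f \<and> \<not> (AE x in \<mu>. f x = 0) \<and> (AE x in \<mu>. T f x = r * f x)"
  unfolding eigenfunction_def square_integrable_def[symmetric]
  using kernel_times_integrable by (auto simp: square_integrable_def)

theorem theorem3p17:
  fixes \<mu> :: "'a::{metric_space, second_countable_topology} measure"
    and \<kappa> :: "'a \<Rightarrow> 'a \<Rightarrow> real"
    and \<rho> :: "real \<Rightarrow> real"
    and c\<^sub>0 :: real
  assumes "ground_space \<mu>"
    and "is_kernel \<kappa>"
    and "0 < kernel_op_norm \<mu> \<kappa>"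
    and "irreducible_kernel \<mu> \<kappa>"
    and "(SUP x. \<integral>\<^sup>+ y. ennreal ((\<kappa> x y)\<^sup>2) \<partial>\<mu>) < \<infinity>"
    and \<rho>_def: "\<rho> = (\<lambda>c. survival \<mu> (\<lambda>x y. c * \<kappa> x y))"
    and c\<^sub>0_def: "c\<^sub>0 = inverse (enn2real (kernel_op_norm \<mu> \<kappa>))"
  shows "(\<forall>c>0. real_analytic_at \<rho> c \<longleftrightarrow> c \<noteq> c\<^sub>0) \<and>
    kernel_op_norm \<mu> \<kappa> < \<infinity> \<and>
    (\<exists>\<psi>. eigenfunction \<mu> \<kappa> (enn2real (kernel_op_norm \<mu> \<kappa>)) \<psi>) \<and>
    (\<forall>\<psi>. eigenfunction \<mu> \<kappa> (enn2real (kernel_op_norm \<mu> \<kappa>)) \<psi> \<longrightarrow>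
       ess_bounded \<mu> \<psi> \<and>
       (let D = 2 * inverse c\<^sub>0 * ((\<integral>x. \<psi> x \<partial>\<mu>) * (\<integral>x. (\<psi> x)\<^sup>2 \<partial>\<mu>) / (\<integral>x. (\<psi> x) ^ 3 \<partial>\<mu>))
        in (\<lambda>\<epsilon>. \<rho> (c\<^sub>0 + \<epsilon>) - D * \<epsilon>) \<in> O[at_right 0](\<lambda>\<epsilon>. \<epsilon>\<^sup>2) \<and>
           (\<rho> has_real_derivative D) (at_right c\<^sub>0) \<and>
           D > 0)) \<and>
    phase_transition_exponent \<rho> c\<^sub>0 1"
proof -
  interpret prob_space \<mu> using assms(1) by (simp add: ground_space_def)
  have sets_\<mu> [measurable_cong]: "sets \<mu> = sets borel" using assms(1) by (simp add: ground_space_def)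
  define S where "S = (SUP x. \<integral>\<^sup>+ y. ennreal ((\<kappa> x y)\<^sup>2) \<partial>\<mu>)"
  have meas2[measurable]: "(\<lambda>(x, y). \<kappa> x y) \<in> borel_measurable (borel \<Otimes>\<^sub>M borel)"
    using assms(2) by (simp add: is_kernel_def borel_prod)
  have meas[measurable]: "\<kappa> x \<in> borel_measurable \<mu>" for x by measurable
  have le_S: "(\<integral>\<^sup>+ y. ennreal ((\<kappa> x y)\<^sup>2) \<partial>\<mu>) \<le> S" for x unfolding S_def by (rule SUP_upper) simp
  have S: "S < \<infinity>" using assms(5) by (simp add: S_def)
  have sq: "square_integrable \<mu> (\<kappa> x)" for x
    unfolding square_integrable_def using le_less_trans[OF le_S[of x] S]
    by (auto intro!: integrableI_bounded meas)
  \<comment> \<open>The summand 1 makes the bound positive whatever the supremum is.\<close>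
  define C where "C = sqrt (enn2real S) + 1"
  have bound: "norm2 \<mu> (\<kappa> x) \<le> C" for x
  proof -
    have "ennreal (\<integral>y. (\<kappa> x y)\<^sup>2 \<partial>\<mu>) \<le> S"
      using le_S[of x] nn_integral_eq_integral[OF square_integrable_square[OF sq[of x]]] by simp
    then have "(\<integral>y. (\<kappa> x y)\<^sup>2 \<partial>\<mu>) \<le> enn2real S"
      using enn2real_mono[of "ennreal (\<integral>y. (\<kappa> x y)\<^sup>2 \<partial>\<mu>)" S] S by simp
    then have "norm2 \<mu> (\<kappa> x) \<le> sqrt (enn2real S)" unfolding norm2_def by (rule real_sqrt_le_mono)
    then show ?thesis by (simp add: C_def)
  qed
  have C: "0 < C" unfolding C_def by (intro add_nonneg_pos) auto
  interpret bounded_square_kernel \<mu> \<kappa> C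
    by unfold_locales (use assms(2) sets_\<mu> meas2 sq bound C in \<open>auto simp: is_kernel_def\<close>)
  have "0 < lam" using assms(3) op_norm_finite by (simp add: lam_def enn2real_positive_iff)
  then interpret irreducible_kernel_op \<mu> \<kappa> C by unfold_locales (rule assms(4))
  obtain \<psi>\<^sub>0 B where \<psi>\<^sub>0: "\<psi>\<^sub>0 \<in> borel_measurable borel" "\<And>x. 0 \<le> \<psi>\<^sub>0 x" "\<And>x. \<psi>\<^sub>0 x \<le> B"
    "\<And>x. T \<psi>\<^sub>0 x = lam * \<psi>\<^sub>0 x" "AE x in \<mu>. 0 < \<psi>\<^sub>0 x"
    by (rule exists_positive_eigenfunction) blast
  interpret kernel_with_eigenfunction \<mu> \<kappa> C \<psi>\<^sub>0 B by unfold_locales (use \<psi>\<^sub>0 in auto)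
  have \<rho>: "\<rho> = surv_prob" and c\<^sub>0: "c\<^sub>0 = c0"
    using \<rho>_def c\<^sub>0_def by (auto simp: lam_def)
  have ex: "eigenfunction \<mu> \<kappa> lam \<psi>\<^sub>0"
    unfolding eigenfunction_iff
  proof (intro conjI notI)
    assume "AE x in \<mu>. \<psi>\<^sub>0 x = 0"
    with \<psi>\<^sub>0(5) have "AE x in \<mu>. False" by eventually_elim simp
    then show False by simp
  qed (use \<psi>\<^sub>0 \<psi>_sqi in auto)
  have all: "ess_bounded \<mu> \<psi> \<and>
      2 * inverse c\<^sub>0 * ((\<integral>x. \<psi> x \<partial>\<mu>) * (\<integral>x. (\<psi> x)\<^sup>2 \<partial>\<mu>) / (\<integral>x. (\<psi> x) ^ 3 \<partial>\<mu>)) = slope"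
    if "eigenfunction \<mu> \<kappa> lam \<psi>" for \<psi>
  proof -
    from that have s: "sqi \<psi>" and ne: "\<not> (AE x in \<mu>. \<psi> x = 0)" and eig: "AE x in \<mu>. T \<psi> x = lam * \<psi> x"
      unfolding eigenfunction_iff by auto
    obtain t where t: "AE x in \<mu>. \<psi> x = t * \<psi>\<^sub>0 x" by (rule eigenfunction_multiple[OF s eig])
    have "t \<noteq> 0" using t ne by auto
    have [measurable]: "\<psi> \<in> borel_measurable borel" using s by auto
    have "AE x in \<mu>. \<bar>\<psi> x\<bar> \<le> \<bar>t\<bar> * B"
      using t by eventually_elim (use \<psi>\<^sub>0(2,3) in \<open>auto simp: abs_mult intro: mult_left_mono\<close>)
    then have 1: "ess_bounded \<mu> \<psi>" unfolding ess_bounded_def by blast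
    have pow: "(\<integral>x. \<psi> x ^ k \<partial>\<mu>) = t ^ k * (\<integral>x. \<psi>\<^sub>0 x ^ k \<partial>\<mu>)" for k
    proof -
      have "(\<integral>x. \<psi> x ^ k \<partial>\<mu>) = (\<integral>x. t ^ k * \<psi>\<^sub>0 x ^ k \<partial>\<mu>)"
        by (intro integral_cong_AE) (use t in \<open>auto simp: power_mult_distrib elim!: eventually_mono\<close>)
      then show ?thesis by simp
    qed
    \<comment> \<open>Numerator and denominator both scale by t^3, so the coefficient is the same
      for every eigenfunction, including those of negative sign.\<close>
    have "(\<integral>x. \<psi> x \<partial>\<mu>) * (\<integral>x. (\<psi> x)\<^sup>2 \<partial>\<mu>) / (\<integral>x. (\<psi> x) ^ 3 \<partial>\<mu>) =
      (\<integral>x. \<psi>\<^sub>0 x \<partial>\<mu>) * (\<integral>x. (\<psi>\<^sub>0 x)\<^sup>2 \<partial>\<mu>) / (\<integral>x. (\<psi>\<^sub>0 x) ^ 3 \<partial>\<mu>)"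
      using pow[of 1] pow[of 2] pow[of 3] \<open>t \<noteq> 0\<close> by (simp add: power2_eq_square power3_eq_cube)
    with 1 show ?thesis by (simp add: slope_def c\<^sub>0)
  qed
  show ?thesis
    unfolding lam_def[symmetric] Let_def
  proof (intro conjI allI impI)
    show "kernel_op_norm \<mu> \<kappa> < \<infinity>" by (rule op_norm_finite)
    show "\<exists>\<psi>. eigenfunction \<mu> \<kappa> lam \<psi>" using ex by blast
    show "real_analytic_at \<rho> c \<longleftrightarrow> c \<noteq> c\<^sub>0" if "0 < c" for c
      unfolding \<rho> c\<^sub>0 by (rule analytic_iff[OF that])
    show "phase_transition_exponent \<rho> c\<^sub>0 1"
      unfolding \<rho> c\<^sub>0 by (rule phase_transition)
    fix \<psi> assume "eigenfunction \<mu> \<kappa> lam \<psi>"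
    note a = all[OF this]
    let ?D = "2 * inverse c\<^sub>0 * ((\<integral>x. \<psi> x \<partial>\<mu>) * (\<integral>x. (\<psi> x)\<^sup>2 \<partial>\<mu>) / (\<integral>x. (\<psi> x) ^ 3 \<partial>\<mu>))"
    have D: "?D = slope" using a by blast
    show "ess_bounded \<mu> \<psi>" using a by blast
    show "(\<lambda>\<epsilon>. \<rho> (c\<^sub>0 + \<epsilon>) - ?D * \<epsilon>) \<in> O[at_right 0](\<lambda>\<epsilon>. \<epsilon>\<^sup>2)"
      unfolding D unfolding \<rho> c\<^sub>0 by (rule survival_expansion_bigo)
    show "(\<rho> has_real_derivative ?D) (at_right c\<^sub>0)"
      unfolding D unfolding \<rho> c\<^sub>0 by (rule survival_right_derivative)
    show "0 < ?D" unfolding D by (rule slope_pos)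
  qed
qed

end
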